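(* Let $n\ge 0$ and $r\ge 1$ be integers, let $S\to\mathbb{F}_n$ be the blow-up of the Hirzebruch surface $\mathbb{F}_n$ at $r$ general points, and let $a,b\ge 0$ be integers. The homogeneous $(-1)$-curves of multiplicity one, that is, the $(-1)$-curves on $S$ belonging to $\mathcal{L}_n(a,b,1^r)$, are exactly the following: (i) $\mathcal{L}_1(0,2,1^5)$ (so $n=1$, $a=0$, $b=2$, $r=5$); (ii) $\mathcal{L}_n(1,0,1)$ (so $a=1$, $b=0$, $r=1$); (iii) $\mathcal{L}_n(e,1,1^{2e+n+1})$ with $e\ge 0$ an integer (so $a=e$, $b=1$, $r=2e+n+1$); where for $n=0$ the list is understood up to exchanging the roles of $F$ and $H$ (i.e. $\mathcal{L}_0(a,b,1^r)$ is identified with $\mathcal{L}_0(b,a,1^r)$).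
   Context: Work over $\mathbb{C}$. $\mathbb{F}_n=\mathbb{P}(\mathcal{O}_{\mathbb{P}^1}\oplus\mathcal{O}_{\mathbb{P}^1}(n))$; $F,H$ are the generators of $\mathrm{Pic}(\mathbb{F}_n)$ with $F^2=0$, $H^2=n$, $F\cdot H=1$. $\pi:S\to\mathbb{F}_n$ is the blow-up at general points $p_1,\dots,p_r$ (in a suitable nonempty Zariski-open subset of $(\mathbb{F}_n)^r$; in particular none lies on the curve $\Gamma_n\in|H-nF|$ of self-intersection $-n$), with exceptional curves $E_1,\dots,E_r$. $\mathcal{L}_n(a,b,m^r)$ denotes the linear system of curves in $|aF+bH|$ with multiplicity at least $m$ at each $p_i$, identified with the complete linear system of $a\pi^*F+b\pi^*H-m\sum_iE_i$ on $S$. A $(-1)$-curve on $S$ is an irreducible curve $E$ with $E^2=E\cdot K_S=-1$. *)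

theory Defs
  imports "HOL-Analysis.Analysis"
begin

section \<open>Polynomial functions\<close>

text \<open>The algebra of polynomial expressions over the complex numbers in a given set of
  coordinate functions. Over an infinite field these are the same as polynomials.\<close>

inductive_set poly_funs :: "('a \<Rightarrow> complex) set \<Rightarrow> ('a \<Rightarrow> complex) set"
  for X :: "('a \<Rightarrow> complex) set" where
  const: "(\<lambda>_. c) \<in> poly_funs X"
| coord: "x \<in> X \<Longrightarrow> x \<in> poly_funs X"
| add: "f \<in> poly_funs X \<Longrightarrow> g \<in> poly_funs X \<Longrightarrow> (\<lambda>z. f z + g z) \<in> poly_funs X"
| mult: "f \<in> poly_funs X \<Longrightarrow> g \<in> poly_funs X \<Longrightarrow> (\<lambda>z. f z * g z) \<in> poly_funs X"

type_synonym cvec4 = "complex^4"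

section \<open>Hirzebruch surfaces\<close>

text \<open>The Hirzebruch surface of index \<open>n\<close> is the quotient of
  \<open>(\<complex>\<^sup>2 - 0) \<times> (\<complex>\<^sup>2 - 0)\<close>, with coordinates \<open>((z\<^sub>1, z\<^sub>2), (z\<^sub>3, z\<^sub>4))\<close>, by the free action
  of the torus \<open>(\<complex> - 0)\<^sup>2\<close> given below: \<open>z\<^sub>1, z\<^sub>2\<close> are the homogeneous coordinates of the base
  (class \<open>F\<close>), \<open>z\<^sub>3\<close> is the equation of the curve of self-intersection \<open>-n\<close> (class \<open>H - n F\<close>)
  and \<open>z\<^sub>4\<close> has class \<open>H\<close>. A point is represented by its orbit.\<close>

definition cox_points :: "(cvec4) set" where
  "cox_points = {z. (z$1 \<noteq> 0 \<or> z$2 \<noteq> 0) \<and> (z$3 \<noteq> 0 \<or> z$4 \<noteq> 0)}"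

definition torus_act :: "nat \<Rightarrow> complex \<Rightarrow> complex \<Rightarrow> cvec4 \<Rightarrow> cvec4" where
  "torus_act n l m z = vector [l * z$1, l * z$2, m * z$3 / l ^ n, m * z$4]"

definition orbit :: "nat \<Rightarrow> cvec4 \<Rightarrow> (cvec4) set" where
  "orbit n z = {torus_act n l m z | l m. l \<noteq> 0 \<and> m \<noteq> 0}"

definition hirzebruch :: "nat \<Rightarrow> (cvec4) set set" where
  "hirzebruch n = orbit n ` cox_points"

definition negative_curve :: "nat \<Rightarrow> (cvec4) set set" where
  "negative_curve n = {x \<in> hirzebruch n. \<forall>z\<in>x. z$3 = 0}"

text \<open>Global sections of the line bundle of class \<open>a F + b H\<close>: polynomials of bidegree \<open>(a, b)\<close>
  for the torus action (by Hartogs, regular functions on \<^const>\<open>cox_points\<close> are polynomials).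
  The nonzero ones, up to scalars, are the effective divisors in \<open>|a F + b H|\<close>.\<close>

definition hirz_sections :: "nat \<Rightarrow> int \<Rightarrow> int \<Rightarrow> (cvec4 \<Rightarrow> complex) set" where
  "hirz_sections n a b =
     {f \<in> poly_funs (range (\<lambda>i z. z$i)).
        \<forall>l m z. l \<noteq> 0 \<longrightarrow> m \<noteq> 0 \<longrightarrow> f (torus_act n l m z) = l powi a * m powi b * f z}"

text \<open>The product of \<open>r\<close> copies of the surface carries the quotient of the Zariski topology of
  \<open>(\<complex>\<^sup>4)\<^sup>r\<close>, restricted to tuples in \<^const>\<open>cox_points\<close>.\<close>

definition zariski_open_prod :: "nat \<Rightarrow> nat \<Rightarrow> (nat \<Rightarrow> (cvec4) set) set \<Rightarrow> bool" where
  "zariski_open_prod n r U \<longleftrightarrow>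
     U \<subseteq> ({..<r} \<rightarrow>\<^sub>E hirzebruch n) \<and>
     (\<exists>P \<subseteq> poly_funs {(\<lambda>z. z k $ i) | k i. k < r}. \<forall>z :: nat \<Rightarrow> cvec4.
        (\<forall>k<r. z k \<in> cox_points) \<longrightarrow>
        ((\<lambda>k\<in>{..<r}. orbit n (z k)) \<in> U \<longleftrightarrow> (\<exists>f\<in>P. f z \<noteq> 0)))"

section \<open>The blow-up as a set of points\<close>

text \<open>The tangent space of the surface at the point represented by \<open>z\<close> is
  \<open>\<complex>\<^sup>4\<close> modulo the tangent space of the orbit at \<open>z\<close>, which is spanned by
  the derivatives of \<^const>\<open>torus_act\<close> at the identity.\<close>

definition orbit_tangent :: "nat \<Rightarrow> cvec4 \<Rightarrow> (cvec4) set" where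
  "orbit_tangent n z =
     {vector [c * z$1, c * z$2, (d - of_nat n * c) * z$3, d * z$4] | c d. True}"

text \<open>The tangent direction given by a vector \<open>w\<close> at \<open>z\<close>, as the set of all pairs representing it.\<close>

definition tangent_dir :: "nat \<Rightarrow> cvec4 \<Rightarrow> cvec4 \<Rightarrow> (cvec4 \<times> cvec4) set" where
  "tangent_dir n z w =
     {(torus_act n l m z, torus_act n l m (c *s w + d)) | l m c d.
        l \<noteq> 0 \<and> m \<noteq> 0 \<and> c \<noteq> 0 \<and> d \<in> orbit_tangent n z}"

text \<open>Points of the blow-up: either points of the surface different from the centres, or tangent
  directions at a centre (the points of an exceptional curve).\<close>

datatype blowup_point =
    Outside "(cvec4) set"
  | Direction "(cvec4 \<times> cvec4) set"

definition blowup :: "nat \<Rightarrow> nat \<Rightarrow> (nat \<Rightarrow> (cvec4) set) \<Rightarrow> blowup_point set" where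
  "blowup n r p =
     Outside ` (hirzebruch n - p ` {..<r}) \<union>
     {Direction (tangent_dir n z w) | i z w. i < r \<and> z \<in> p i \<and> w \<notin> orbit_tangent n z}"

section \<open>Divisor classes and their sections\<close>

text \<open>\<open>Pic a b m\<close> is the class \<open>a \<pi>\<^sup>*F + b \<pi>\<^sup>*H - (\<Sum>i<r. m i * E\<^sub>i)\<close>; only the values of \<open>m\<close>
  below \<open>r\<close> matter. The intersection form is determined by \<open>F\<^sup>2 = 0\<close>, \<open>H\<^sup>2 = n\<close>, \<open>F H = 1\<close>,
  \<open>E\<^sub>i\<^sup>2 = -1\<close> and orthogonality of the \<open>E\<^sub>i\<close> to each other and to pullbacks; the canonical class
  is \<open>\<pi>\<^sup>*((n - 2) F - 2 H) + (\<Sum>i<r. E\<^sub>i)\<close>.\<close>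

datatype pic = Pic (cF: int) (cH: int) (mul: "nat \<Rightarrow> int")

definition pic_diff :: "pic \<Rightarrow> pic \<Rightarrow> pic" where
  "pic_diff D D' = Pic (cF D - cF D') (cH D - cH D') (\<lambda>i. mul D i - mul D' i)"

definition intersection :: "nat \<Rightarrow> nat \<Rightarrow> pic \<Rightarrow> pic \<Rightarrow> int" where
  "intersection n r D D' =
     cF D * cH D' + cH D * cF D' + int n * cH D * cH D' - (\<Sum>i<r. mul D i * mul D' i)"

definition canonical_class :: "nat \<Rightarrow> pic" where
  "canonical_class n = Pic (int n - 2) (-2) (\<lambda>_. -1)"

text \<open>\<open>f\<close> vanishes to order at least \<open>k\<close> at \<open>z\<close> along the line in direction \<open>w\<close>. Having this for
  all \<open>w\<close> means multiplicity at least \<open>k\<close> at \<open>z\<close>, which is also the multiplicity at the image of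
  \<open>z\<close> on the surface, because the quotient map is smooth.\<close>

definition vanishes_along :: "(cvec4 \<Rightarrow> complex) \<Rightarrow> cvec4 \<Rightarrow> cvec4 \<Rightarrow> nat \<Rightarrow> bool" where
  "vanishes_along f z w k \<longleftrightarrow> (\<exists>q :: complex poly. \<forall>c. f (z + c *s w) = c ^ k * poly q c)"

definition mult_ge :: "(cvec4 \<Rightarrow> complex) \<Rightarrow> (cvec4) set \<Rightarrow> nat \<Rightarrow> bool" where
  "mult_ge f x k \<longleftrightarrow> (\<forall>z\<in>x. \<forall>w. vanishes_along f z w k)"

text \<open>Global sections on the blow-up of the line bundle of a class, identified with sections on the
  surface with prescribed multiplicities. A negative multiplicity, that is a positive coefficient
  of \<open>E\<^sub>i\<close>, imposes no condition.\<close>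

definition sections ::
  "nat \<Rightarrow> nat \<Rightarrow> (nat \<Rightarrow> (cvec4) set) \<Rightarrow> pic \<Rightarrow> (cvec4 \<Rightarrow> complex) set" where
  "sections n r p D =
     {f \<in> hirz_sections n (cF D) (cH D). \<forall>i<r. mult_ge f (p i) (nat (mul D i))}"

definition linear_system ::
  "nat \<Rightarrow> nat \<Rightarrow> (nat \<Rightarrow> (cvec4) set) \<Rightarrow> nat \<Rightarrow> nat \<Rightarrow> nat \<Rightarrow> (cvec4 \<Rightarrow> complex) set" where
  "linear_system n r p a b m =
     sections n r p (Pic (int a) (int b) (\<lambda>_. int m)) - {\<lambda>_. 0}"

text \<open>Vanishing, at a point of the blow-up, of \<open>f\<close> as a section of the class \<open>D\<close>. On the
  \<open>i\<close>-th exceptional curve the restriction of the section is the homogeneous part of degree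
  \<open>mul D i\<close> of \<open>f\<close> at \<open>p i\<close>, viewed as a form on the tangent space; for \<open>mul D i < 0\<close> the section
  contains that curve.\<close>

fun section_zero ::
  "nat \<Rightarrow> (nat \<Rightarrow> (cvec4) set) \<Rightarrow> pic \<Rightarrow> (cvec4 \<Rightarrow> complex) \<Rightarrow> blowup_point \<Rightarrow> bool" where
  "section_zero r p D f (Outside x) \<longleftrightarrow> (\<forall>z\<in>x. f z = 0)"
| "section_zero r p D f (Direction d) \<longleftrightarrow>
     (\<forall>(z, w)\<in>d. \<forall>i<r. z \<in> p i \<longrightarrow> vanishes_along f z w (nat (mul D i + 1)))"

section \<open>Curves on the blow-up\<close>

text \<open>The blow-up is projective, so its Zariski closed subsets are the common zero loci of families
  of sections of line bundles.\<close>

definition zariski_closed ::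
  "nat \<Rightarrow> nat \<Rightarrow> (nat \<Rightarrow> (cvec4) set) \<Rightarrow> blowup_point set \<Rightarrow> bool" where
  "zariski_closed n r p Z \<longleftrightarrow>
     (\<exists>\<Phi>. (\<forall>(D, f)\<in>\<Phi>. f \<in> sections n r p D) \<and>
          Z = {x \<in> blowup n r p. \<forall>(D, f)\<in>\<Phi>. section_zero r p D f x})"

text \<open>The blow-up is an irreducible surface, so an irreducible closed subset has dimension one iff
  it is infinite and proper.\<close>

definition irreducible_curve ::
  "nat \<Rightarrow> nat \<Rightarrow> (nat \<Rightarrow> (cvec4) set) \<Rightarrow> blowup_point set \<Rightarrow> bool" where
  "irreducible_curve n r p E \<longleftrightarrow>
     zariski_closed n r p E \<and> infinite E \<and> E \<noteq> blowup n r p \<and>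
     (\<forall>Z Z'. zariski_closed n r p Z \<longrightarrow> zariski_closed n r p Z' \<longrightarrow> E \<subseteq> Z \<union> Z' \<longrightarrow>
        E \<subseteq> Z \<or> E \<subseteq> Z')"

text \<open>The divisor of the section \<open>f\<close> of the class \<open>D\<close> is the reduced curve \<open>E\<close>, that is,
  multiplication by \<open>f\<close> identifies \<open>\<O>(-D)\<close> with the ideal sheaf of \<open>E\<close>: for every
  class \<open>D'\<close>, the sections of \<open>D'\<close> vanishing on \<open>E\<close> are the multiples of \<open>f\<close> by sections of
  \<open>D' - D\<close>.\<close>

definition divisor_is ::
  "nat \<Rightarrow> nat \<Rightarrow> (nat \<Rightarrow> (cvec4) set) \<Rightarrow> pic \<Rightarrow> (cvec4 \<Rightarrow> complex) \<Rightarrow>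
   blowup_point set \<Rightarrow> bool" where
  "divisor_is n r p D f E \<longleftrightarrow>
     f \<in> sections n r p D \<and>
     (\<forall>D'. \<forall>g \<in> sections n r p D'.
        (\<forall>x\<in>E. section_zero r p D' g x) \<longleftrightarrow>
        (\<exists>h \<in> sections n r p (pic_diff D' D). g = (\<lambda>z. f z * h z)))"

definition has_class ::
  "nat \<Rightarrow> nat \<Rightarrow> (nat \<Rightarrow> (cvec4) set) \<Rightarrow> blowup_point set \<Rightarrow> pic \<Rightarrow> bool" where
  "has_class n r p E D \<longleftrightarrow> (\<exists>f. divisor_is n r p D f E)"

definition minus_one_curve ::
  "nat \<Rightarrow> nat \<Rightarrow> (nat \<Rightarrow> (cvec4) set) \<Rightarrow> blowup_point set \<Rightarrow> bool" where
  "minus_one_curve n r p E \<longleftrightarrow>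
     irreducible_curve n r p E \<and>
     (\<exists>D. has_class n r p E D \<and>
          intersection n r D D = -1 \<and> intersection n r D (canonical_class n) = -1)"

definition belongs_to_system ::
  "nat \<Rightarrow> nat \<Rightarrow> (nat \<Rightarrow> (cvec4) set) \<Rightarrow> nat \<Rightarrow> nat \<Rightarrow> nat \<Rightarrow> blowup_point set \<Rightarrow> bool" where
  "belongs_to_system n r p a b m E \<longleftrightarrow>
     (\<exists>f \<in> linear_system n r p a b m.
        divisor_is n r p (Pic (int a) (int b) (\<lambda>_. int m)) f E)"

text \<open>The linear system consists of the single divisor \<open>E\<close>.\<close>

definition system_is_curve ::
  "nat \<Rightarrow> nat \<Rightarrow> (nat \<Rightarrow> (cvec4) set) \<Rightarrow> nat \<Rightarrow> nat \<Rightarrow> nat \<Rightarrow> blowup_point set \<Rightarrow> bool" where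
  "system_is_curve n r p a b m E \<longleftrightarrow>
     linear_system n r p a b m \<noteq> {} \<and>
     (\<forall>f \<in> linear_system n r p a b m.
        divisor_is n r p (Pic (int a) (int b) (\<lambda>_. int m)) f E)"

definition listed :: "nat \<Rightarrow> nat \<Rightarrow> nat \<Rightarrow> nat \<Rightarrow> bool" where
  "listed n r a b \<longleftrightarrow>
     (n = 1 \<and> a = 0 \<and> b = 2 \<and> r = 5) \<or>
     (a = 1 \<and> b = 0 \<and> r = 1) \<or>
     (\<exists>e. a = e \<and> b = 1 \<and> r = 2 * e + n + 1)"

definition listed_up_to_swap :: "nat \<Rightarrow> nat \<Rightarrow> nat \<Rightarrow> nat \<Rightarrow> bool" where
  "listed_up_to_swap n r a b \<longleftrightarrow> listed n r a b \<or> (n = 0 \<and> listed n r b a)"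

end

theory Submission
  imports Defs "Jordan_Normal_Form.Determinant"
    "HOL-Computational_Algebra.Fundamental_Theorem_Algebra"
begin

text \<open>A section is determined by the curve it defines up to a unit, so the class of a curve in
  \<open>|a F + b H|\<close> with multiplicity one at all centres is \<open>(a, b, 1\<^sup>r)\<close>. The equations
  \<open>E\<^sup>2 = E K = -1\<close> then combine to \<open>(b - 1) (2 (a - 1) + n b) = 0\<close>, whose solutions are the listed
  classes.

  Conversely, each listed system contains a curve with a polynomial parametrization by the affine
  line: a fibre, the graph of the rational function \<open>- B / A\<close> interpolating the centres (the zero
  locus of \<open>A z\<^sub>4 + B z\<^sub>3\<close>), its image under the exchange of rulings, or a conic. In each case a
  section that vanishes along the parametrization is a multiple of the equation, and the equation
  has multiplicity exactly one at the centres; irreducibility and the determination of the divisor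
  follow from these two facts. What is needed of the centres is that certain square linear systems,
  which express interpolation by forms of lower degree, have only the trivial solution. This is the
  nonvanishing of determinants, hence Zariski open, and points on a graph \<open>y = x\<^sup>d\<close> show that it can
  be satisfied.\<close>

text \<open>\<open>divisor_is\<close> tests every class, so a section vanishing on the curve has to
  be divided by the equation \<open>f\<close> in all degrees, with control of the multiplicities of
  the quotient. This is done by substitution or division with remainder, followed by cancellation of
  linear forms in \<open>z$1\<close>, \<open>z$2\<close>. Points on the exceptional curves, and
  points that the affine line misses, are never inspected separately: vanishing at cofinitely many
  parameters already makes a section a multiple of \<open>f\<close>, and multiples vanish on the
  whole curve. The obstacle is degeneration. A curve through the centres always exists by counting
  coefficients, but it could contain fibres or the negative curve, or be a pair of lines. Each of
  these would leave a residual curve of smaller class through too many centres, and the square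
  systems exclude exactly that. The open set may depend on \<open>n\<close> and \<open>r\<close>
  only, so it carries the conditions for all listed classes with these invariants at once. On it the
  torus moves every centre to the form \<open>vec4 1 x 1 y\<close>, which reduces interpolation to
  polynomials in one variable.\<close>

no_notation vec_index (infixl "$" 100)

abbreviation coords :: "(cvec4 \<Rightarrow> complex) set" where
  "coords \<equiv> range (\<lambda>i z. z $ i)"

abbreviation vec4 :: "complex \<Rightarrow> complex \<Rightarrow> complex \<Rightarrow> complex \<Rightarrow> cvec4" where
  "vec4 a b c d \<equiv> vector [a, b, c, d]"

lemma vector_4 [simp]:
  "(vec4 a b c d) $ 1 = a" "(vec4 a b c d) $ 2 = b"
  "(vec4 a b c d) $ 3 = c" "(vec4 a b c d) $ 4 = d"
  unfolding vector_def by simp_all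

lemma vec4_eq_iff: "(z :: cvec4) = w \<longleftrightarrow> z$1 = w$1 \<and> z$2 = w$2 \<and> z$3 = w$3 \<and> z$4 = w$4"
  by (simp add: Finite_Cartesian_Product.vec_eq_iff forall_4)

lemma vec4_eta: "vec4 (z$1) (z$2) (z$3) (z$4) = z"
  by (simp add: vec4_eq_iff)

subsection \<open>Polynomial functions\<close>

lemma poly_funs_coord [simp, intro]: "(\<lambda>z. z $ i) \<in> poly_funs coords"
  by (rule poly_funs.coord) auto

lemma poly_funs_cmult: "f \<in> poly_funs X \<Longrightarrow> (\<lambda>z. c * f z) \<in> poly_funs X"
  using poly_funs.mult[OF poly_funs.const] .

lemma poly_funs_uminus: "f \<in> poly_funs X \<Longrightarrow> (\<lambda>z. - f z) \<in> poly_funs X"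
  using poly_funs_cmult[of f X "-1"] by simp

lemma poly_funs_diff:
  "f \<in> poly_funs X \<Longrightarrow> g \<in> poly_funs X \<Longrightarrow> (\<lambda>z. f z - g z) \<in> poly_funs X"
  using poly_funs.add[OF _ poly_funs_uminus] by simp

lemma poly_funs_divide: "f \<in> poly_funs X \<Longrightarrow> (\<lambda>z. f z / c) \<in> poly_funs X"
  using poly_funs_cmult[of f X "inverse c"] by (simp add: field_simps)

lemma poly_funs_power: "f \<in> poly_funs X \<Longrightarrow> (\<lambda>z. f z ^ k) \<in> poly_funs X"
  by (induction k) (auto intro: poly_funs.const poly_funs.mult)

lemma poly_funs_sum:
  "(\<And>i. i \<in> I \<Longrightarrow> f i \<in> poly_funs X) \<Longrightarrow> (\<lambda>z. \<Sum>i\<in>I. f i z) \<in> poly_funs X"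
  by (induction I rule: infinite_finite_induct) (auto intro: poly_funs.const poly_funs.add)

lemma poly_funs_prod:
  "(\<And>i. i \<in> I \<Longrightarrow> f i \<in> poly_funs X) \<Longrightarrow> (\<lambda>z. \<Prod>i\<in>I. f i z) \<in> poly_funs X"
  by (induction I rule: infinite_finite_induct) (auto intro: poly_funs.const poly_funs.mult)

lemmas poly_funs_intros = poly_funs.const poly_funs.add poly_funs.mult poly_funs_cmult
  poly_funs_uminus poly_funs_diff poly_funs_divide poly_funs_power poly_funs_sum poly_funs_prod poly_funs_coord

lemma poly_funs_compose:
  assumes "g \<in> poly_funs X" and "\<And>x. x \<in> X \<Longrightarrow> (\<lambda>z. x (u z)) \<in> poly_funs Y"
  shows "(\<lambda>z. g (u z)) \<in> poly_funs Y"
  using assms(1) by induction (auto intro: assms(2) poly_funs_intros)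

lemma poly_funs_compose4:
  assumes "g \<in> poly_funs coords" and "\<And>i. (\<lambda>z. u z $ i) \<in> poly_funs Y"
  shows "(\<lambda>z. g (u z)) \<in> poly_funs Y"
  using assms by (auto intro: poly_funs_compose)

lemma poly_funs_comp_vec4:
  assumes "g \<in> poly_funs coords" and "a \<in> poly_funs Y" "b \<in> poly_funs Y"
    "c \<in> poly_funs Y" "d \<in> poly_funs Y"
  shows "(\<lambda>z. g (vec4 (a z) (b z) (c z) (d z))) \<in> poly_funs Y"
proof (rule poly_funs_compose4[OF assms(1)])
  show "(\<lambda>z. vec4 (a z) (b z) (c z) (d z) $ i) \<in> poly_funs Y" for i
    using exhaust_4[of i] assms by auto
qed

lemma poly_funs_along:
  assumes "f \<in> poly_funs X" and "\<And>x. x \<in> X \<Longrightarrow> \<exists>q. \<forall>c. x (\<gamma> c) = poly q c"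
  shows "\<exists>q. \<forall>c. f (\<gamma> c) = poly q c"
  using assms(1)
proof induction
  case (const c)
  show ?case by (rule exI[of _ "[:c:]"]) simp
next
  case (add f g)
  then obtain p q where "\<forall>c. f (\<gamma> c) = poly p c" "\<forall>c. g (\<gamma> c) = poly q c" by blast
  then show ?case by (intro exI[of _ "p + q"]) simp
next
  case (mult f g)
  then obtain p q where "\<forall>c. f (\<gamma> c) = poly p c" "\<forall>c. g (\<gamma> c) = poly q c" by blast
  then show ?case by (intro exI[of _ "p * q"]) simp
qed (use assms(2) in auto)

lemma poly_funs_along4:
  assumes "f \<in> poly_funs coords" and "\<And>i. \<exists>q. \<forall>c. \<gamma> c $ i = poly q c"
  shows "\<exists>q. \<forall>c. f (\<gamma> c) = poly q c"
  using assms by (auto intro!: poly_funs_along[OF assms(1)])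

lemma poly_funs_line:
  assumes "f \<in> poly_funs coords"
  shows "\<exists>q. \<forall>c. f (z + c *s w) = poly q c"
proof (rule poly_funs_along4[OF assms])
  show "\<exists>q. \<forall>c. (z + c *s w) $ i = poly q c" for i
    by (rule exI[of _ "[:z$i, w$i:]"]) simp
qed

section \<open>Identity principle and divisibility for polynomial functions\<close>

lemma poly_eqI_infinite:
  fixes p q :: "complex poly"
  assumes "infinite A" and "\<And>x. x \<in> A \<Longrightarrow> poly p x = poly q x"
  shows "p = q"
proof (rule ccontr)
  assume "p \<noteq> q"
  then have "finite {x. poly (p - q) x = 0}" by (intro poly_roots_finite) simp
  moreover have "A \<subseteq> {x. poly (p - q) x = 0}" using assms(2) by auto
  ultimately show False using assms(1) finite_subset by blast
qed

lemma poly_eqI_cofinite: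
  fixes p q :: "complex poly"
  assumes "finite A" and "\<And>x. x \<notin> A \<Longrightarrow> poly p x = poly q x"
  shows "p = q"
  by (rule poly_eqI_infinite[of "- A"])
     (use assms in \<open>auto simp: infinite_UNIV_char_0 Compl_eq_Diff_UNIV\<close>)

text \<open>On the line from \<open>z\<close> to \<open>z0\<close> both functions become polynomials
  in one variable with product 0, and the first is nonzero at the parameter 1. This is the density
  principle: identities need checking only where some function is nonzero.\<close>

lemma poly_funs_domain:
  assumes "f \<in> poly_funs coords" "g \<in> poly_funs coords"
    and "f z0 \<noteq> 0" and "\<And>z. f z \<noteq> 0 \<Longrightarrow> g z = 0"
  shows "g z = 0"
proof -
  obtain p where p: "\<forall>c. f (z + c *s (z0 - z)) = poly p c" using poly_funs_line[OF assms(1)] by blast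
  obtain q where q: "\<forall>c. g (z + c *s (z0 - z)) = poly q c" using poly_funs_line[OF assms(2)] by blast
  have "poly (p * q) c = 0" for c
    using assms(4) p q by (metis mult_eq_0_iff poly_mult)
  then have "p * q = 0" using poly_eq_poly_eq_iff[of "p * q" 0] by auto
  moreover have "poly p 1 \<noteq> 0" using assms(3) p[rule_format, of 1] by simp
  ultimately have "q = 0" by auto
  then show ?thesis using q[rule_format, of 0] by simp
qed

text \<open>Congruence modulo \<open>f\<close> passes from coordinates to all polynomials. The
  product case telescopes through \<open>g (v z) * h (u z)\<close>.\<close>

lemma poly_funs_subst_dvd:
  assumes "g \<in> poly_funs coords"
    and "\<And>i. (\<lambda>z. u z $ i) \<in> poly_funs coords" "\<And>i. (\<lambda>z. v z $ i) \<in> poly_funs coords"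
    and "\<And>i. \<exists>k\<in>poly_funs coords. \<forall>z. u z $ i - v z $ i = f z * k z"
  shows "\<exists>k\<in>poly_funs coords. \<forall>z :: cvec4. g (u z) - g (v z) = f z * k z"
  using assms(1)
proof induction
  case (const c)
  show ?case by (rule bexI[of _ "\<lambda>_. 0"]) (auto intro: poly_funs.const)
next
  case (coord x)
  then show ?case using assms(4) by auto
next
  case (add g h)
  then obtain k l where kl: "k \<in> poly_funs coords" "l \<in> poly_funs coords"
    "\<forall>z. g (u z) - g (v z) = f z * k z" "\<forall>z. h (u z) - h (v z) = f z * l z" by blast
  show ?case
  proof (rule bexI[of _ "\<lambda>z. k z + l z"], intro allI)
    fix z show "g (u z) + h (u z) - (g (v z) + h (v z)) = f z * (k z + l z)"
      using kl(3)[rule_format, of z] kl(4)[rule_format, of z] by (simp add: algebra_simps)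
  qed (use kl in \<open>auto intro: poly_funs_intros\<close>)
next
  case (mult g h)
  then obtain k l where kl: "k \<in> poly_funs coords" "l \<in> poly_funs coords"
    "\<forall>z. g (u z) - g (v z) = f z * k z" "\<forall>z. h (u z) - h (v z) = f z * l z" by blast
  show ?case
  proof (rule bexI[of _ "\<lambda>z. h (u z) * k z + g (v z) * l z"], intro allI)
    fix z
    have "g (u z) * h (u z) - g (v z) * h (v z)
        = (g (u z) - g (v z)) * h (u z) + g (v z) * (h (u z) - h (v z))"
      by (simp add: algebra_simps)
    then show "g (u z) * h (u z) - g (v z) * h (v z) = f z * (h (u z) * k z + g (v z) * l z)"
      unfolding kl(3)[rule_format, of z] kl(4)[rule_format, of z] by (simp add: algebra_simps)
  qed (use kl mult.hyps assms(2,3) in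
        \<open>auto intro!: poly_funs.add poly_funs.mult poly_funs_compose4[of h] poly_funs_compose4[of g]\<close>)
qed

text \<open>\<open>L\<close> is prime because the retraction \<open>v\<close> onto its zero locus identifies the residue ring with
  a ring of polynomial functions.\<close>

lemma poly_funs_cancel:
  assumes "f \<in> poly_funs coords" "g \<in> poly_funs coords" "k \<in> poly_funs coords" "L \<in> poly_funs coords"
    and eq: "\<And>z. L z * g z = f z * k z"
    and v: "\<And>i. (\<lambda>z. v z $ i) \<in> poly_funs coords" "\<And>z. L (v z) = 0"
      "\<And>i. \<exists>k\<in>poly_funs coords. \<forall>z. z $ i - v z $ i = L z * k z"
    and "f (v z1) \<noteq> 0" and "L z0 \<noteq> 0"
  shows "\<exists>k\<in>poly_funs coords. \<forall>z. g z = f z * k z"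
proof -
  have kv: "k (v z) = 0" for z
  proof (rule poly_funs_domain[of "\<lambda>z. f (v z)" "\<lambda>z. k (v z)" z1])
    show "f (v z) \<noteq> 0 \<Longrightarrow> k (v z) = 0" for z using eq[of "v z"] v(2)[of z] by auto
  qed (use assms in \<open>auto intro: poly_funs_compose4\<close>)
  \<comment> \<open>Modulo \<open>L\<close> the identity map agrees with the retraction
    \<open>v\<close>, so \<open>k\<close> is congruent to \<open>k \<circ> v\<close>, which
    vanishes.\<close>
  have "\<exists>l\<in>poly_funs coords. \<forall>z. k z - k (v z) = L z * l z"
    using poly_funs_subst_dvd[of k "\<lambda>z. z" v L] assms(3) v by auto
  then obtain l where l: "l \<in> poly_funs coords" "\<And>z. k z = L z * l z"
    using kv by auto
  have "g z - f z * l z = 0" for z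
  proof (rule poly_funs_domain[OF assms(4) _ \<open>L z0 \<noteq> 0\<close>])
    show "(\<lambda>z. g z - f z * l z) \<in> poly_funs coords" using assms l by (intro poly_funs_intros)
    show "L z \<noteq> 0 \<Longrightarrow> g z - f z * l z = 0" for z
      using eq[of z] l(2)[of z] by (simp add: algebra_simps)
  qed
  then show ?thesis using l by auto
qed

subsection \<open>The torus action and its orbits\<close>

lemma torus_act_nth [simp]:
  "torus_act n l m z $ 1 = l * z$1" "torus_act n l m z $ 2 = l * z$2"
  "torus_act n l m z $ 3 = m * z$3 / l ^ n" "torus_act n l m z $ 4 = m * z$4"
  unfolding torus_act_def by simp_all

lemma torus_act_1 [simp]: "torus_act n 1 1 z = z"
  by (simp add: vec4_eq_iff)

lemma torus_act_mult: "torus_act n l m (torus_act n l' m' z) = torus_act n (l * l') (m * m') z"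
  by (simp add: vec4_eq_iff power_mult_distrib mult_ac)

lemma torus_act_linear: "torus_act n l m (z + c *s w) = torus_act n l m z + c *s torus_act n l m w"
  by (simp add: vec4_eq_iff algebra_simps add_divide_distrib)

lemma self_in_orbit: "z \<in> Defs.orbit n z"
  unfolding Defs.orbit_def by (force intro: exI[of _ 1])

lemma orbit_torus_act:
  assumes "l \<noteq> 0" "m \<noteq> 0"
  shows "Defs.orbit n (torus_act n l m z) = Defs.orbit n z"
proof
  show "Defs.orbit n (torus_act n l m z) \<subseteq> Defs.orbit n z"
    unfolding Defs.orbit_def torus_act_mult using assms mult_eq_0_iff by blast
  show "Defs.orbit n z \<subseteq> Defs.orbit n (torus_act n l m z)"
  proof
    fix w assume "w \<in> Defs.orbit n z"
    then obtain l' m' where lm: "w = torus_act n l' m' z" "l' \<noteq> 0" "m' \<noteq> 0"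
      unfolding Defs.orbit_def by blast
    then have "w = torus_act n (l' / l) (m' / m) (torus_act n l m z)"
      using assms by (simp add: torus_act_mult)
    then show "w \<in> Defs.orbit n (torus_act n l m z)"
      unfolding Defs.orbit_def using assms lm divide_eq_0_iff by blast
  qed
qed

lemma orbit_eqE:
  assumes "Defs.orbit n z = Defs.orbit n z'"
  obtains l m where "l \<noteq> 0" "m \<noteq> 0" "z' = torus_act n l m z"
  using self_in_orbit[of z' n] assms unfolding Defs.orbit_def by blast

lemma in_orbitE:
  assumes "w \<in> Defs.orbit n z"
  obtains l m where "l \<noteq> 0" "m \<noteq> 0" "w = torus_act n l m z"
  using assms unfolding Defs.orbit_def by blast

lemma poly_funs_torus_act:
  "g \<in> poly_funs coords \<Longrightarrow> (\<lambda>z. g (torus_act n l m z)) \<in> poly_funs coords"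
  unfolding torus_act_def
  by (rule poly_funs_comp_vec4) (intro poly_funs_intros | assumption)+

subsection \<open>Sections\<close>

lemma hirz_sectionsI:
  assumes "f \<in> poly_funs coords"
    and "\<And>l m z. l \<noteq> 0 \<Longrightarrow> m \<noteq> 0 \<Longrightarrow> f (torus_act n l m z) = l powi a * m powi b * f z"
  shows "f \<in> hirz_sections n a b"
  using assms unfolding hirz_sections_def by auto

lemma hirz_sections_poly_funs: "f \<in> hirz_sections n a b \<Longrightarrow> f \<in> poly_funs coords"
  unfolding hirz_sections_def by auto

lemma hirz_sections_torus_act:
  "f \<in> hirz_sections n a b \<Longrightarrow> l \<noteq> 0 \<Longrightarrow> m \<noteq> 0 \<Longrightarrow>
    f (torus_act n l m z) = l powi a * m powi b * f z"
  unfolding hirz_sections_def by auto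

lemma hirz_sections_cmult:
  "f \<in> hirz_sections n a b \<Longrightarrow> (\<lambda>z. c * f z) \<in> hirz_sections n a b"
  by (rule hirz_sectionsI)
     (auto simp: hirz_sections_torus_act algebra_simps intro: poly_funs_intros hirz_sections_poly_funs)

lemma hirz_sections_const: "(\<lambda>_. c) \<in> hirz_sections n 0 0"
  by (rule hirz_sectionsI) (auto intro: poly_funs_intros)

lemma hirz_sections_monomial:
  "(\<lambda>z. z$1 ^ i * z$2 ^ j * z$3 ^ k * z$4 ^ l) \<in>
     hirz_sections n (int (i + j) - int n * int k) (int (k + l))"
proof (rule hirz_sectionsI)
  fix x y :: complex and z :: cvec4
  assume "x \<noteq> 0" "y \<noteq> 0"
  then show "torus_act n x y z $ 1 ^ i * torus_act n x y z $ 2 ^ j * torus_act n x y z $ 3 ^ k *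
      torus_act n x y z $ 4 ^ l = x powi (int (i + j) - int n * int k) * y powi (int (k + l)) *
        (z$1 ^ i * z$2 ^ j * z$3 ^ k * z$4 ^ l)"
    unfolding power_int_diff[OF disjI1[OF \<open>x \<noteq> 0\<close>]]
    by (simp add: power_int_add power_mult_distrib power_divide power_add
        power_mult power_int_of_nat flip: of_nat_mult of_nat_add)
qed (intro poly_funs_intros)

text \<open>The weight of \<open>h\<close> is determined wherever \<open>f\<close> is nonzero, and
  the identity extends by density.\<close>

lemma hirz_sections_quotient:
  assumes "f \<in> hirz_sections n a b" "(\<lambda>z. f z * h z) \<in> hirz_sections n a' b'"
    and "h \<in> poly_funs coords" and "f z0 \<noteq> 0"
  shows "h \<in> hirz_sections n (a' - a) (b' - b)"
proof (rule hirz_sectionsI[OF assms(3)])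
  fix l m :: complex and z :: cvec4
  assume lm: "l \<noteq> 0" "m \<noteq> 0"
  have "h (torus_act n l m z) - l powi (a' - a) * m powi (b' - b) * h z = 0"
  proof (rule poly_funs_domain[of f "\<lambda>z. h (torus_act n l m z) - l powi (a' - a) * m powi (b' - b) * h z" z0])
    fix z assume fz: "f z \<noteq> 0"
    have "l powi a * m powi b * f z * h (torus_act n l m z) = l powi a' * m powi b' * (f z * h z)"
      using hirz_sections_torus_act[OF assms(2) lm] hirz_sections_torus_act[OF assms(1) lm] by simp
    then show "h (torus_act n l m z) - l powi (a' - a) * m powi (b' - b) * h z = 0"
      using lm fz by (simp add: power_int_diff field_simps)
  qed (use assms in \<open>auto intro: poly_funs_intros poly_funs_torus_act hirz_sections_poly_funs\<close>)
  then show "h (torus_act n l m z) = l powi (a' - a) * m powi (b' - b) * h z" by simp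
qed

subsection \<open>Monomial expansion of sections\<close>

text \<open>A coefficient followed by the exponents of the four coordinates. Expansions are lists of
  such terms and may repeat exponents, so that concatenation realizes addition.\<close>

type_synonym monom4 = "complex \<times> nat \<times> nat \<times> nat \<times> nat"

fun mon_eval :: "cvec4 \<Rightarrow> monom4 \<Rightarrow> complex" where
  "mon_eval z (c, i, j, k, l) = c * (z$1 ^ i * z$2 ^ j * z$3 ^ k * z$4 ^ l)"

fun mon_F :: "nat \<Rightarrow> monom4 \<Rightarrow> int" where
  "mon_F n (c, i, j, k, l) = int (i + j) - int n * int k"

fun mon_H :: "monom4 \<Rightarrow> int" where
  "mon_H (c, i, j, k, l) = int (k + l)"

fun mon_mult :: "monom4 \<Rightarrow> monom4 \<Rightarrow> monom4" where
  "mon_mult (c, i, j, k, l) (c', i', j', k', l') = (c * c', i + i', j + j', k + k', l + l')"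

lemma mon_eval_mult: "mon_eval z (mon_mult s t) = mon_eval z s * mon_eval z t"
  by (cases s; cases t) (simp add: power_add)

lemma mon_eval_hirz_sections: "(\<lambda>z. mon_eval z t) \<in> hirz_sections n (mon_F n t) (mon_H t)"
  by (cases t) (auto intro!: hirz_sections_cmult hirz_sections_monomial simp del: of_nat_add)

lemma poly_funs_monomials:
  assumes "f \<in> poly_funs coords"
  shows "\<exists>xs. \<forall>z. f z = (\<Sum>t\<leftarrow>xs. mon_eval z t)"
  using assms
proof induction
  case (const c)
  show ?case by (rule exI[of _ "[(c, 0, 0, 0, 0)]"]) simp
next
  case (coord x)
  then obtain i where i: "x = (\<lambda>z. z $ i)" by auto
  consider "i = 1" | "i = 2" | "i = 3" | "i = 4" using exhaust_4 by blast
  then show ?case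
  proof cases
    case 1 show ?thesis by (rule exI[of _ "[(1, 1, 0, 0, 0)]"]) (simp add: i 1)
  next
    case 2 show ?thesis by (rule exI[of _ "[(1, 0, 1, 0, 0)]"]) (simp add: i 2)
  next
    case 3 show ?thesis by (rule exI[of _ "[(1, 0, 0, 1, 0)]"]) (simp add: i 3)
  next
    case 4 show ?thesis by (rule exI[of _ "[(1, 0, 0, 0, 1)]"]) (simp add: i 4)
  qed
next
  case (add f g)
  then obtain xs ys where "\<forall>z. f z = (\<Sum>t\<leftarrow>xs. mon_eval z t)" "\<forall>z. g z = (\<Sum>t\<leftarrow>ys. mon_eval z t)"
    by blast
  then show ?case by (intro exI[of _ "xs @ ys"]) simp
next
  case (mult f g)
  then obtain xs ys where *: "\<forall>z. f z = (\<Sum>t\<leftarrow>xs. mon_eval z t)" "\<forall>z. g z = (\<Sum>t\<leftarrow>ys. mon_eval z t)"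
    by blast
  have "(\<Sum>t\<leftarrow>xs. mon_eval z t) * (\<Sum>t\<leftarrow>ys. mon_eval z t)
      = (\<Sum>t\<leftarrow>concat (map (\<lambda>s. map (mon_mult s) ys) xs). mon_eval z t)" for z
    by (induction xs) (simp_all add: distrib_right sum_list_const_mult mon_eval_mult o_def)
  then show ?case using * by (intro exI[of _ "concat (map (\<lambda>s. map (mon_mult s) ys) xs)"]) simp
qed

lemma powi_coeff_extract:
  fixes C :: "'t \<Rightarrow> complex" and w :: "'t \<Rightarrow> int"
  assumes "\<And>l. l \<noteq> 0 \<Longrightarrow> (\<Sum>t\<leftarrow>xs. l powi w t * C t) = l powi a * F"
  shows "F = (\<Sum>t\<leftarrow>filter (\<lambda>t. w t = a) xs. C t)"
proof -
  \<comment> \<open>Multiplication by \<open>l powi N\<close> clears all negative exponents and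
    leaves polynomials that agree away from 0.\<close>
  define N where "N = \<bar>a\<bar> + (\<Sum>t\<leftarrow>xs. \<bar>w t\<bar>)"
  have N: "0 \<le> a + N" "\<And>t. t \<in> set xs \<Longrightarrow> 0 \<le> w t + N"
  proof -
    have "(\<Sum>t\<leftarrow>xs. \<bar>w t\<bar>) \<ge> 0" by (rule sum_list_nonneg) auto
    then show "0 \<le> a + N" unfolding N_def by linarith
    fix t assume "t \<in> set xs"
    then have "\<bar>w t\<bar> \<le> (\<Sum>t\<leftarrow>xs. \<bar>w t\<bar>)" by (intro member_le_sum_list) auto
    then show "0 \<le> w t + N" unfolding N_def by linarith
  qed
  have "(\<Sum>t\<leftarrow>xs. Polynomial.monom (C t) (nat (w t + N))) = Polynomial.monom F (nat (a + N))"
  proof (rule poly_eqI_cofinite[of "{0}"])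
    fix l :: complex assume "l \<notin> {0}"
    then have l: "l \<noteq> 0" by simp
    have "poly (\<Sum>t\<leftarrow>xs. Polynomial.monom (C t) (nat (w t + N))) l
        = (\<Sum>t\<leftarrow>xs. l powi N * (l powi w t * C t))"
      using N(2)
    proof (induction xs)
      case (Cons t xs)
      have "l ^ nat (w t + N) = l powi (w t + N)" using Cons.prems[of t] by (simp add: power_int_def)
      then show ?case using Cons l by (simp add: poly_monom power_int_add)
    qed simp
    also have "\<dots> = l powi N * (l powi a * F)"
      using assms[OF l] by (simp add: sum_list_const_mult)
    also have "\<dots> = poly (Polynomial.monom F (nat (a + N))) l"
    proof -
      have "l ^ nat (a + N) = l powi (a + N)" using N(1) by (simp add: power_int_def)
      then show ?thesis using l by (simp add: poly_monom power_int_add)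
    qed
    finally show "poly (\<Sum>t\<leftarrow>xs. Polynomial.monom (C t) (nat (w t + N))) l
        = poly (Polynomial.monom F (nat (a + N))) l" .
  qed simp
  then have "Polynomial.coeff (\<Sum>t\<leftarrow>xs. Polynomial.monom (C t) (nat (w t + N))) (nat (a + N)) = F"
    by simp
  moreover have "Polynomial.coeff (\<Sum>t\<leftarrow>xs. Polynomial.monom (C t) (nat (w t + N))) (nat (a + N))
      = (\<Sum>t\<leftarrow>filter (\<lambda>t. w t = a) xs. C t)"
    using N(2)
  proof (induction xs)
    case (Cons t xs)
    have "nat (w t + N) = nat (a + N) \<longleftrightarrow> w t = a"
      using Cons.prems[of t] N(1) by auto
    then show ?case using Cons by (simp add: coeff_monom)
  qed simp
  ultimately show ?thesis by simp
qed

text \<open>The one-parameter subgroups \<open>m = 1\<close> and \<open>l = 1\<close> are used in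
  turn to discard the monomials of the wrong bidegree.\<close>

lemma hirz_sections_monomials:
  assumes f: "f \<in> hirz_sections n a b"
  obtains xs where "\<And>z. f z = (\<Sum>t\<leftarrow>xs. mon_eval z t)"
    and "\<And>t. t \<in> set xs \<Longrightarrow> mon_F n t = a \<and> mon_H t = b"
proof -
  obtain xs where xs: "\<And>z. f z = (\<Sum>t\<leftarrow>xs. mon_eval z t)"
    using poly_funs_monomials[OF hirz_sections_poly_funs[OF f]] by blast
  have act: "mon_eval (torus_act n l m z) t = l powi mon_F n t * m powi mon_H t * mon_eval z t"
    if "l \<noteq> 0" "m \<noteq> 0" for l m z t
    using hirz_sections_torus_act[OF mon_eval_hirz_sections that] .
  define ys where "ys = filter (\<lambda>t. mon_F n t = a) xs"
  have ys: "f z = (\<Sum>t\<leftarrow>ys. mon_eval z t)" for z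
    unfolding ys_def
  proof (rule powi_coeff_extract)
    fix l :: complex assume l: "l \<noteq> 0"
    show "(\<Sum>t\<leftarrow>xs. l powi mon_F n t * mon_eval z t) = l powi a * f z"
      using xs[of "torus_act n l 1 z"] hirz_sections_torus_act[OF f l, of 1 z]
      by (simp add: act l)
  qed
  define zs where "zs = filter (\<lambda>t. mon_H t = b) ys"
  have zs: "f z = (\<Sum>t\<leftarrow>zs. mon_eval z t)" for z
    unfolding zs_def
  proof (rule powi_coeff_extract)
    fix m :: complex assume m: "m \<noteq> 0"
    show "(\<Sum>t\<leftarrow>ys. m powi mon_H t * mon_eval z t) = m powi b * f z"
      using ys[of "torus_act n 1 m z"] hirz_sections_torus_act[OF f _ m, of 1 z]
      by (simp add: act m)
  qed
  show thesis by (rule that[OF zs]) (auto simp: zs_def ys_def)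
qed

text \<open>Induction over the monomials of a bidegree. Closure under scalars is contained in the
  monomial case, where the coefficient is arbitrary.\<close>

lemma hirz_sections_span:
  assumes "f \<in> hirz_sections n a b"
    and "V (\<lambda>_. 0)" and "\<And>g h. V g \<Longrightarrow> V h \<Longrightarrow> V (\<lambda>z. g z + h z)"
    and "\<And>t. mon_F n t = a \<Longrightarrow> mon_H t = b \<Longrightarrow> V (\<lambda>z. mon_eval z t)"
  shows "V f"
proof -
  obtain xs where xs: "\<And>z. f z = (\<Sum>t\<leftarrow>xs. mon_eval z t)"
    "\<And>t. t \<in> set xs \<Longrightarrow> mon_F n t = a \<and> mon_H t = b" using hirz_sections_monomials[OF assms(1)] by blast
  have "V (\<lambda>z. \<Sum>t\<leftarrow>xs. mon_eval z t)"
    using xs(2)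
  proof (induction xs)
    case (Cons t xs)
    then show ?case using assms(3)[OF assms(4)[of t] Cons.IH] by simp
  qed (simp add: assms(2))
  moreover have "f = (\<lambda>z. \<Sum>t\<leftarrow>xs. mon_eval z t)" using xs(1) by auto
  ultimately show ?thesis by simp
qed

lemma hirz_sections_neg_H:
  assumes "f \<in> hirz_sections n a b" "b < 0"
  shows "f = (\<lambda>_. 0)"
proof (rule hirz_sections_span[OF assms(1)])
  show "(\<lambda>z. mon_eval z t) = (\<lambda>_. 0)" if "mon_H t = b" for t
    using that assms(2) by (cases t) auto
qed auto

text \<open>The coordinate \<open>z$3\<close> is the only one whose weight in \<open>F\<close> can
  be negative, and degree 0 in \<open>H\<close> excludes it.\<close>

lemma hirz_sections_neg_F:
  assumes "f \<in> hirz_sections n a 0" "a < 0"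
  shows "f = (\<lambda>_. 0)"
proof (rule hirz_sections_span[OF assms(1)])
  show "(\<lambda>z. mon_eval z t) = (\<lambda>_. 0)" if "mon_F n t = a" "mon_H t = 0" for t
    using that assms(2) by (cases t) (simp flip: of_nat_add)
qed auto

lemma hirz_sections_00_const:
  assumes "f \<in> hirz_sections n 0 0"
  shows "\<exists>c. f = (\<lambda>_. c)"
proof (rule hirz_sections_span[OF assms(1)])
  show "\<exists>c. (\<lambda>z. mon_eval z t) = (\<lambda>_. c)" if "mon_F n t = 0" "mon_H t = 0" for t
  proof (cases t)
    case (fields c i j k l)
    then have "k = 0" "l = 0" using that by auto
    moreover from this have "i = 0" "j = 0" using that fields by auto
    ultimately show ?thesis using fields by auto
  qed
next
  show "\<exists>c. (\<lambda>z. g z + h z) = (\<lambda>_. c)" if "\<exists>c. g = (\<lambda>_. c)" "\<exists>c. h = (\<lambda>_. c)" 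
    for g h :: "cvec4 \<Rightarrow> complex" using that by auto
qed auto

subsection \<open>Multiplicities\<close>

lemma vanishes_along_iff_coeff:
  assumes "\<And>c. f (z + c *s w) = poly q c"
  shows "vanishes_along f z w k \<longleftrightarrow> (\<forall>j<k. Polynomial.coeff q j = 0)"
proof -
  have "vanishes_along f z w k \<longleftrightarrow> Polynomial.monom 1 k dvd q"
  proof
    assume "vanishes_along f z w k"
    then obtain u where u: "\<forall>c. f (z + c *s w) = c ^ k * poly u c"
      unfolding vanishes_along_def by blast
    have "q = Polynomial.monom 1 k * u"
      using assms u by (intro poly_eqI_cofinite[of "{}"]) (auto simp: poly_monom)
    then show "Polynomial.monom 1 k dvd q" by simp
  next
    assume "Polynomial.monom 1 k dvd q"
    then show "vanishes_along f z w k"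
      unfolding vanishes_along_def using assms by (auto simp: poly_monom elim!: dvdE)
  qed
  then show ?thesis by (simp add: monom_1_dvd_iff')
qed

lemma vanishes_along_mono: "vanishes_along f z w k \<Longrightarrow> j \<le> k \<Longrightarrow> vanishes_along f z w j"
proof -
  assume "vanishes_along f z w k" "j \<le> k"
  then obtain q where "\<forall>c. f (z + c *s w) = c ^ k * poly q c" unfolding vanishes_along_def by blast
  then show ?thesis unfolding vanishes_along_def
    using \<open>j \<le> k\<close> by (intro exI[of _ "Polynomial.monom 1 (k - j) * q"])
      (simp add: poly_monom mult.assoc[symmetric] flip: power_add)
qed

lemma vanishes_along_mult:
  assumes "vanishes_along f z w j" "vanishes_along g z w k"
  shows "vanishes_along (\<lambda>z. f z * g z) z w (j + k)"
proof -
  obtain p q where "\<forall>c. f (z + c *s w) = c ^ j * poly p c" "\<forall>c. g (z + c *s w) = c ^ k * poly q c"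
    using assms unfolding vanishes_along_def by blast
  then show ?thesis unfolding vanishes_along_def
    by (intro exI[of _ "p * q"]) (simp add: power_add)
qed

lemma vanishes_along_0: "f \<in> poly_funs coords \<Longrightarrow> vanishes_along f z w 0"
  unfolding vanishes_along_def using poly_funs_line by simp

lemma vanishes_along_1:
  assumes "f \<in> poly_funs coords"
  shows "vanishes_along f z w 1 \<longleftrightarrow> f z = 0"
proof -
  obtain q where q: "\<And>c. f (z + c *s w) = poly q c" using poly_funs_line[OF assms] by blast
  have "f z = Polynomial.coeff q 0" using q[of 0] by (simp add: poly_0_coeff_0)
  then show ?thesis using vanishes_along_iff_coeff[of f z w q 1, OF q] by auto
qed

lemma vanishes_along_cmult:
  "vanishes_along f z w k \<Longrightarrow> vanishes_along (\<lambda>z. c * f z) z w k"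
  using vanishes_along_mult[of "\<lambda>_. c" z w 0 f k]
  by (metis add_0 poly_funs.const vanishes_along_0)

lemma vanishes_along_torus_act:
  assumes "f \<in> hirz_sections n a b" "l \<noteq> 0" "m \<noteq> 0"
    and "vanishes_along f (torus_act n l m z) (torus_act n l m w) k"
  shows "vanishes_along f z w k"
proof -
  obtain q where q: "\<forall>c. f (torus_act n l m z + c *s torus_act n l m w) = c ^ k * poly q c"
    using assms(4) unfolding vanishes_along_def by blast
  have "f (z + c *s w) = c ^ k * poly (Polynomial.smult (inverse (l powi a * m powi b)) q) c" for c
    using q[rule_format, of c] hirz_sections_torus_act[OF assms(1-3), of "z + c *s w"] assms(2,3)
    by (simp add: torus_act_linear field_simps)
  then show ?thesis unfolding vanishes_along_def by blast
qed

text \<open>Orders of vanishing at the parameter 0 add under products, and that of \<open>f\<close>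
  along \<open>w\<close> is at most 1.\<close>

lemma vanishes_along_cancel:
  assumes "f \<in> poly_funs coords" "h \<in> poly_funs coords"
    and "\<not> vanishes_along f z w 2" "vanishes_along (\<lambda>z. f z * h z) z w k"
  shows "vanishes_along h z w (k - 1)"
proof -
  obtain p where p: "\<And>c. f (z + c *s w) = poly p c" using poly_funs_line[OF assms(1)] by blast
  obtain q where q: "\<And>c. h (z + c *s w) = poly q c" using poly_funs_line[OF assms(2)] by blast
  have iff: "vanishes_along u z w j \<longleftrightarrow> s = 0 \<or> j \<le> Polynomial.order 0 s"
    if "\<And>c. u (z + c *s w) = poly s c" for u s j
    unfolding vanishes_along_iff_coeff[of u z w s j, OF that] monom_1_dvd_iff'[symmetric]
    using monom_1_dvd_iff[of s j] by auto
  have p0: "p \<noteq> 0" "Polynomial.order 0 p \<le> 1" using assms(3) iff[OF p, of 2] by auto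
  show ?thesis
  proof (cases "q = 0")
    case False
    then have "k \<le> Polynomial.order 0 (p * q)"
      using iff[of "\<lambda>z. f z * h z" "p * q" k] p q assms(4) p0(1) by simp
    also have "\<dots> = Polynomial.order 0 p + Polynomial.order 0 q" using p0 False by (simp add: order_mult)
    finally have "k - 1 \<le> Polynomial.order 0 q" using p0(2) by linarith
    then show ?thesis using iff[of h q "k - 1", OF q] by simp
  qed (use iff[of h q "k - 1", OF q] in simp)
qed

text \<open>A polynomial in \<open>s\<close> and \<open>c\<close> is encoded with \<open>s\<close>
  as outer variable and coefficients in \<open>c\<close>, hence the evaluation at the constant
  polynomial \<open>[:s:]\<close>.\<close>

lemma poly_funs_pencil:
  assumes "f \<in> poly_funs coords"
  shows "\<exists>Q :: complex poly poly. \<forall>s c. f (z + c *s (w + s *s v)) = poly (poly Q [:s:]) c"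
  using assms
proof induction
  case (const c)
  show ?case by (rule exI[of _ "[:[:c:]:]"]) simp
next
  case (coord x)
  then obtain i where i: "x = (\<lambda>z. z $ i)" by auto
  show ?case by (rule exI[of _ "[:[:z$i, w$i:], [:0, v$i:]:]"]) (simp add: i algebra_simps)
next
  case (add f g)
  then obtain P Q where "\<forall>s c. f (z + c *s (w + s *s v)) = poly (poly P [:s:]) c"
    "\<forall>s c. g (z + c *s (w + s *s v)) = poly (poly Q [:s:]) c" by blast
  then show ?case by (intro exI[of _ "P + Q"]) simp
next
  case (mult f g)
  then obtain P Q where "\<forall>s c. f (z + c *s (w + s *s v)) = poly (poly P [:s:]) c"
    "\<forall>s c. g (z + c *s (w + s *s v)) = poly (poly Q [:s:]) c" by blast
  then show ?case by (intro exI[of _ "P * Q"]) simp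
qed

lemma poly_coeff_pencil:
  fixes Q :: "complex poly poly"
  shows "\<exists>q. \<forall>s. Polynomial.coeff (poly Q [:s:]) j = poly q s"
proof (induction Q)
  case (pCons a Q)
  then obtain q where "\<forall>s. Polynomial.coeff (poly Q [:s:]) j = poly q s" by blast
  then show ?case by (intro exI[of _ "[:Polynomial.coeff a j:] + [:0, 1:] * q"]) simp
qed (auto intro: exI[of _ 0])

text \<open>In the pencil from \<open>w\<close> to \<open>w0\<close> some coefficient of
  \<open>f\<close> is a nonzero polynomial in \<open>s\<close>, so \<open>gen\<close> applies for
  all but finitely many \<open>s\<close>. There the low coefficients of \<open>h\<close> vanish;
  being polynomials in \<open>s\<close>, they also vanish at \<open>s = 0\<close>, the direction
  \<open>w\<close>.\<close>

lemma vanishes_along_generic: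
  assumes f: "f \<in> poly_funs coords" and h: "h \<in> poly_funs coords"
    and w0: "\<not> vanishes_along f z w0 k"
    and gen: "\<And>w. \<not> vanishes_along f z w k \<Longrightarrow> vanishes_along h z w m"
  shows "vanishes_along h z w m"
proof -
  obtain P where P: "\<And>s c. f (z + c *s (w + s *s (w0 - w))) = poly (poly P [:s:]) c"
    using poly_funs_pencil[OF f] by blast
  obtain Q where Q: "\<And>s c. h (z + c *s (w + s *s (w0 - w))) = poly (poly Q [:s:]) c"
    using poly_funs_pencil[OF h] by blast
  have "\<not> vanishes_along f z (w + 1 *s (w0 - w)) k" using w0 by simp
  then obtain i where i: "i < k" "Polynomial.coeff (poly P [:1:]) i \<noteq> 0"
    using vanishes_along_iff_coeff[of f z "w + 1 *s (w0 - w)", OF P] by blast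
  obtain p where p: "\<And>s. Polynomial.coeff (poly P [:s:]) i = poly p s" using poly_coeff_pencil by blast
  then have "p \<noteq> 0" using i(2) by auto
  have "Polynomial.coeff (poly Q [:0:]) j = 0" if j: "j < m" for j
  proof -
    obtain q where q: "\<And>s. Polynomial.coeff (poly Q [:s:]) j = poly q s" using poly_coeff_pencil by blast
    have "q = 0"
    proof (rule poly_eqI_cofinite[of "{s. poly p s = 0}"])
      show "finite {s. poly p s = 0}" using \<open>p \<noteq> 0\<close> by (rule poly_roots_finite)
      fix s assume "s \<notin> {s. poly p s = 0}"
      then have "\<not> vanishes_along f z (w + s *s (w0 - w)) k"
        using vanishes_along_iff_coeff[of f z "w + s *s (w0 - w)", OF P] i(1) p by auto
      from gen[OF this] show "poly q s = poly 0 s"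
        using vanishes_along_iff_coeff[of h z "w + s *s (w0 - w)", OF Q] j q by auto
    qed
    then show ?thesis using q[of 0] by simp
  qed
  then show ?thesis using vanishes_along_iff_coeff[of h z "w + 0 *s (w0 - w)", OF Q] by simp
qed

subsection \<open>Classes of curves\<close>

lemma const_sections: "(\<lambda>_. c) \<in> sections n r p (pic_diff D D)"
proof -
  have "mult_ge (\<lambda>_. c) x 0" for x
    unfolding mult_ge_def by (auto intro: vanishes_along_0 poly_funs.const)
  then show ?thesis unfolding sections_def pic_diff_def using hirz_sections_const by simp
qed

text \<open>\<open>f\<close> is its own multiple by the section 1 of the trivial class.\<close>

lemma divisor_is_vanishes:
  assumes "divisor_is n r p D f E" "x \<in> E"
  shows "section_zero r p D f x"
proof -
  have "\<exists>h\<in>sections n r p (pic_diff D D). f = (\<lambda>z. f z * h z)"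
    by (rule bexI[OF _ const_sections[of 1]]) simp
  then show ?thesis using assms unfolding divisor_is_def by blast
qed

lemma divisor_is_dvd:
  assumes "divisor_is n r p D f E" "divisor_is n r p D' g E"
  shows "\<exists>h\<in>sections n r p (pic_diff D' D). g = (\<lambda>z. f z * h z)"
proof -
  have "g \<in> sections n r p D'" using assms(2) unfolding divisor_is_def by simp
  moreover have "\<forall>x\<in>E. section_zero r p D' g x" using divisor_is_vanishes[OF assms(2)] by simp
  ultimately show ?thesis using assms(1) unfolding divisor_is_def by simp
qed

text \<open>If \<open>f\<close> were 0, every section vanishing on \<open>E\<close> would be 0. But
  \<open>E\<close> is closed and proper, so one of its defining sections is nonzero at a point off
  \<open>E\<close>.\<close>

lemma divisor_is_nonzero:
  assumes "divisor_is n r p D f E" "irreducible_curve n r p E"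
  shows "\<exists>z. f z \<noteq> 0"
proof (rule ccontr)
  assume f0: "\<nexists>z. f z \<noteq> 0"
  obtain \<Phi> where \<Phi>: "\<And>D f. (D, f) \<in> \<Phi> \<Longrightarrow> f \<in> sections n r p D"
    "E = {x \<in> blowup n r p. \<forall>(D, f)\<in>\<Phi>. section_zero r p D f x}"
  proof -
    have "zariski_closed n r p E" using assms(2) unfolding irreducible_curve_def by simp
    then obtain \<Phi> where "\<forall>(D, f)\<in>\<Phi>. f \<in> sections n r p D"
      "E = {x \<in> blowup n r p. \<forall>(D, f)\<in>\<Phi>. section_zero r p D f x}"
      unfolding zariski_closed_def by (elim exE conjE)
    then show ?thesis using that[of \<Phi>] by auto
  qed
  have "E \<noteq> blowup n r p" using assms(2) unfolding irreducible_curve_def by simp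
  then obtain D' g x where g: "(D', g) \<in> \<Phi>" "\<not> section_zero r p D' g x"
    unfolding \<Phi>(2) by auto
  have "\<forall>x\<in>E. section_zero r p D' g x" using \<Phi>(2) g(1) by auto
  then obtain h where "g = (\<lambda>z. f z * h z)"
    using assms(1) \<Phi>(1)[OF g(1)] unfolding divisor_is_def by blast
  then have "g = (\<lambda>_. 0)" using f0 by auto
  moreover have "vanishes_along (\<lambda>_. 0) z w k" for z w k
    unfolding vanishes_along_def by (auto intro: exI[of _ 0])
  ultimately show False using g(2) by (cases x) auto
qed

text \<open>Units have trivial class: no nonzero section has negative degree in \<open>H\<close>,
  and none of degree 0 in \<open>H\<close> has negative degree in \<open>F\<close>. For the
  multiplicities only an inequality results, since a negative one imposes no condition; equality
  comes from treating the inverse in the same way.\<close>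

lemma sections_invertible:
  assumes "h \<in> sections n r p D" "k \<in> sections n r p D'"
    and "cF D' = - cF D" "cH D' = - cH D" and "\<And>z. h z * k z = 1"
    and "\<forall>i<r. p i \<noteq> {}"
  shows "cF D = 0" "cH D = 0" "\<And>i. i < r \<Longrightarrow> mul D i \<le> 0"
proof -
  have hk: "h \<in> hirz_sections n (cF D) (cH D)" "k \<in> hirz_sections n (- cF D) (- cH D)"
    using assms unfolding sections_def by auto
  have nz: "h \<noteq> (\<lambda>_. 0)" "k \<noteq> (\<lambda>_. 0)" using assms(5) by force+
  show "cH D = 0" using hirz_sections_neg_H[OF hk(1)] hirz_sections_neg_H[OF hk(2)] nz by force
  then show "cF D = 0"
    using hirz_sections_neg_F[of h n "cF D"] hirz_sections_neg_F[of k n "- cF D"] hk nz by force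
  fix i assume i: "i < r"
  show "mul D i \<le> 0"
  proof (rule ccontr)
    assume "\<not> mul D i \<le> 0"
    obtain z where z: "z \<in> p i" using assms(6) i by auto
    have "vanishes_along h z 0 (nat (mul D i))"
      using assms(1) i z unfolding sections_def mult_ge_def by auto
    then have "vanishes_along h z 0 1"
      using \<open>\<not> mul D i \<le> 0\<close> by (auto elim: vanishes_along_mono)
    then have "h z = 0" using vanishes_along_1[OF hirz_sections_poly_funs[OF hk(1)]] by simp
    then show False using assms(5)[of z] by simp
  qed
qed

text \<open>Each of the two equations divides the other, so the quotients are mutually inverse
  units.\<close>

lemma divisor_is_class_unique:
  assumes f: "divisor_is n r p D f E" and f': "divisor_is n r p D' f' E" and "\<exists>z. f z \<noteq> 0"
    and ne: "\<forall>i<r. p i \<noteq> {}"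
  shows "cF D = cF D'" "cH D = cH D'" "\<And>i. i < r \<Longrightarrow> mul D i = mul D' i"
proof -
  obtain h where h: "h \<in> sections n r p (pic_diff D D')" "f = (\<lambda>z. f' z * h z)"
    using divisor_is_dvd[OF f' f] by (elim bexE)
  obtain k where k: "k \<in> sections n r p (pic_diff D' D)" "f' = (\<lambda>z. f z * k z)"
    using divisor_is_dvd[OF f f'] by (elim bexE)
  have polys: "f \<in> poly_funs coords" "h \<in> poly_funs coords" "k \<in> poly_funs coords"
  proof -
    have "f \<in> sections n r p D" using f unfolding divisor_is_def by simp
    then show "f \<in> poly_funs coords" "h \<in> poly_funs coords" "k \<in> poly_funs coords"
      using h(1) k(1) unfolding sections_def by (blast intro: hirz_sections_poly_funs)+
  qed
  obtain z0 where z0: "f z0 \<noteq> 0" using assms(3) by blast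
  have hk: "h z * k z = 1" for z
  proof -
    have "h z * k z - 1 = 0"
    proof (rule poly_funs_domain[of f _ z0])
      fix z assume "f z \<noteq> 0"
      moreover have "f z = f z * k z * h z" using fun_cong[OF h(2), of z] fun_cong[OF k(2), of z] by metis
      ultimately show "h z * k z - 1 = 0" by (simp add: mult_ac)
    qed (use polys z0 in \<open>intro poly_funs_intros | simp\<close>)+
    then show ?thesis by simp
  qed
  then have kh: "k z * h z = 1" for z by (simp add: mult.commute)
  have neg: "cF (pic_diff D' D) = - cF (pic_diff D D')" "cH (pic_diff D' D) = - cH (pic_diff D D')"
    "cF (pic_diff D D') = - cF (pic_diff D' D)" "cH (pic_diff D D') = - cH (pic_diff D' D)"
    by (simp_all add: pic_diff_def)
  note inv = sections_invertible[OF h(1) k(1) neg(1,2) hk ne]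
  note inv' = sections_invertible[OF k(1) h(1) neg(3,4) kh ne]
  show "cF D = cF D'" "cH D = cH D'"
    using inv(1,2) unfolding pic_diff_def by simp_all
  show "mul D i = mul D' i" if "i < r" for i
    using inv(3)[OF that] inv'(3)[OF that] unfolding pic_diff_def by simp
qed

section \<open>Numerical classification of the possible classes\<close>

lemma minus_one_curve_class_equations:
  assumes "minus_one_curve n r p E" "belongs_to_system n r p a b 1 E"
    and "\<forall>i<r. p i \<noteq> {}"
  shows "2 * a * b + n * b * b + 1 = r" "2 * a + 2 * b + n * b = r + 1"
proof -
  define D' where "D' = Pic (int a) (int b) (\<lambda>_. int 1)"
  obtain D f where D: "divisor_is n r p D f E" "intersection n r D D = -1"
    "intersection n r D (canonical_class n) = -1" "irreducible_curve n r p E"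
    using assms(1) unfolding minus_one_curve_def has_class_def by blast
  obtain f' where f': "divisor_is n r p D' f' E"
    using assms(2) unfolding belongs_to_system_def D'_def by blast
  \<comment> \<open>The class \<open>D\<close> that witnesses \<open>minus_one_curve\<close> is a
    priori unrelated to that of the linear system; uniqueness identifies them below
    \<open>r\<close>.\<close>
  note eq = divisor_is_class_unique[OF D(1) f' divisor_is_nonzero[OF D(1,4)] assms(3)]
  have mul: "mul D i = 1" if "i < r" for i using eq(3)[OF that] unfolding D'_def by simp
  have sums: "(\<Sum>i<r. mul D i * mul D i) = int r" "(\<Sum>i<r. mul D i * - 1) = - int r"
  proof -
    have "(\<Sum>i<r. mul D i * mul D i) = (\<Sum>i<r. 1)" "(\<Sum>i<r. mul D i * - 1) = (\<Sum>i<r. - 1)"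
      by (rule sum.cong; simp add: mul)+
    then show "(\<Sum>i<r. mul D i * mul D i) = int r" "(\<Sum>i<r. mul D i * - 1) = - int r"
      by simp_all
  qed
  have cls: "cF D = int a" "cH D = int b" using eq(1,2) unfolding D'_def by simp_all
  have "intersection n r D D = 2 * (int a * int b) + int n * int b * int b - int r"
    unfolding intersection_def sums cls by simp
  moreover have "intersection n r D (canonical_class n)
      = int r - 2 * int a - 2 * int b - int n * int b"
    unfolding intersection_def canonical_class_def cls pic.sel sums by (simp add: algebra_simps)
  ultimately have "2 * (int a * int b) + int n * int b * int b + 1 = int r"
    "2 * int a + 2 * int b + int n * int b = int r + 1"
    using D(2,3) by linarith+
  then have "int (2 * a * b + n * b * b + 1) = int r" "int (2 * a + 2 * b + n * b) = int (r + 1)"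
    by simp_all
  then show "2 * a * b + n * b * b + 1 = r" "2 * a + 2 * b + n * b = r + 1"
    by (simp_all only: of_nat_eq_iff)
qed

lemma class_equations_listed:
  assumes "2 * a * b + n * b * b + 1 = r" "2 * a + 2 * b + n * b = (r :: nat) + 1"
  shows "listed_up_to_swap n r a b"
proof -
  have "int (2 * a * b + n * b * b + 1) = int r" "int (2 * a + 2 * b + n * b) = int (r + 1)"
    using assms by simp_all
  then have "(int b - 1) * (2 * (int a - 1) + int n * int b) = 0"
    unfolding of_nat_add of_nat_mult of_nat_numeral of_nat_1 left_diff_distrib right_diff_distrib
      distrib_left distrib_right mult_1_left mult_1_right
    by (simp only: mult_ac)
  then consider "int b = 1" | "2 * int a + int n * int b = 2" by auto
  then consider "b = 1" | "2 * a + n * b = 2"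
  proof cases
    case 2
    then have "int (2 * a + n * b) = int 2" by simp
    then show ?thesis using that(2) by (simp only: of_nat_eq_iff)
  qed simp
  then show ?thesis
  proof cases
    case 1
    then have "r = 2 * a + n + 1" using assms(1) by simp
    then show ?thesis using 1 unfolding listed_up_to_swap_def listed_def by blast
  next
    case 2
    \<comment> \<open>\<open>a = 1\<close>, \<open>n = 0\<close> is the family of sections with the
      rulings exchanged and \<open>e = b\<close>; \<open>n = 2\<close>, \<open>b = 1\<close> is the
      member \<open>e = 0\<close> of the family itself. The other two are the fibre and the
      conic.\<close>
    then consider "a = 1" "n = 0" | "a = 1" "b = 0" | "a = 0" "n = 1" "b = 2" | "a = 0" "n = 2" "b = 1"
    proof (cases "a = 0")
      case True
      then have nb: "n * b = 2" using 2 by simp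
      then have "b \<noteq> 0" "n \<noteq> 0" by (metis mult_0 mult_0_right zero_neq_numeral)+
      then have "n \<le> n * b" by simp
      then have "n = 1 \<or> n = 2" using nb \<open>n \<noteq> 0\<close> by linarith
      then show ?thesis using nb True that(3,4) by auto
    next
      case False
      then have "a = 1" "n * b = 0" using 2 by (cases a; simp)+
      then show ?thesis using that(1,2) by auto
    qed
    then show ?thesis
    proof cases
      case 1
      then have "r = 2 * b + 0 + 1" using assms(1) by simp
      then show ?thesis using 1 unfolding listed_up_to_swap_def listed_def by blast
    next
      case 4
      then have "r = 2 * 0 + n + 1" using assms(1) by simp
      then show ?thesis using 4 unfolding listed_up_to_swap_def listed_def by blast
    qed (use assms in \<open>simp_all add: listed_up_to_swap_def listed_def\<close>)
  qed
qed

subsection \<open>Rationally parametrized curves on the blow-up\<close>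

text \<open>The parametrization \<open>\<phi>\<close> may miss points of the curve.
  \<open>f_dvd\<close> combines density of its image with primality of \<open>f\<close>; the degrees
  there are arbitrary because \<open>divisor_is\<close> tests every class. One direction in
  \<open>f_simple\<close> suffices for multiplicity exactly one, and \<open>f_unique\<close> makes
  the linear system a single divisor.\<close>

locale blowup_curve =
  fixes n r :: nat and z :: "nat \<Rightarrow> cvec4" and p :: "nat \<Rightarrow> cvec4 set" and a b :: nat
    and f :: "cvec4 \<Rightarrow> complex" and \<phi> :: "complex \<Rightarrow> cvec4"
  assumes z_cox: "k < r \<Longrightarrow> z k \<in> cox_points"
    and p_eq: "k < r \<Longrightarrow> p k = Defs.orbit n (z k)"
    and f_hirz: "f \<in> hirz_sections n (int a) (int b)"
    and f_nonzero: "\<exists>x. f x \<noteq> 0"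
    and phi_poly: "\<exists>q. \<forall>t. \<phi> t $ i = poly q t"
    and phi_cox: "\<phi> t \<in> cox_points"
    and phi_inj: "inj (\<lambda>t. Defs.orbit n (\<phi> t))"
    and f_phi: "f (\<phi> t) = 0"
    and f_dvd: "g \<in> hirz_sections n a' b' \<Longrightarrow> (\<And>t. g (\<phi> t) = 0) \<Longrightarrow>
      \<exists>h\<in>poly_funs coords. \<forall>x. g x = f x * h x"
    and f_centre: "k < r \<Longrightarrow> f (z k) = 0"
    and f_simple: "k < r \<Longrightarrow> \<exists>w. \<not> vanishes_along f (z k) w 2"
    and f_unique: "g \<in> hirz_sections n (int a) (int b) \<Longrightarrow> (\<And>k. k < r \<Longrightarrow> g (z k) = 0) \<Longrightarrow>
      \<exists>c. g = (\<lambda>x. c * f x)"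
begin

definition cls :: pic where
  "cls = Pic (int a) (int b) (\<lambda>_. int 1)"

definition curve :: "blowup_point set" where
  "curve = {x \<in> blowup n r p. section_zero r p cls f x}"

lemma f_poly: "f \<in> poly_funs coords"
  using f_hirz by (rule hirz_sections_poly_funs)

lemma f_simple_orbit:
  assumes "k < r" "x \<in> p k"
  shows "\<exists>w. \<not> vanishes_along f x w 2"
proof -
  obtain w where w: "\<not> vanishes_along f (z k) w 2" using f_simple[OF assms(1)] by blast
  obtain l m where lm: "l \<noteq> 0" "m \<noteq> 0" "x = torus_act n l m (z k)"
    using assms p_eq by (auto elim: in_orbitE)
  then have "\<not> vanishes_along f x (torus_act n l m w) 2"
    using w vanishes_along_torus_act[OF f_hirz lm(1,2)] by blast
  then show ?thesis by blast
qed

lemma zero_on_orbit: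
  assumes "g \<in> hirz_sections n a' b'" "g x = 0" "y \<in> Defs.orbit n x"
  shows "g y = 0"
  using assms(3) by (rule in_orbitE) (use hirz_sections_torus_act[OF assms(1)] assms(2) in simp)

lemma f_sections: "f \<in> sections n r p cls"
proof -
  have "mult_ge f (p k) 1" if k: "k < r" for k
    unfolding mult_ge_def vanishes_along_1[OF f_poly]
    using zero_on_orbit[OF f_hirz f_centre[OF k]] p_eq[OF k] by simp
  then show ?thesis unfolding sections_def cls_def using f_hirz by simp
qed

text \<open>Points with \<open>z$1 * z$3 \<noteq> 0\<close> lie in \<open>cox_points\<close> and are
  dense.\<close>

lemma cox_nonzero: "\<exists>x\<in>cox_points. f x \<noteq> 0"
proof (rule ccontr)
  assume *: "\<not> ?thesis"
  obtain x0 where "f x0 \<noteq> 0" using f_nonzero by blast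
  moreover have "f x0 = 0"
  proof (rule poly_funs_domain[of "\<lambda>z. z$1 * z$3" f "vec4 1 1 1 1"])
    fix x :: cvec4 assume "x$1 * x$3 \<noteq> 0"
    then show "f x = 0" using * unfolding cox_points_def by auto
  qed (use f_poly in \<open>auto intro: poly_funs_intros\<close>)
  ultimately show False by simp
qed

lemma curve_ne_blowup: "curve \<noteq> blowup n r p"
proof -
  obtain x where x: "x \<in> cox_points" "f x \<noteq> 0" using cox_nonzero by blast
  have "Defs.orbit n x \<notin> p ` {..<r}"
  proof
    assume "Defs.orbit n x \<in> p ` {..<r}"
    then obtain k where k: "k < r" "Defs.orbit n x = p k" by auto
    then have "x \<in> Defs.orbit n (z k)" using self_in_orbit p_eq by blast
    then show False using zero_on_orbit[OF f_hirz f_centre[OF k(1)]] x by simp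
  qed
  then have "Outside (Defs.orbit n x) \<in> blowup n r p"
    unfolding blowup_def hirzebruch_def using x by auto
  moreover have "Outside (Defs.orbit n x) \<notin> curve"
    unfolding curve_def using x self_in_orbit by auto
  ultimately show ?thesis by blast
qed

text \<open>These are the parameters at which \<open>\<phi>\<close> runs through a centre, where the
  blow-up has tangent directions in place of an \<open>Outside\<close> point.\<close>

lemma finite_bad: "finite {t. Defs.orbit n (\<phi> t) \<in> p ` {..<r}}"
  using finite_vimageI[OF _ phi_inj, of "p ` {..<r}"] by (simp add: vimage_def)

lemma curve_outside:
  assumes "Defs.orbit n (\<phi> t) \<notin> p ` {..<r}"
  shows "Outside (Defs.orbit n (\<phi> t)) \<in> curve"
  using assms phi_cox zero_on_orbit[OF f_hirz f_phi]
  unfolding curve_def blowup_def hirzebruch_def by auto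

lemma infinite_curve: "infinite curve"
proof
  assume "finite curve"
  then have "finite {t. Outside (Defs.orbit n (\<phi> t)) \<in> curve}"
    using finite_vimageI[of curve "\<lambda>t. Outside (Defs.orbit n (\<phi> t))"] phi_inj
    by (auto simp: vimage_def inj_def)
  moreover have "UNIV = {t. Outside (Defs.orbit n (\<phi> t)) \<in> curve} \<union> {t. Defs.orbit n (\<phi> t) \<in> p ` {..<r}}"
    using curve_outside by blast
  ultimately have "finite (UNIV :: complex set)" using finite_bad by (metis finite_UnI)
  then show False using infinite_UNIV_char_0 by blast
qed

text \<open>Vanishing is known directly only away from the centres, that is at cofinitely many
  parameters, which suffices for a polynomial in \<open>t\<close>.\<close>

lemma vanishes_on_phi:
  assumes "g \<in> sections n r p D" "\<And>x. x \<in> curve \<Longrightarrow> section_zero r p D g x"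
  shows "g (\<phi> t) = 0"
proof -
  have "g \<in> poly_funs coords" using assms(1) unfolding sections_def by (auto dest: hirz_sections_poly_funs)
  then obtain q where q: "\<And>t. g (\<phi> t) = poly q t" using poly_funs_along4 phi_poly by metis
  have "q = 0"
  proof (rule poly_eqI_cofinite[OF finite_bad])
    fix t assume "t \<notin> {t. Defs.orbit n (\<phi> t) \<in> p ` {..<r}}"
    then have "section_zero r p D g (Outside (Defs.orbit n (\<phi> t)))"
      using assms(2)[OF curve_outside] by blast
    then show "poly q t = poly 0 t" using self_in_orbit q by (simp flip: q)
  qed
  then show ?thesis using q by simp
qed

text \<open>Since \<open>f\<close> has multiplicity exactly one at the centres, division lowers the
  multiplicity by at most one. Cancellation works in the directions where \<open>f\<close> has order
  1, and \<open>vanishes_along_generic\<close> extends the bound to those tangent to the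
  curve.\<close>

lemma section_multiple:
  assumes g: "g \<in> sections n r p D" and "\<And>t. g (\<phi> t) = 0"
  shows "\<exists>h\<in>sections n r p (pic_diff D cls). g = (\<lambda>x. f x * h x)"
proof -
  have gh: "g \<in> hirz_sections n (cF D) (cH D)" using g unfolding sections_def by simp
  obtain h where h: "h \<in> poly_funs coords" "\<And>x. g x = f x * h x"
    using f_dvd[OF gh assms(2)] by blast
  have g_eq: "g = (\<lambda>x. f x * h x)" using h(2) by blast
  obtain x0 where "f x0 \<noteq> 0" using f_nonzero by blast
  then have "h \<in> hirz_sections n (cF D - int a) (cH D - int b)"
    using hirz_sections_quotient[OF f_hirz _ h(1)] gh g_eq by simp
  moreover have "mult_ge h (p k) (nat (mul D k - 1))" if k: "k < r" for k
    unfolding mult_ge_def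
  proof (intro ballI allI)
    fix x w assume x: "x \<in> p k"
    obtain w0 where w0: "\<not> vanishes_along f x w0 2" using f_simple_orbit[OF k x] by blast
    show "vanishes_along h x w (nat (mul D k - 1))"
    proof (rule vanishes_along_generic[OF f_poly h(1) w0])
      fix w assume w: "\<not> vanishes_along f x w 2"
      have "vanishes_along (\<lambda>x. f x * h x) x w (nat (mul D k))"
        using g k x unfolding sections_def mult_ge_def g_eq by simp
      from vanishes_along_cancel[OF f_poly h(1) w this] have "vanishes_along h x w (nat (mul D k) - 1)" .
      \<comment> \<open>Both sides are truncated at 0, so negative multiplicities are
        covered.\<close>
      moreover have "nat (mul D k) - 1 = nat (mul D k - 1)" by linarith
      ultimately show "vanishes_along h x w (nat (mul D k - 1))" by simp
    qed
  qed
  ultimately have "h \<in> sections n r p (pic_diff D cls)"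
    unfolding sections_def pic_diff_def cls_def by simp
  then show ?thesis using g_eq by blast
qed

text \<open>On an exceptional curve the points of \<open>curve\<close> are the directions along
  which \<open>f\<close> vanishes to order 2, one more than its multiplicity; orders add under
  products.\<close>

lemma multiple_section_zero:
  assumes h: "h \<in> sections n r p (pic_diff D cls)" and x: "x \<in> curve"
  shows "section_zero r p D (\<lambda>x. f x * h x) x"
proof (cases x)
  case (Outside y)
  then show ?thesis using x unfolding curve_def by simp
next
  case (Direction d)
  have "vanishes_along (\<lambda>x. f x * h x) y w (nat (mul D i + 1))"
    if "(y, w) \<in> d" "i < r" "y \<in> p i" for y w i
  proof -
    have "vanishes_along f y w 2"
      using x that unfolding curve_def Direction cls_def by fastforce
    moreover have "vanishes_along h y w (nat (mul D i - 1))"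
      using h that unfolding sections_def mult_ge_def pic_diff_def cls_def by simp
    ultimately have "vanishes_along (\<lambda>x. f x * h x) y w (2 + nat (mul D i - 1))"
      by (rule vanishes_along_mult)
    \<comment> \<open>The bound \<open>nat (m + 1) \<le> 2 + nat (m - 1)\<close> is an equality for
      positive \<open>m\<close> and holds by truncation for the others.\<close>
    then show ?thesis by (rule vanishes_along_mono) linarith
  qed
  then show ?thesis using Direction by auto
qed

lemma divisor_curve: "divisor_is n r p cls f curve"
  unfolding divisor_is_def
proof (intro conjI allI ballI iffI)
  show "f \<in> sections n r p cls" by (rule f_sections)
next
  fix D g assume "g \<in> sections n r p D" "\<forall>x\<in>curve. section_zero r p D g x"
  then show "\<exists>h\<in>sections n r p (pic_diff D cls). g = (\<lambda>x. f x * h x)"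
    using vanishes_on_phi section_multiple by blast
next
  fix D g x assume "\<exists>h\<in>sections n r p (pic_diff D cls). g = (\<lambda>x. f x * h x)" "x \<in> curve"
  then show "section_zero r p D g x" using multiple_section_zero by blast
qed

lemma zariski_closed_curve: "zariski_closed n r p curve"
  unfolding zariski_closed_def
  by (rule exI[of _ "{(cls, f)}"]) (use f_sections in \<open>auto simp: curve_def\<close>)

text \<open>A defining section of \<open>Z\<close> that is nonzero at a point of the curve is no
  multiple of \<open>f\<close>, so its pullback \<open>q\<close> to the affine line is not
  0.\<close>

lemma not_subset_zariski_closed:
  assumes "zariski_closed n r p Z" "\<not> curve \<subseteq> Z"
  obtains q where "q \<noteq> 0" "\<And>t. Outside (Defs.orbit n (\<phi> t)) \<in> Z \<Longrightarrow> poly q t = 0"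
proof -
  obtain \<Phi> where \<Phi>: "\<forall>(D, f)\<in>\<Phi>. f \<in> sections n r p D"
    "Z = {x \<in> blowup n r p. \<forall>(D, f)\<in>\<Phi>. section_zero r p D f x}"
    using assms(1) unfolding zariski_closed_def by (elim exE conjE)
  obtain x where "x \<in> curve" "x \<notin> Z" using assms(2) by blast
  then obtain D g where Dg: "(D, g) \<in> \<Phi>" "\<not> section_zero r p D g x"
    unfolding \<Phi>(2) curve_def by blast
  then have g: "g \<in> sections n r p D" using \<Phi>(1) by blast
  then have "g \<in> poly_funs coords" unfolding sections_def by (auto dest: hirz_sections_poly_funs)
  then obtain q where q: "\<And>t. g (\<phi> t) = poly q t" using poly_funs_along4 phi_poly by metis
  have "q \<noteq> 0"
  proof
    assume "q = 0"
    then obtain h where "h \<in> sections n r p (pic_diff D cls)" "g = (\<lambda>x. f x * h x)"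
      using section_multiple[OF g] q by auto
    then show False using Dg(2) multiple_section_zero \<open>x \<in> curve\<close> by blast
  qed
  moreover have "poly q t = 0" if "Outside (Defs.orbit n (\<phi> t)) \<in> Z" for t
  proof -
    have "section_zero r p D g (Outside (Defs.orbit n (\<phi> t)))" using that Dg(1) unfolding \<Phi>(2) by blast
    then show ?thesis using self_in_orbit by (simp flip: q)
  qed
  ultimately show thesis by (rule that)
qed

text \<open>If two closed sets covering the curve both failed to contain it, the product of their
  polynomials would be nonzero and yet vanish at cofinitely many parameters.\<close>

lemma irreducible_curve: "irreducible_curve n r p curve"
  unfolding irreducible_curve_def
proof (intro conjI allI impI)
  fix Z Z' assume Z: "zariski_closed n r p Z" "zariski_closed n r p Z'" and sub: "curve \<subseteq> Z \<union> Z'"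
  show "curve \<subseteq> Z \<or> curve \<subseteq> Z'"
  proof (rule ccontr)
    assume "\<not> ?thesis"
    then obtain q q' where q: "q \<noteq> 0" "\<And>t. Outside (Defs.orbit n (\<phi> t)) \<in> Z \<Longrightarrow> poly q t = 0"
      and q': "q' \<noteq> 0" "\<And>t. Outside (Defs.orbit n (\<phi> t)) \<in> Z' \<Longrightarrow> poly q' t = 0"
      using not_subset_zariski_closed[OF Z(1)] not_subset_zariski_closed[OF Z(2)] by metis
    have "q * q' = 0"
    proof (rule poly_eqI_cofinite[OF finite_bad])
      fix t assume "t \<notin> {t. Defs.orbit n (\<phi> t) \<in> p ` {..<r}}"
      then have "Outside (Defs.orbit n (\<phi> t)) \<in> Z \<union> Z'" using curve_outside sub by blast
      then show "poly (q * q') t = poly 0 t" using q(2) q'(2) by auto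
    qed
    then show False using q(1) q'(1) by simp
  qed
qed (use zariski_closed_curve infinite_curve curve_ne_blowup in auto)

lemma system_is_curve: "system_is_curve n r p a b 1 curve"
proof -
  have "f \<in> linear_system n r p a b 1"
    unfolding linear_system_def using f_sections f_nonzero unfolding cls_def by auto
  moreover have "divisor_is n r p cls g curve" if g: "g \<in> linear_system n r p a b 1" for g
  proof -
    have gs: "g \<in> sections n r p cls" "g \<noteq> (\<lambda>_. 0)" using g unfolding linear_system_def cls_def by auto
    then have gh: "g \<in> hirz_sections n (int a) (int b)" unfolding sections_def cls_def by simp
    have "g (z k) = 0" if k: "k < r" for k
    proof -
      have "mult_ge g (p k) (nat (mul cls k))" using gs(1) k unfolding sections_def by simp
      then have "vanishes_along g (z k) 0 1"
        using self_in_orbit p_eq[OF k] unfolding mult_ge_def cls_def by simp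
      then show ?thesis using vanishes_along_1[OF hirz_sections_poly_funs[OF gh]] by simp
    qed
    then obtain c where c: "g = (\<lambda>x. c * f x)" using f_unique[OF gh] by blast
    then have c0: "c \<noteq> 0" using gs(2) by auto
    have scale: "(\<lambda>x. d * h x) \<in> sections n r p D" if "h \<in> sections n r p D" for d h D
      using that unfolding sections_def mult_ge_def by (auto intro: hirz_sections_cmult vanishes_along_cmult)
    have "(\<exists>h\<in>sections n r p (pic_diff D cls). u = (\<lambda>x. g x * h x))
        \<longleftrightarrow> (\<exists>h\<in>sections n r p (pic_diff D cls). u = (\<lambda>x. f x * h x))" for D u
    proof
      assume "\<exists>h\<in>sections n r p (pic_diff D cls). u = (\<lambda>x. g x * h x)"
      then obtain h where "h \<in> sections n r p (pic_diff D cls)" "u = (\<lambda>x. g x * h x)" by blast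
      then show "\<exists>h\<in>sections n r p (pic_diff D cls). u = (\<lambda>x. f x * h x)"
        by (intro bexI[OF _ scale[of h _ c]]) (auto simp: c)
    next
      assume "\<exists>h\<in>sections n r p (pic_diff D cls). u = (\<lambda>x. f x * h x)"
      then obtain h where "h \<in> sections n r p (pic_diff D cls)" "u = (\<lambda>x. f x * h x)" by blast
      then show "\<exists>h\<in>sections n r p (pic_diff D cls). u = (\<lambda>x. g x * h x)"
        using c0 by (intro bexI[OF _ scale[of h _ "inverse c"]]) (auto simp: c)
    qed
    then show ?thesis using divisor_curve gs(1) unfolding divisor_is_def by simp
  qed
  ultimately show ?thesis unfolding system_is_curve_def cls_def by blast
qed

lemma minus_one_curve:
  assumes "2 * a * b + n * b * b + 1 = r" "2 * a + 2 * b + n * b = r + 1"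
  shows "minus_one_curve n r p curve"
proof -
  have "int (2 * a * b + n * b * b + 1) = int r" "int (2 * a + 2 * b + n * b) = int (r + 1)"
    using assms by simp_all
  then have "2 * (int a * int b) + int n * int b * int b + 1 = int r"
    "2 * int a + 2 * int b + int n * int b = int r + 1" by simp_all
  moreover have "intersection n r cls cls = 2 * (int a * int b) + int n * int b * int b - int r"
    unfolding intersection_def cls_def by simp
  moreover have "intersection n r cls (canonical_class n)
      = int r - 2 * int a - 2 * int b - int n * int b"
    unfolding intersection_def canonical_class_def cls_def by (simp add: algebra_simps)
  ultimately have "intersection n r cls cls = -1" "intersection n r cls (canonical_class n) = -1"
    by linarith+
  then show ?thesis
    unfolding minus_one_curve_def has_class_def using irreducible_curve divisor_curve by blast
qed

end

subsection \<open>Square linear systems\<close>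

text \<open>The kernel form is what interpolation supplies and uses; the determinant form shows that
  it is an open condition.\<close>

lemma det_nonzero_iff:
  fixes M :: "nat \<Rightarrow> nat \<Rightarrow> complex"
  shows "Determinant.det (Matrix.mat N N (\<lambda>(k, i). M k i)) \<noteq> 0 \<longleftrightarrow>
    (\<forall>v. (\<forall>k<N. (\<Sum>i<N. v i * M k i) = 0) \<longrightarrow> (\<forall>i<N. v i = 0))"
proof -
  let ?A = "Matrix.mat N N (\<lambda>(k, i). M k i)"
  have A: "?A \<in> carrier_mat N N" by simp
  have prod: "?A *\<^sub>v Matrix.vec N v = 0\<^sub>v N \<longleftrightarrow> (\<forall>k<N. (\<Sum>i<N. v i * M k i) = 0)" for v
    by (auto simp: Matrix.vec_eq_iff scalar_prod_def mult.commute lessThan_atLeast0)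
  have vec0: "Matrix.vec N v = 0\<^sub>v N \<longleftrightarrow> (\<forall>i<N. v i = 0)" for v :: "nat \<Rightarrow> complex"
    by (auto simp: Matrix.vec_eq_iff)
  have "Determinant.det ?A = 0 \<longleftrightarrow> (\<exists>v. v \<in> carrier_vec N \<and> v \<noteq> 0\<^sub>v N \<and> ?A *\<^sub>v v = 0\<^sub>v N)"
    by (rule det_0_iff_vec_prod_zero[OF A])
  also have "\<dots> \<longleftrightarrow> (\<exists>v. Matrix.vec N v \<noteq> 0\<^sub>v N \<and> ?A *\<^sub>v Matrix.vec N v = 0\<^sub>v N)"
  proof
    assume "\<exists>v. v \<in> carrier_vec N \<and> v \<noteq> 0\<^sub>v N \<and> ?A *\<^sub>v v = 0\<^sub>v N"
    then obtain v where v: "v \<in> carrier_vec N" "v \<noteq> 0\<^sub>v N" "?A *\<^sub>v v = 0\<^sub>v N" by blast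
    moreover have "v = Matrix.vec N (vec_index v)" using v(1) by auto
    ultimately show "\<exists>v. Matrix.vec N v \<noteq> 0\<^sub>v N \<and> ?A *\<^sub>v Matrix.vec N v = 0\<^sub>v N" by metis
  qed (use vec_carrier in blast)
  finally show ?thesis unfolding prod vec0 by blast
qed

text \<open>Padding with a zero row gives a square matrix, which is singular because every Leibniz
  term contains an entry of that row.\<close>

lemma underdetermined_system:
  fixes M :: "nat \<Rightarrow> nat \<Rightarrow> complex"
  shows "\<exists>v. (\<forall>k<r. (\<Sum>i<Suc r. v i * M k i) = 0) \<and> (\<exists>i<Suc r. v i \<noteq> 0)"
proof -
  define M' where "M' = (\<lambda>k i. if k < r then M k i else 0)"
  have "Determinant.det (Matrix.mat (Suc r) (Suc r) (\<lambda>(k, i). M' k i)) = 0"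
  proof (subst det_def'[OF mat_carrier], rule sum.neutral, rule ballI)
    fix s assume "s \<in> {p. p permutes {0..<Suc r}}"
    then have "s r < Suc r" using permutes_in_image[of s "{0..<Suc r}" r] by simp
    then have "(\<Prod>i = 0..<Suc r. Matrix.mat (Suc r) (Suc r) (\<lambda>(k, i). M' k i) $$ (i, s i)) = 0"
      by (intro prod_zero[OF _ bexI[of _ r]]) (auto simp: M'_def)
    then show "signof s * (\<Prod>i = 0..<Suc r. Matrix.mat (Suc r) (Suc r) (\<lambda>(k, i). M' k i) $$ (i, s i)) = 0"
      by simp
  qed
  then obtain v where v: "\<forall>k<Suc r. (\<Sum>i<Suc r. v i * M' k i) = 0" "\<not> (\<forall>i<Suc r. v i = 0)"
    using det_nonzero_iff[of "Suc r" M'] by blast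
  have "(\<Sum>i<Suc r. v i * M k i) = 0" if "k < r" for k
    using v(1)[rule_format, of k] that unfolding M'_def by simp
  then show ?thesis using v(2) by blast
qed

lemma poly_funs_det:
  assumes "\<And>k i. k < N \<Longrightarrow> i < N \<Longrightarrow> M k i \<in> poly_funs X"
  shows "(\<lambda>z. Determinant.det (Matrix.mat N N (\<lambda>(k, i). M k i z))) \<in> poly_funs X"
proof -
  have "(\<lambda>z. \<Sum>s | s permutes {0..<N}. signof s * (\<Prod>i = 0..<N. M i (s i) z)) \<in> poly_funs X"
  proof (intro poly_funs_sum poly_funs_cmult poly_funs_prod assms)
    fix s i assume "s \<in> {p. p permutes {0..<N}}" "i \<in> {0..<N}"
    then show "s i < N" using permutes_in_image[of s "{0..<N}" i] by simp
  qed simp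
  moreover have "Determinant.det (Matrix.mat N N (\<lambda>(k, i). M k i z))
      = (\<Sum>s | s permutes {0..<N}. signof s * (\<Prod>i = 0..<N. M i (s i) z))" for z
  proof -
    have "(\<Prod>i = 0..<N. Matrix.mat N N (\<lambda>(k, i). M k i z) $$ (i, s i)) = (\<Prod>i = 0..<N. M i (s i) z)"
      if "s permutes {0..<N}" for s
      using that permutes_in_image[of s "{0..<N}"] by (intro prod.cong) auto
    then show ?thesis by (subst det_def'[OF mat_carrier]) (auto intro!: sum.cong)
  qed
  ultimately show ?thesis by simp
qed

subsection \<open>Open conditions on tuples of points\<close>

abbreviation tuple_coords :: "nat \<Rightarrow> ((nat \<Rightarrow> cvec4) \<Rightarrow> complex) set" where
  "tuple_coords r \<equiv> {(\<lambda>z. z k $ i) | k i. k < r}"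

text \<open>Torus invariance lets the condition descend from representatives to points of the
  surface. Nonemptiness refers to tuples of arbitrary vectors, which form an affine space;
  membership in \<open>cox_points\<close> is a consequence of
  \<open>general_position\<close>.\<close>

definition open_condition :: "nat \<Rightarrow> nat \<Rightarrow> ((nat \<Rightarrow> cvec4) \<Rightarrow> bool) \<Rightarrow> bool" where
  "open_condition n r C \<longleftrightarrow>
     (\<exists>F\<in>poly_funs (tuple_coords r). \<forall>z. C z \<longleftrightarrow> F z \<noteq> 0) \<and> (\<exists>z. C z) \<and>
     (\<forall>z z'. (\<forall>k<r. \<exists>l m. l \<noteq> 0 \<and> m \<noteq> 0 \<and> z' k = torus_act n l m (z k)) \<longrightarrow> C z \<longrightarrow> C z')"

lemma open_conditionI:
  assumes "F \<in> poly_funs (tuple_coords r)" "\<And>z. C z \<longleftrightarrow> F z \<noteq> 0" "C z0"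
    and "\<And>z l m. (\<And>k. k < r \<Longrightarrow> l k \<noteq> 0 \<and> m k \<noteq> 0) \<Longrightarrow> C z \<Longrightarrow>
      (\<And>z'. (\<And>k. k < r \<Longrightarrow> z' k = torus_act n (l k) (m k) (z k)) \<Longrightarrow> C z')"
  shows "open_condition n r C"
  unfolding open_condition_def
proof (intro conjI allI impI)
  fix z z' assume *: "\<forall>k<r. \<exists>l m. l \<noteq> 0 \<and> m \<noteq> 0 \<and> z' k = torus_act n l m (z k)" and "C z"
  obtain l m where "\<forall>k<r. l k \<noteq> 0 \<and> m k \<noteq> 0 \<and> z' k = torus_act n (l k) (m k) (z k)"
    using * by metis
  then show "C z'" using assms(4)[of l m z z'] \<open>C z\<close> by blast
qed (use assms(1-3) in blast)+

lemma poly_funs_tuple_line: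
  assumes "F \<in> poly_funs (tuple_coords r)"
  shows "\<exists>q. \<forall>c. F (\<lambda>k. z k + c *s (z' k - z k)) = poly q c"
proof (rule poly_funs_along[OF assms])
  fix x assume "x \<in> tuple_coords r"
  then obtain k i where "x = (\<lambda>z. z k $ i)" by blast
  then show "\<exists>q. \<forall>c. x (\<lambda>k. z k + c *s (z' k - z k)) = poly q c"
    by (intro exI[of _ "[:z k $ i, z' k $ i - z k $ i:]"]) (simp add: algebra_simps)
qed

lemma open_condition_True: "open_condition n r (\<lambda>_. True)"
  by (rule open_conditionI[of "\<lambda>_. 1"]) (auto intro: poly_funs.const)

text \<open>Irreducibility of affine space: on the line joining a witness of each condition, both
  conditions become nonvanishing of a nonzero polynomial.\<close>

lemma open_condition_conj:
  assumes "open_condition n r C" "open_condition n r D"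
  shows "open_condition n r (\<lambda>z. C z \<and> D z)"
proof -
  obtain F z where F: "F \<in> poly_funs (tuple_coords r)" "\<And>z. C z \<longleftrightarrow> F z \<noteq> 0" "F z \<noteq> 0"
    using assms(1) unfolding open_condition_def by blast
  obtain G z' where G: "G \<in> poly_funs (tuple_coords r)" "\<And>z. D z \<longleftrightarrow> G z \<noteq> 0" "G z' \<noteq> 0"
    using assms(2) unfolding open_condition_def by blast
  let ?l = "\<lambda>c k. z k + c *s (z' k - z k)"
  obtain p where p: "\<And>c. F (?l c) = poly p c" using poly_funs_tuple_line[OF F(1)] by metis
  obtain q where q: "\<And>c. G (?l c) = poly q c" using poly_funs_tuple_line[OF G(1)] by metis
  have "poly p 0 \<noteq> 0" "poly q 1 \<noteq> 0" using F(3) G(3) p[of 0] q[of 1] by simp_all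
  then have "p * q \<noteq> 0" by auto
  then obtain c where "poly (p * q) c \<noteq> 0" using poly_all_0_iff_0 by blast
  then have ex: "F (?l c) * G (?l c) \<noteq> 0" using p q by simp
  show ?thesis unfolding open_condition_def
  proof (intro conjI)
    show "\<exists>H\<in>poly_funs (tuple_coords r). \<forall>z. (C z \<and> D z) \<longleftrightarrow> H z \<noteq> 0"
      by (rule bexI[of _ "\<lambda>z. F z * G z"]) (use F G in \<open>auto intro: poly_funs.mult\<close>)
    show "\<exists>z. C z \<and> D z" using ex F(2) G(2) by (intro exI[of _ "?l c"]) simp
  qed (use assms in \<open>unfold open_condition_def, blast\<close>)
qed

lemma open_condition_all:
  assumes "finite I" "\<And>i. i \<in> I \<Longrightarrow> open_condition n r (C i)"
  shows "open_condition n r (\<lambda>z. \<forall>i\<in>I. C i z)"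
  using assms by (induction I) (auto intro: open_condition_True open_condition_conj)

lemma open_condition_imp:
  "(P \<Longrightarrow> open_condition n r C) \<Longrightarrow> open_condition n r (\<lambda>z. P \<longrightarrow> C z)"
  by (cases P) (auto intro: open_condition_True)

lemma open_condition_all_less:
  "(\<And>i. i < (N :: nat) \<Longrightarrow> open_condition n r (C i)) \<Longrightarrow> open_condition n r (\<lambda>z. \<forall>i<N. C i z)"
  using open_condition_all[of "{..<N}" n r C] unfolding Ball_def lessThan_iff by simp

lemma poly_funs_tuple_component:
  assumes "k < r" "f \<in> poly_funs coords"
  shows "(\<lambda>z. f (z k)) \<in> poly_funs (tuple_coords r)"
  by (rule poly_funs_compose4[OF assms(2)]) (use assms(1) in \<open>auto intro: poly_funs.coord\<close>)

lemma open_condition_nonzero: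
  assumes "k < r" "f \<in> hirz_sections n a b" "f x \<noteq> 0"
  shows "open_condition n r (\<lambda>z. f (z k) \<noteq> 0)"
proof (rule open_conditionI)
  show "(\<lambda>z. f (z k)) \<in> poly_funs (tuple_coords r)"
    using assms by (intro poly_funs_tuple_component hirz_sections_poly_funs)
  show "f ((\<lambda>_. x) k) \<noteq> 0" using assms(3) .
qed (use assms hirz_sections_torus_act[OF assms(2)] in auto)

text \<open>All \<open>g i\<close> have the same bidegree, so the torus multiplies each equation by
  a nonzero factor and leaves the solutions unchanged.\<close>

lemma open_condition_kernel:
  fixes N :: nat
  assumes sec: "\<And>i. i < N \<Longrightarrow> g i \<in> hirz_sections n a b" and \<sigma>: "\<And>k. k < N \<Longrightarrow> \<sigma> k < r"
    and wit: "\<And>v i. (\<And>k. k < N \<Longrightarrow> (\<Sum>i<N. v i * g i (z0 (\<sigma> k))) = 0) \<Longrightarrow> i < N \<Longrightarrow> v i = 0"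
  shows "open_condition n r
    (\<lambda>z. \<forall>v. (\<forall>k<N. (\<Sum>i<N. v i * g i (z (\<sigma> k))) = 0) \<longrightarrow> (\<forall>i<N. v i = 0))"
proof (rule open_conditionI)
  show "(\<lambda>z. Determinant.det (Matrix.mat N N (\<lambda>(k, i). g i (z (\<sigma> k))))) \<in> poly_funs (tuple_coords r)"
    by (intro poly_funs_det poly_funs_tuple_component \<sigma> hirz_sections_poly_funs[OF sec])
  show "(\<forall>v. (\<forall>k<N. (\<Sum>i<N. v i * g i (z (\<sigma> k))) = 0) \<longrightarrow> (\<forall>i<N. v i = 0))
      \<longleftrightarrow> Determinant.det (Matrix.mat N N (\<lambda>(k, i). g i (z (\<sigma> k)))) \<noteq> 0" for z
    unfolding det_nonzero_iff ..
  show "\<forall>v. (\<forall>k<N. (\<Sum>i<N. v i * g i (z0 (\<sigma> k))) = 0) \<longrightarrow> (\<forall>i<N. v i = 0)"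
    using wit by blast
next
  fix z l m z'
  assume lm: "\<And>k. k < r \<Longrightarrow> l k \<noteq> 0 \<and> m k \<noteq> 0"
    and z': "\<And>k. k < r \<Longrightarrow> z' k = torus_act n (l k) (m k) (z k)"
    and C: "\<forall>v. (\<forall>k<N. (\<Sum>i<N. v i * g i (z (\<sigma> k))) = 0) \<longrightarrow> (\<forall>i<N. v i = 0)"
  have eq: "(\<Sum>i<N. v i * g i (z' (\<sigma> k))) = l (\<sigma> k) powi a * m (\<sigma> k) powi b * (\<Sum>i<N. v i * g i (z (\<sigma> k)))"
    if "k < N" for v k
    unfolding sum_distrib_left
    by (rule sum.cong) (use z' \<sigma> lm that hirz_sections_torus_act[OF sec] in auto)
  have "(\<Sum>i<N. v i * g i (z' (\<sigma> k))) = 0 \<longleftrightarrow> (\<Sum>i<N. v i * g i (z (\<sigma> k))) = 0" if "k < N" for v k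
    unfolding eq[OF that] using lm[OF \<sigma>[OF that]] by simp
  then show "\<forall>v. (\<forall>k<N. (\<Sum>i<N. v i * g i (z' (\<sigma> k))) = 0) \<longrightarrow> (\<forall>i<N. v i = 0)"
    using C by simp
qed

text \<open>By invariance, membership in \<open>U\<close> does not depend on the representatives, so
  a single polynomial defines \<open>U\<close>.\<close>

lemma zariski_open_prod_open_condition:
  assumes "open_condition n r C"
  defines "U \<equiv> {\<lambda>k\<in>{..<r}. Defs.orbit n (z k) | z. (\<forall>k<r. z k \<in> cox_points) \<and> C z}"
  shows "zariski_open_prod n r U"
proof -
  obtain F where F: "F \<in> poly_funs (tuple_coords r)" "\<And>z. C z \<longleftrightarrow> F z \<noteq> 0"
    and inv: "\<And>z z'. (\<forall>k<r. \<exists>l m. l \<noteq> 0 \<and> m \<noteq> 0 \<and> z' k = torus_act n l m (z k)) \<Longrightarrow> C z \<Longrightarrow> C z'"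
    using assms(1) unfolding open_condition_def by blast
  have "(\<lambda>k\<in>{..<r}. Defs.orbit n (z k)) \<in> U \<longleftrightarrow> C z" if cox: "\<forall>k<r. z k \<in> cox_points" for z
  proof
    assume "(\<lambda>k\<in>{..<r}. Defs.orbit n (z k)) \<in> U"
    then obtain z' where z': "(\<lambda>k\<in>{..<r}. Defs.orbit n (z k)) = (\<lambda>k\<in>{..<r}. Defs.orbit n (z' k))" "C z'"
      unfolding U_def by blast
    have "\<exists>l m. l \<noteq> 0 \<and> m \<noteq> 0 \<and> z k = torus_act n l m (z' k)" if "k < r" for k
    proof -
      have "Defs.orbit n (z' k) = Defs.orbit n (z k)" using fun_cong[OF z'(1), of k] that by simp
      then show ?thesis by (elim orbit_eqE) blast
    qed
    then show "C z" using inv z'(2) by blast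
  qed (use cox in \<open>auto simp: U_def\<close>)
  then have "\<forall>z. (\<forall>k<r. z k \<in> cox_points) \<longrightarrow>
      ((\<lambda>k\<in>{..<r}. Defs.orbit n (z k)) \<in> U \<longleftrightarrow> (\<exists>f\<in>{F}. f z \<noteq> 0))"
    using F(2) by simp
  moreover have "U \<subseteq> {..<r} \<rightarrow>\<^sub>E hirzebruch n" unfolding U_def hirzebruch_def by auto
  ultimately show ?thesis unfolding zariski_open_prod_def using F(1) by blast
qed

subsection \<open>Interpolation conditions\<close>

text \<open>The first \<open>e\<close> functions span \<open>z\<^sub>4\<close> times the forms of degree \<open>e - 1\<close>, the others span
  \<open>z\<^sub>3\<close> times the forms of degree \<open>e + m - 1\<close>.\<close>

definition interp_fun :: "nat \<Rightarrow> nat \<Rightarrow> nat \<Rightarrow> cvec4 \<Rightarrow> complex" where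
  "interp_fun e m i z = (if i < e then z$1 ^ (e - 1 - i) * z$2 ^ i * z$4
     else z$1 ^ (e + m - 1 - (i - e)) * z$2 ^ (i - e) * z$3)"

text \<open>The square system for sections of class \<open>(e - 1) F + H\<close>: their space has
  dimension \<open>2 * e + m\<close>, the number of points selected by
  \<open>\<sigma>\<close>.\<close>

definition interp_cond :: "nat \<Rightarrow> nat \<Rightarrow> (nat \<Rightarrow> nat) \<Rightarrow> (nat \<Rightarrow> cvec4) \<Rightarrow> bool" where
  "interp_cond e m \<sigma> z \<longleftrightarrow> (\<forall>v. (\<forall>k<2*e+m. (\<Sum>i<2*e+m. v i * interp_fun e m i (z (\<sigma> k))) = 0) \<longrightarrow>
     (\<forall>i<2*e+m. v i = 0))"

lemma interp_fun_hirz_sections: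
  assumes "i < 2 * e + n"
  shows "interp_fun e n i \<in> hirz_sections n (int e - 1) 1"
proof (cases "i < e")
  case True
  then have "interp_fun e n i = (\<lambda>z. z$1 ^ (e - 1 - i) * z$2 ^ i * z$3 ^ 0 * z$4 ^ 1)"
    by (auto simp: interp_fun_def)
  moreover have "int (e - 1 - i + i) - int n * int 0 = int e - 1" using True by simp
  ultimately show ?thesis using hirz_sections_monomial[of "e - 1 - i" i 0 1 n] by simp
next
  case False
  then have "interp_fun e n i = (\<lambda>z. z$1 ^ (e + n - 1 - (i - e)) * z$2 ^ (i - e) * z$3 ^ 1 * z$4 ^ 0)"
    by (auto simp: interp_fun_def)
  moreover have "int (e + n - 1 - (i - e) + (i - e)) - int n * int 1 = int e - 1" using False assms by simp
  ultimately show ?thesis using hirz_sections_monomial[of "e + n - 1 - (i - e)" "i - e" 1 0 n] by simp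
qed

lemma sum_interp_fun:
  "(\<Sum>i<2*e+m. v i * interp_fun e m i (vec4 1 x 1 y))
     = (\<Sum>i<e. v i * x ^ i) * y + (\<Sum>i<e+m. v (e + i) * x ^ i)"
proof -
  have "(\<Sum>i<2*e+m. v i * interp_fun e m i (vec4 1 x 1 y))
      = (\<Sum>i<e. v i * interp_fun e m i (vec4 1 x 1 y)) + (\<Sum>i<e+m. v (e+i) * interp_fun e m (e+i) (vec4 1 x 1 y))"
    using sum.atLeastLessThan_concat[of 0 e "2*e+m" "\<lambda>i. v i * interp_fun e m i (vec4 1 x 1 y)"]
      sum.shift_bounds_nat_ivl[of "\<lambda>i. v i * interp_fun e m i (vec4 1 x 1 y)" 0 e "e+m"]
    by (simp add: lessThan_atLeast0 add_ac mult_2)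
  then show ?thesis by (simp add: interp_fun_def sum_distrib_left mult_ac)
qed

lemma poly_as_sum_lessThan:
  fixes a :: "complex poly"
  assumes "\<And>i. i \<ge> d \<Longrightarrow> Polynomial.coeff a i = 0"
  shows "poly a x = (\<Sum>i<d. Polynomial.coeff a i * x ^ i)"
proof -
  have "a = (\<Sum>i<d. Polynomial.monom (Polynomial.coeff a i) i)"
    using assms by (intro poly_eqI) (auto simp: coeff_sum coeff_monom sum.delta if_distrib not_less cong: if_cong)
  then have "poly a x = poly (\<Sum>i<d. Polynomial.monom (Polynomial.coeff a i) i) x" by simp
  then show ?thesis by (simp add: poly_sum poly_monom)
qed

text \<open>The degree bounds are strict and are phrased by vanishing coefficients, so that
  \<open>e = 0\<close> leaves \<open>a = 0\<close> as the admissible case.\<close>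

lemma interp_condD:
  fixes a b :: "complex poly"
  assumes "interp_cond e m \<sigma> z" "\<And>k. k < 2*e+m \<Longrightarrow> z (\<sigma> k) = vec4 1 (x (\<sigma> k)) 1 (y (\<sigma> k))"
    and a: "\<And>i. i \<ge> e \<Longrightarrow> Polynomial.coeff a i = 0"
    and b: "\<And>i. i \<ge> e + m \<Longrightarrow> Polynomial.coeff b i = 0"
    and van: "\<And>k. k < 2*e+m \<Longrightarrow> poly a (x (\<sigma> k)) * y (\<sigma> k) + poly b (x (\<sigma> k)) = 0"
  shows "a = 0 \<and> b = 0"
proof -
  define v where "v i = (if i < e then Polynomial.coeff a i else Polynomial.coeff b (i - e))" for i
  have pa: "poly a x = (\<Sum>i<e. Polynomial.coeff a i * x ^ i)" for x
    by (rule poly_as_sum_lessThan) (rule a)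
  have pb: "poly b x = (\<Sum>i<e+m. Polynomial.coeff b i * x ^ i)" for x
    by (rule poly_as_sum_lessThan) (rule b)
  have "(\<Sum>i<2*e+m. v i * interp_fun e m i (z (\<sigma> k))) = 0" if k: "k < 2*e+m" for k
    using van[OF k] unfolding assms(2)[OF k] sum_interp_fun pa pb by (simp add: v_def)
  then have v0: "v i = 0" if "i < 2*e+m" for i using assms(1) that unfolding interp_cond_def by blast
  have "Polynomial.coeff a i = 0" for i
    using a[of i] v0[of i] by (cases "i < e") (auto simp: v_def)
  moreover have "Polynomial.coeff b i = 0" for i
    using b[of i] v0[of "e + i"] by (cases "i < e + m") (auto simp: v_def)
  ultimately show ?thesis by (simp add: poly_eq_iff)
qed

lemma poly_zero_by_roots:
  fixes p :: "complex poly"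
  assumes "finite A" "\<And>x. x \<in> A \<Longrightarrow> poly p x = 0" "\<And>i. i \<ge> card A \<Longrightarrow> Polynomial.coeff p i = 0"
  shows "p = 0"
proof (rule ccontr)
  assume "p \<noteq> 0"
  then have "card A \<le> card {x. poly p x = 0}" using assms(2) by (intro card_mono poly_roots_finite) auto
  also have "\<dots> \<le> Polynomial.degree p" using card_poly_roots_bound \<open>p \<noteq> 0\<close> by blast
  finally show False using assms(3)[of "Polynomial.degree p"] \<open>p \<noteq> 0\<close> by simp
qed

text \<open>On the graph of \<open>x ^ (e + m)\<close> the expression \<open>a y + b\<close> becomes
  a polynomial of degree below \<open>2 * e + m\<close> in which the coefficients of
  \<open>b\<close> and of \<open>a\<close> occupy disjoint ranges. With that many roots it is 0, and
  both parts with it.\<close>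

lemma interp_cond_witness:
  assumes "inj_on \<sigma> {..<2*e+m}"
  shows "interp_cond e m \<sigma> (\<lambda>k. vec4 1 (of_nat k) 1 (of_nat k ^ (e + m)))"
  unfolding interp_cond_def
proof (intro allI impI)
  fix v i assume van: "\<forall>k<2*e+m. (\<Sum>i<2*e+m. v i *
      interp_fun e m i (vec4 1 (of_nat (\<sigma> k)) 1 (of_nat (\<sigma> k) ^ (e + m)))) = 0" and i: "i < 2*e+m"
  define u where "u j = (if j < e + m then v (e + j) else v (j - (e + m)))" for j
  define P where "P = (\<Sum>j<2*e+m. Polynomial.monom (u j) j)"
  have coeffP: "Polynomial.coeff P j = (if j < 2*e+m then u j else 0)" for j
    unfolding P_def by (simp add: coeff_sum coeff_monom sum.delta)
  have "P = 0"
  proof (rule poly_zero_by_roots[of "(\<lambda>k. of_nat (\<sigma> k)) ` {..<2*e+m}"])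
    have "inj_on (\<lambda>k. of_nat (\<sigma> k) :: complex) {..<2*e+m}" using assms by (auto simp: inj_on_def)
    then have "card ((\<lambda>k. of_nat (\<sigma> k) :: complex) ` {..<2*e+m}) = 2*e+m" by (simp add: card_image)
    then show "Polynomial.coeff P i = 0" if "card ((\<lambda>k. of_nat (\<sigma> k) :: complex) ` {..<2*e+m}) \<le> i" for i
      using that coeffP by simp
    fix x :: complex assume "x \<in> (\<lambda>k. of_nat (\<sigma> k)) ` {..<2*e+m}"
    then obtain k where k: "k < 2*e+m" "x = of_nat (\<sigma> k)" by auto
    have "poly P x = (\<Sum>j<2*e+m. u j * x ^ j)" unfolding P_def by (simp add: poly_sum poly_monom)
    also have "\<dots> = (\<Sum>j<e+m. u j * x ^ j) + (\<Sum>j<e. u (j + (e+m)) * x ^ (j + (e+m)))"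
      using sum.atLeastLessThan_concat[of 0 "e+m" "2*e+m" "\<lambda>j. u j * x ^ j"]
        sum.shift_bounds_nat_ivl[of "\<lambda>j. u j * x ^ j" 0 "e+m" e]
      by (simp add: lessThan_atLeast0 add_ac mult_2)
    also have "\<dots> = (\<Sum>i<e. v i * x ^ i) * x ^ (e + m) + (\<Sum>i<e+m. v (e + i) * x ^ i)"
      by (simp add: u_def sum_distrib_left power_add mult_ac)
    also have "\<dots> = 0" using van[rule_format, OF k(1)] unfolding sum_interp_fun k(2) .
    finally show "poly P x = 0" .
  qed simp
  then have u0: "u j = 0" if "j < 2*e+m" for j using coeffP[of j] that by simp
  show "v i = 0"
  proof (cases "i < e")
    case True
    then show ?thesis using u0[of "i + (e + m)"] by (simp add: u_def)
  next
    case False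
    then have "i - e < e + m" "i - e < 2*e+m" "e + (i - e) = i" using i by linarith+
    then show ?thesis using u0[of "i - e"] by (simp add: u_def)
  qed
qed

lemma open_condition_interp_cond:
  assumes "\<And>k. k < 2*e+n \<Longrightarrow> \<sigma> k < r" "inj_on \<sigma> {..<2*e+n}"
  shows "open_condition n r (interp_cond e n \<sigma>)"
proof -
  have "open_condition n r (\<lambda>z. \<forall>v. (\<forall>k<2*e+n. (\<Sum>i<2*e+n. v i * interp_fun e n i (z (\<sigma> k))) = 0) \<longrightarrow>
     (\<forall>i<2*e+n. v i = 0))"
  proof (rule open_condition_kernel)
    show "interp_fun e n i \<in> hirz_sections n (int e - 1) 1" if "i < 2*e+n" for i
      using that by (rule interp_fun_hirz_sections)
    show "\<sigma> k < r" if "k < 2*e+n" for k using that by (rule assms(1))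
    fix v i assume "\<And>k. k < 2*e+n \<Longrightarrow> (\<Sum>i<2*e+n. v i *
      interp_fun e n i ((\<lambda>k. vec4 1 (of_nat k) 1 (of_nat k ^ (e + n))) (\<sigma> k))) = 0" "i < 2*e+n"
    then show "v i = 0" using interp_cond_witness[OF assms(2)] unfolding interp_cond_def by blast
  qed
  moreover have "interp_cond e n \<sigma> = (\<lambda>z. \<forall>v. (\<forall>k<2*e+n. (\<Sum>i<2*e+n. v i * interp_fun e n i (z (\<sigma> k))) = 0) \<longrightarrow>
     (\<forall>i<2*e+n. v i = 0))" by (auto simp: interp_cond_def)
  ultimately show ?thesis by simp
qed

subsection \<open>Exchanging the rulings of the quadric\<close>

text \<open>Compatible with the torus action for index 0, where \<open>z$3\<close> and
  \<open>z$4\<close> have equal weights.\<close>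

definition swap :: "cvec4 \<Rightarrow> cvec4" where
  "swap z = vec4 (z$3) (z$4) (z$1) (z$2)"

lemma swap_nth [simp]: "swap z $ 1 = z$3" "swap z $ 2 = z$4" "swap z $ 3 = z$1" "swap z $ 4 = z$2"
  by (simp_all add: swap_def)

lemma swap_swap [simp]: "swap (swap z) = z"
  by (simp add: vec4_eq_iff)

lemma swap_torus_act: "swap (torus_act 0 l m z) = torus_act 0 m l (swap z)"
  by (simp add: vec4_eq_iff)

lemma swap_linear: "swap (z + c *s w) = swap z + c *s swap w"
  by (simp add: vec4_eq_iff)

lemma swap_cox: "swap z \<in> cox_points \<longleftrightarrow> z \<in> cox_points"
  unfolding cox_points_def by auto

lemma poly_funs_swap:
  "f \<in> poly_funs coords \<Longrightarrow> (\<lambda>z. f (swap z)) \<in> poly_funs coords"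
  unfolding swap_def by (rule poly_funs_comp_vec4) auto

lemma hirz_sections_swap:
  "f \<in> hirz_sections 0 a b \<Longrightarrow> (\<lambda>z. f (swap z)) \<in> hirz_sections 0 b a"
  by (rule hirz_sectionsI)
     (auto simp: swap_torus_act hirz_sections_torus_act intro: poly_funs_swap hirz_sections_poly_funs)

lemma orbit_swap_eq:
  "Defs.orbit 0 (swap z) = Defs.orbit 0 (swap z') \<longleftrightarrow> Defs.orbit 0 z = Defs.orbit 0 z'"
proof -
  have imp: "Defs.orbit 0 (swap z) = Defs.orbit 0 (swap z')" if "Defs.orbit 0 z = Defs.orbit 0 z'" for z z'
    using that by (rule orbit_eqE) (simp add: swap_torus_act orbit_torus_act)
  show ?thesis using imp[of z z'] imp[of "swap z" "swap z'", unfolded swap_swap] by blast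
qed

lemma open_condition_swap:
  assumes "open_condition 0 r C"
  shows "open_condition 0 r (\<lambda>z. C (\<lambda>k. swap (z k)))"
proof -
  obtain F z0 where F: "F \<in> poly_funs (tuple_coords r)" "\<And>z. C z \<longleftrightarrow> F z \<noteq> 0" "C z0"
    and inv: "\<And>z z'. (\<forall>k<r. \<exists>l m. l \<noteq> 0 \<and> m \<noteq> 0 \<and> z' k = torus_act 0 l m (z k)) \<Longrightarrow> C z \<Longrightarrow> C z'"
    using assms unfolding open_condition_def by blast
  show ?thesis
  proof (rule open_conditionI)
    show "(\<lambda>z. F (\<lambda>k. swap (z k))) \<in> poly_funs (tuple_coords r)"
    proof (rule poly_funs_compose[OF F(1)])
      fix x assume "x \<in> tuple_coords r"
      then obtain k i where ki: "x = (\<lambda>z. z k $ i)" "k < r" by blast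
      then show "(\<lambda>z. x (\<lambda>k. swap (z k))) \<in> poly_funs (tuple_coords r)"
        using poly_funs_tuple_component[OF ki(2) poly_funs_swap[OF poly_funs_coord[of i]]] by simp
    qed
    show "C (\<lambda>k. swap ((\<lambda>k. swap (z0 k)) k))" using F(3) by simp
    fix z l m z'
    assume lm: "\<And>k. k < r \<Longrightarrow> l k \<noteq> 0 \<and> m k \<noteq> 0" and C: "C (\<lambda>k. swap (z k))"
      and z': "\<And>k. k < r \<Longrightarrow> z' k = torus_act 0 (l k) (m k) (z k)"
    have "\<exists>l m. l \<noteq> 0 \<and> m \<noteq> 0 \<and> swap (z' k) = torus_act 0 l m (swap (z k))" if "k < r" for k
      using lm[OF that] unfolding z'[OF that] swap_torus_act by blast
    then show "C (\<lambda>k. swap (z' k))"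
      using inv[of "\<lambda>k. swap (z' k)" "\<lambda>k. swap (z k)"] C by blast
  qed (use F(2) in simp)
qed

subsection \<open>Binary forms\<close>

text \<open>Homogenization of \<open>a\<close> to degree \<open>d\<close>, with affine chart
  \<open>u = 1\<close>. A degree of \<open>a\<close> below \<open>d\<close> shows up as a zero at
  \<open>(0, 1)\<close>.\<close>

definition hpoly :: "nat \<Rightarrow> complex poly \<Rightarrow> complex \<Rightarrow> complex \<Rightarrow> complex" where
  "hpoly d a u v = (\<Sum>i\<le>d. Polynomial.coeff a i * u ^ (d - i) * v ^ i)"

lemma hpoly_1: "Polynomial.degree a \<le> d \<Longrightarrow> hpoly d a 1 x = poly a x"
  unfolding hpoly_def
  using poly_as_sum_lessThan[of "Suc d" a x] by (simp add: coeff_eq_0 lessThan_Suc_atMost)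

lemma hpoly_scale: "hpoly d a (l * u) (l * v) = l ^ d * hpoly d a u v"
  unfolding hpoly_def sum_distrib_left
proof (rule sum.cong)
  fix i assume "i \<in> {..d}"
  then have "l ^ d = l ^ (d - i) * l ^ i" by (simp flip: power_add)
  then show "Polynomial.coeff a i * (l * u) ^ (d - i) * (l * v) ^ i
      = l ^ d * (Polynomial.coeff a i * u ^ (d - i) * v ^ i)"
    by (simp add: power_mult_distrib)
qed simp

lemma hpoly_homogenize:
  "Polynomial.degree a \<le> d \<Longrightarrow> u \<noteq> 0 \<Longrightarrow> hpoly d a u v = u ^ d * poly a (v / u)"
  using hpoly_scale[of d a u 1 "v / u"] hpoly_1[of a d "v / u"] by simp

lemma hpoly_add: "hpoly d (a + b) u v = hpoly d a u v + hpoly d b u v"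
  unfolding hpoly_def by (simp add: distrib_right sum.distrib)

lemma hpoly_smult: "hpoly d (Polynomial.smult c a) u v = c * hpoly d a u v"
  unfolding hpoly_def sum_distrib_left by (rule sum.cong) (auto simp: mult_ac)

lemma hpoly_0 [simp]: "hpoly d 0 u v = 0"
  unfolding hpoly_def by simp

lemma hpoly_monom: "j \<le> d \<Longrightarrow> hpoly d (Polynomial.monom c j) u v = c * u ^ (d - j) * v ^ j"
  unfolding hpoly_def by (simp add: coeff_monom if_distrib[of "\<lambda>x. x * _"] sum.delta cong: if_cong)

lemma hpoly_root_0: "hpoly d a 0 v = Polynomial.coeff a d * v ^ d"
proof -
  have "hpoly d a 0 v = (\<Sum>i\<le>d. if i = d then Polynomial.coeff a d * v ^ d else 0)"
    unfolding hpoly_def by (rule sum.cong) auto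
  then show ?thesis by simp
qed

lemma hpoly_Suc_coeff_0:
  assumes "Polynomial.coeff a (Suc d) = 0"
  shows "hpoly (Suc d) a u v = u * hpoly d a u v"
proof -
  have "hpoly (Suc d) a u v = (\<Sum>i\<le>d. Polynomial.coeff a i * u ^ (Suc d - i) * v ^ i)"
    unfolding hpoly_def using assms by simp
  also have "\<dots> = u * hpoly d a u v"
    unfolding hpoly_def sum_distrib_left by (rule sum.cong) (auto simp: Suc_diff_le)
  finally show ?thesis .
qed

lemma hpoly_linear_factor:
  assumes "Polynomial.degree a \<le> d"
  shows "hpoly (Suc d) ([:- \<alpha>, 1:] * a) u v = (v - \<alpha> * u) * hpoly d a u v"
proof -
  have 1: "hpoly (Suc d) (pCons 0 a) u v = v * hpoly d a u v"
    unfolding hpoly_def sum.atMost_Suc_shift by (simp add: sum_distrib_left mult_ac)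
  have 2: "hpoly (Suc d) (Polynomial.smult (- \<alpha>) a) u v = - \<alpha> * (u * hpoly d a u v)"
    unfolding hpoly_smult using hpoly_Suc_coeff_0[of a d u v] assms by (simp add: coeff_eq_0)
  have 3: "[:- \<alpha>, 1:] * a = Polynomial.smult (- \<alpha>) a + pCons 0 a" by simp
  show ?thesis unfolding 3 hpoly_add 1 2 by (simp add: algebra_simps)
qed

lemma poly_funs_hpoly:
  assumes "f \<in> poly_funs X" "g \<in> poly_funs X"
  shows "(\<lambda>z. hpoly d a (f z) (g z)) \<in> poly_funs X"
  unfolding hpoly_def using assms by (intro poly_funs_intros)

text \<open>Linear factors are cancelled one by one: \<open>z$1\<close> when the top coefficient is
  0, otherwise \<open>z$2 - \<alpha> * z$1\<close> for a root \<open>\<alpha>\<close>. The zero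
  locus of each has an explicit retraction, and since \<open>f\<close> is nonzero somewhere over
  every zero of the form, no such factor divides \<open>f\<close>.\<close>

lemma cancel_binary_form:
  assumes "f \<in> poly_funs coords" "g \<in> poly_funs coords" "k \<in> poly_funs coords"
    and "a \<noteq> 0" "Polynomial.degree a \<le> d"
    and "\<And>u v. (u, v) \<noteq> (0, 0) \<Longrightarrow> hpoly d a u v = 0 \<Longrightarrow> \<exists>s t. f (vec4 u v s t) \<noteq> 0"
    and "\<And>z. hpoly d a (z$1) (z$2) * g z = f z * k z"
  shows "\<exists>k\<in>poly_funs coords. \<forall>z. g z = f z * k z"
  using assms(2-)
proof (induction d arbitrary: a g k)
  case 0
  then obtain c where c: "a = [:c:]" by (auto elim: degree_eq_zeroE)
  then have "c \<noteq> 0" using "0.prems"(3) by auto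
  have "g z = f z * (inverse c * k z)" for z
    using "0.prems"(6)[of z] c \<open>c \<noteq> 0\<close> by (simp add: hpoly_def field_simps)
  then show ?case using 0 by (intro bexI[of _ "\<lambda>z. inverse c * k z"]) (auto intro: poly_funs_cmult)
next
  case (Suc d)
  show ?case
  proof (cases "Polynomial.coeff a (Suc d) = 0")
    case True
    have deg: "Polynomial.degree a \<le> d"
      using True Suc.prems(3,4) by (metis le_Suc_eq leading_coeff_0_iff)
    obtain s t where st: "f (vec4 0 1 s t) \<noteq> 0"
      using Suc.prems(5)[of 0 1] True by (auto simp: hpoly_root_0)
    have "\<exists>k\<in>poly_funs coords. \<forall>z. hpoly d a (z$1) (z$2) * g z = f z * k z"
    proof (rule poly_funs_cancel[where L = "\<lambda>z. z$1" and v = "\<lambda>z. vec4 0 (z$2) (z$3) (z$4)"])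
      show "z$1 * (hpoly d a (z$1) (z$2) * g z) = f z * k z" for z
        using Suc.prems(6)[of z] unfolding hpoly_Suc_coeff_0[OF True] by (simp only: mult.assoc)
      show "(\<lambda>z. vec4 0 (z$2) (z$3) (z$4) $ i) \<in> poly_funs coords" for i
        using exhaust_4[of i] by (auto intro: poly_funs_intros)
      show "\<exists>k\<in>poly_funs coords. \<forall>z :: cvec4. z $ i - vec4 0 (z$2) (z$3) (z$4) $ i = z$1 * k z" for i
      proof (cases "i = 1")
        case True
        then show ?thesis by (intro bexI[of _ "\<lambda>_. 1"]) (auto intro: poly_funs.const)
      next
        case False
        then show ?thesis using exhaust_4[of i]
          by (intro bexI[of _ "\<lambda>_. 0"]) (auto intro: poly_funs.const)
      qed
      show "f (vec4 0 ((vec4 0 1 s t)$2) ((vec4 0 1 s t)$3) ((vec4 0 1 s t)$4)) \<noteq> 0" using st by simp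
      show "(vec4 1 0 0 0) $ 1 \<noteq> 0" by simp
    qed (use assms(1) Suc.prems in \<open>auto intro!: poly_funs.mult poly_funs_hpoly\<close>)
    then obtain k' where k': "k' \<in> poly_funs coords" "\<And>z. hpoly d a (z$1) (z$2) * g z = f z * k' z" by blast
    show ?thesis
    proof (rule Suc.IH[OF Suc.prems(1) k'(1) Suc.prems(3) deg _ k'(2)])
      show "\<exists>s t. f (vec4 u v s t) \<noteq> 0" if "(u, v) \<noteq> (0, 0)" "hpoly d a u v = 0" for u v
        using Suc.prems(5)[OF that(1)] that(2) hpoly_Suc_coeff_0[OF True] by simp
    qed
  next
    case False
    then have deg: "Polynomial.degree a = Suc d" using Suc.prems(4) le_degree le_antisym by blast
    then obtain \<alpha> where \<alpha>: "poly a \<alpha> = 0"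
      using fundamental_theorem_of_algebra[of a] constant_degree[of a] by auto
    then obtain a' where a': "a = [:- \<alpha>, 1:] * a'" using poly_eq_0_iff_dvd dvdE by metis
    then have "a' \<noteq> 0" using Suc.prems(3) by auto
    then have "Polynomial.degree a = 1 + Polynomial.degree a'" unfolding a' by (subst degree_mult_eq) auto
    then have deg': "Polynomial.degree a' \<le> d" using deg by simp
    note fac = hpoly_linear_factor[OF deg', of \<alpha>, folded a']
    obtain s t where st: "f (vec4 1 \<alpha> s t) \<noteq> 0"
      using Suc.prems(5)[of 1 \<alpha>] fac[of 1 \<alpha>] by auto
    have "\<exists>k\<in>poly_funs coords. \<forall>z. hpoly d a' (z$1) (z$2) * g z = f z * k z"
    proof (rule poly_funs_cancel[where L = "\<lambda>z. z$2 - \<alpha> * z$1" and v = "\<lambda>z. vec4 (z$1) (\<alpha> * z$1) (z$3) (z$4)"])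
      show "(z$2 - \<alpha> * z$1) * (hpoly d a' (z$1) (z$2) * g z) = f z * k z" for z
        using Suc.prems(6)[of z] unfolding fac by (simp only: mult.assoc)
      show "(\<lambda>z. vec4 (z$1) (\<alpha> * z$1) (z$3) (z$4) $ i) \<in> poly_funs coords" for i
        using exhaust_4[of i] by (auto intro!: poly_funs_cmult)
      show "\<exists>k\<in>poly_funs coords. \<forall>z :: cvec4.
          z $ i - vec4 (z$1) (\<alpha> * z$1) (z$3) (z$4) $ i = (z$2 - \<alpha> * z$1) * k z" for i
      proof (cases "i = 2")
        case True
        then show ?thesis by (intro bexI[of _ "\<lambda>_. 1"]) (auto intro: poly_funs.const)
      next
        case False
        then show ?thesis using exhaust_4[of i]
          by (intro bexI[of _ "\<lambda>_. 0"]) (auto intro: poly_funs.const)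
      qed
      show "f (vec4 ((vec4 1 \<alpha> s t)$1) (\<alpha> * (vec4 1 \<alpha> s t)$1) ((vec4 1 \<alpha> s t)$3) ((vec4 1 \<alpha> s t)$4)) \<noteq> 0"
        using st by simp
      show "(vec4 0 1 0 0) $ 2 - \<alpha> * (vec4 0 1 0 0) $ 1 \<noteq> 0" by simp
      show "(\<lambda>z. z$2 - \<alpha> * z$1) \<in> poly_funs coords" by (intro poly_funs_intros)
    qed (use assms(1) Suc.prems in \<open>auto intro!: poly_funs.mult poly_funs_hpoly\<close>)
    then obtain k' where k': "k' \<in> poly_funs coords" "\<And>z. hpoly d a' (z$1) (z$2) * g z = f z * k' z" by blast
    show ?thesis
    proof (rule Suc.IH[OF Suc.prems(1) k'(1) \<open>a' \<noteq> 0\<close> deg' _ k'(2)])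
      show "\<exists>s t. f (vec4 u v s t) \<noteq> 0" if "(u, v) \<noteq> (0, 0)" "hpoly d a' u v = 0" for u v
        using Suc.prems(5)[OF that(1)] that(2) fac by simp
    qed
  qed
qed

lemma cancel_binary_form_power:
  assumes "f \<in> poly_funs coords" "g \<in> poly_funs coords" "k \<in> poly_funs coords"
    and "a \<noteq> 0" "Polynomial.degree a \<le> d"
    and "\<And>u v. (u, v) \<noteq> (0, 0) \<Longrightarrow> hpoly d a u v = 0 \<Longrightarrow> \<exists>s t. f (vec4 u v s t) \<noteq> 0"
    and "\<And>z. hpoly d a (z$1) (z$2) ^ N * g z = f z * k z"
  shows "\<exists>k\<in>poly_funs coords. \<forall>z. g z = f z * k z"
  using assms(3,7)
proof (induction N arbitrary: k)
  case (Suc N)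
  have "\<exists>k\<in>poly_funs coords. \<forall>z. hpoly d a (z$1) (z$2) ^ N * g z = f z * k z"
  proof (rule cancel_binary_form[OF assms(1) _ Suc.prems(1) assms(4-6)])
    show "(\<lambda>z. hpoly d a (z$1) (z$2) ^ N * g z) \<in> poly_funs coords"
      by (intro poly_funs.mult poly_funs_power poly_funs_hpoly poly_funs_coord assms(2))
    show "hpoly d a (z$1) (z$2) * (hpoly d a (z$1) (z$2) ^ N * g z) = f z * k z" for z
      using Suc.prems(2)[of z] by (simp add: mult_ac)
  qed
  then show ?case using Suc.IH by blast
qed auto

text \<open>The torus gives this for \<open>m \<noteq> 0\<close> only. Polynomiality in
  \<open>m\<close> adds \<open>m = 0\<close>, which matters because the factor will be a form or a
  coordinate and may vanish.\<close>

lemma hirz_sections_scale: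
  assumes "g \<in> hirz_sections n a (int N)"
  shows "g (vec4 u v (m * s) (m * t)) = m ^ N * g (vec4 u v s t)"
proof -
  have "\<exists>q. \<forall>m. g (vec4 u v (m * s) (m * t)) = poly q m"
  proof (rule poly_funs_along4[OF hirz_sections_poly_funs[OF assms]])
    show "\<exists>q. \<forall>m. vec4 u v (m * s) (m * t) $ i = poly q m" for i
      using exhaust_4[of i] by (elim disjE)
        (auto intro: exI[of _ "[:u:]"] exI[of _ "[:v:]"] exI[of _ "[:0, s:]"] exI[of _ "[:0, t:]"])
  qed
  then obtain q where q: "\<And>m. g (vec4 u v (m * s) (m * t)) = poly q m" by blast
  have "q = Polynomial.monom (g (vec4 u v s t)) N"
  proof (rule poly_eqI_cofinite[of "{0}"])
    fix m :: complex assume "m \<notin> {0}"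
    moreover have "torus_act n 1 m (vec4 u v s t) = vec4 u v (m * s) (m * t)" by (simp add: vec4_eq_iff)
    ultimately have "g (vec4 u v (m * s) (m * t)) = m ^ N * g (vec4 u v s t)"
      using hirz_sections_torus_act[OF assms, of 1 m "vec4 u v s t"] by simp
    then show "poly q m = poly (Polynomial.monom (g (vec4 u v s t)) N) m" using q by (simp add: poly_monom)
  qed simp
  then show ?thesis using q by (simp add: poly_monom)
qed

subsection \<open>Sections of the ruling\<close>

definition section_fun :: "nat \<Rightarrow> nat \<Rightarrow> complex poly \<Rightarrow> complex poly \<Rightarrow> cvec4 \<Rightarrow> complex" where
  "section_fun e n a b z = hpoly e a (z$1) (z$2) * z$4 + hpoly (e + n) b (z$1) (z$2) * z$3"

lemma section_fun_affine:
  "Polynomial.degree a \<le> e \<Longrightarrow> Polynomial.degree b \<le> e + n \<Longrightarrow>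
    section_fun e n a b (vec4 1 x 1 y) = poly a x * y + poly b x"
  unfolding section_fun_def by (simp add: hpoly_1)

lemma section_fun_hirz_sections: "section_fun e n a b \<in> hirz_sections n (int e) 1"
proof (rule hirz_sectionsI)
  show "section_fun e n a b \<in> poly_funs coords"
    unfolding section_fun_def by (intro poly_funs.add poly_funs.mult poly_funs_hpoly poly_funs_coord)
  show "section_fun e n a b (torus_act n l m z) = l powi int e * m powi 1 * section_fun e n a b z"
    if "l \<noteq> 0" "m \<noteq> 0" for l m z
    unfolding section_fun_def torus_act_nth hpoly_scale using that by (simp add: power_add field_simps)
qed

text \<open>Degree 1 in \<open>H\<close> means exactly one factor \<open>z$3\<close> or
  \<open>z$4\<close>; as \<open>z$3\<close> has weight \<open>-n\<close> in \<open>F\<close>, its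
  cofactor has degree \<open>e + n\<close>.\<close>

lemma hirz_sections_section_fun:
  assumes "g \<in> hirz_sections n (int e) 1"
  shows "\<exists>a b. Polynomial.degree a \<le> e \<and> Polynomial.degree b \<le> e + n \<and> g = section_fun e n a b"
proof (rule hirz_sections_span[OF assms])
  show "\<exists>a b. Polynomial.degree a \<le> e \<and> Polynomial.degree b \<le> e + n \<and> (\<lambda>_. 0) = section_fun e n a b"
    by (intro exI[of _ 0]) (auto simp: section_fun_def)
next
  fix g h
  assume "\<exists>a b. Polynomial.degree a \<le> e \<and> Polynomial.degree b \<le> e + n \<and> g = section_fun e n a b"
    "\<exists>a b. Polynomial.degree a \<le> e \<and> Polynomial.degree b \<le> e + n \<and> h = section_fun e n a b"
  then obtain a b c d where *: "Polynomial.degree a \<le> e" "Polynomial.degree b \<le> e + n"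
    "Polynomial.degree c \<le> e" "Polynomial.degree d \<le> e + n"
    "g = section_fun e n a b" "h = section_fun e n c d" by blast
  have "(\<lambda>z. g z + h z) = section_fun e n (a + c) (b + d)"
    unfolding *(5,6) section_fun_def hpoly_add by (simp add: algebra_simps)
  then show "\<exists>a b. Polynomial.degree a \<le> e \<and> Polynomial.degree b \<le> e + n \<and> (\<lambda>z. g z + h z) = section_fun e n a b"
    using *(1-4) degree_add_le by blast
next
  fix t assume t: "mon_F n t = int e" "mon_H t = 1"
  obtain c i j k l where fields: "t = (c, i, j, k, l)" by (cases t)
  then have "k + l = 1" "i + j = e + n * k"
    using t by (simp_all add: algebra_simps flip: of_nat_add of_nat_mult)
  then consider "k = 0" "l = 1" "i + j = e" | "k = 1" "l = 0" "i + j = e + n" by (cases k) auto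
  then show "\<exists>a b. Polynomial.degree a \<le> e \<and> Polynomial.degree b \<le> e + n \<and> (\<lambda>z. mon_eval z t) = section_fun e n a b"
  proof cases
    case 1
    then have "i = e - j" "j \<le> e" by auto
    then have "(\<lambda>z. mon_eval z t) = section_fun e n (Polynomial.monom c j) 0"
      using 1 fields by (auto simp: section_fun_def hpoly_monom)
    moreover have "Polynomial.degree (Polynomial.monom c j) \<le> e" using \<open>j \<le> e\<close> degree_monom_le le_trans by blast
    ultimately show ?thesis by (intro exI[of _ "Polynomial.monom c j"] exI[of _ 0]) simp
  next
    case 2
    then have "i = e + n - j" "j \<le> e + n" by auto
    then have "(\<lambda>z. mon_eval z t) = section_fun e n 0 (Polynomial.monom c j)"
      using 2 fields by (auto simp: section_fun_def hpoly_monom)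
    moreover have "Polynomial.degree (Polynomial.monom c j) \<le> e + n" using \<open>j \<le> e + n\<close> degree_monom_le le_trans by blast
    ultimately show ?thesis by (intro exI[of _ 0] exI[of _ "Polynomial.monom c j"]) simp
  qed
qed

text \<open>With \<open>A\<close>, \<open>B\<close> the forms of \<open>a\<close>, \<open>b\<close>
  and \<open>N\<close> the degree in \<open>H\<close>, \<open>A ^ N * g\<close> is \<open>g\<close>
  with last coordinates \<open>(A z$3, A z$4)\<close>. Modulo \<open>A z$4 + B z$3\<close> this is
  \<open>g\<close> at \<open>(A z$3, - B z$3)\<close>, which is \<open>z$3 ^ N\<close> times
  \<open>g\<close> at \<open>(A, - B)\<close>, hence 0. As \<open>A\<close> and \<open>B\<close>
  have no common zero, \<open>A ^ N\<close> can be cancelled.\<close>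

lemma section_fun_dvd:
  assumes g: "g \<in> hirz_sections n a' b'"
    and a: "Polynomial.degree a \<le> e" "a \<noteq> 0" and b: "Polynomial.degree b \<le> e + n"
    and cop: "\<And>u v. (u, v) \<noteq> (0, 0) \<Longrightarrow> hpoly e a u v = 0 \<Longrightarrow> hpoly (e + n) b u v \<noteq> 0"
    and van: "\<And>t. g (vec4 1 t (poly a t) (- poly b t)) = 0"
  shows "\<exists>h\<in>poly_funs coords. \<forall>z. g z = section_fun e n a b z * h z"
proof (cases "b' < 0")
  case True
  then have "g = (\<lambda>_. 0)" using hirz_sections_neg_H[OF g] by simp
  then show ?thesis by (intro bexI[of _ "\<lambda>_. 0"]) (auto intro: poly_funs.const)
next
  case False
  define N where "N = nat b'"
  then have gN: "g \<in> hirz_sections n a' (int N)" using g False by simp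
  have gp: "g \<in> poly_funs coords" using g by (rule hirz_sections_poly_funs)
  let ?A = "\<lambda>z :: cvec4. hpoly e a (z$1) (z$2)" and ?B = "\<lambda>z :: cvec4. hpoly (e + n) b (z$1) (z$2)"
  have AB: "?A \<in> poly_funs coords" "?B \<in> poly_funs coords" by (intro poly_funs_hpoly poly_funs_coord)+
  \<comment> \<open>For \<open>z$1 \<noteq> 0\<close> the point is a torus translate of a point of
    the parametrization; the rest follows by density.\<close>
  have vanish: "g (vec4 (z$1) (z$2) (?A z) (- ?B z)) = 0" for z
  proof (rule poly_funs_domain[of "\<lambda>z. z$1" "\<lambda>z. g (vec4 (z$1) (z$2) (?A z) (- ?B z))" "vec4 1 0 0 0"])
    show "(\<lambda>z. g (vec4 (z$1) (z$2) (?A z) (- ?B z))) \<in> poly_funs coords"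
      by (intro poly_funs_comp_vec4 gp AB poly_funs_coord poly_funs_uminus)
    fix z :: cvec4 assume z1: "z$1 \<noteq> 0"
    have "vec4 (z$1) (z$2) (?A z) (- ?B z) = torus_act n (z$1) (z$1 ^ (e + n))
        (vec4 1 (z$2 / z$1) (poly a (z$2 / z$1)) (- poly b (z$2 / z$1)))"
      using z1 a(1) b by (simp add: vec4_eq_iff hpoly_homogenize power_add)
    then show "g (vec4 (z$1) (z$2) (?A z) (- ?B z)) = 0"
      using hirz_sections_torus_act[OF g] van z1 by simp
  qed auto
  have "\<exists>k\<in>poly_funs coords. \<forall>z. g (vec4 (z$1) (z$2) (?A z * z$3) (?A z * z$4))
      - g (vec4 (z$1) (z$2) (?A z * z$3) (- ?B z * z$3)) = section_fun e n a b z * k z"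
  proof (rule poly_funs_subst_dvd[OF gp])
    show "(\<lambda>z. vec4 (z$1) (z$2) (?A z * z$3) (?A z * z$4) $ i) \<in> poly_funs coords" for i
      using exhaust_4[of i] AB by (auto intro!: poly_funs.mult poly_funs_uminus)
    show "(\<lambda>z. vec4 (z$1) (z$2) (?A z * z$3) (- ?B z * z$3) $ i) \<in> poly_funs coords" for i
      using exhaust_4[of i] AB by (auto intro!: poly_funs.mult poly_funs_uminus)
    show "\<exists>k\<in>poly_funs coords. \<forall>z :: cvec4. vec4 (z$1) (z$2) (?A z * z$3) (?A z * z$4) $ i
      - vec4 (z$1) (z$2) (?A z * z$3) (- ?B z * z$3) $ i = section_fun e n a b z * k z" for i
    proof (cases "i = 4")
      case True
      then show ?thesis by (intro bexI[of _ "\<lambda>_. 1"]) (auto intro: poly_funs.const simp: section_fun_def)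
    next
      case False
      then show ?thesis using exhaust_4[of i]
        by (intro bexI[of _ "\<lambda>_. 0"]) (auto intro: poly_funs.const)
    qed
  qed
  then obtain k where k: "k \<in> poly_funs coords" "\<And>z. g (vec4 (z$1) (z$2) (?A z * z$3) (?A z * z$4))
      - g (vec4 (z$1) (z$2) (?A z * z$3) (- ?B z * z$3)) = section_fun e n a b z * k z" by blast
  have eq: "?A z ^ N * g z = section_fun e n a b z * k z" for z
  proof -
    have "g (vec4 (z$1) (z$2) (?A z * z$3) (- ?B z * z$3)) = 0"
      using hirz_sections_scale[OF gN, of "z$1" "z$2" "z$3" "?A z" "- ?B z"] vanish[of z]
      by (simp add: mult.commute)
    then show ?thesis
      using k(2)[of z] hirz_sections_scale[OF gN, of "z$1" "z$2" "?A z" "z$3" "z$4"] by (simp add: vec4_eta)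
  qed
  show ?thesis
  proof (rule cancel_binary_form_power[OF _ gp k(1) a(2,1) _ eq])
    show "section_fun e n a b \<in> poly_funs coords"
      using section_fun_hirz_sections by (rule hirz_sections_poly_funs)
    show "\<exists>s t. section_fun e n a b (vec4 u v s t) \<noteq> 0" if "(u, v) \<noteq> (0, 0)" "hpoly e a u v = 0" for u v
      using cop[OF that] by (intro exI[of _ 1] exI[of _ 0]) (simp add: section_fun_def)
  qed
qed

subsection \<open>Fibres and sections\<close>

definition skip :: "nat \<Rightarrow> nat \<Rightarrow> nat" where
  "skip j k = (if k < j then k else Suc k)"

lemma inj_skip: "inj_on (skip j) A"
  by (auto simp: inj_on_def skip_def split: if_splits)

lemma skip_less: "k < N \<Longrightarrow> skip j k < Suc N"
  by (auto simp: skip_def)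

lemma skip_neq: "skip j k \<noteq> j"
  by (auto simp: skip_def)

text \<open>A common zero is a common linear factor. Removing it leaves a nonzero pair of degrees at
  most \<open>e - 1\<close> and \<open>e + n - 1\<close> that still vanishes at all centres but at
  most one, against \<open>gen\<close>.\<close>

lemma interpolating_pair_coprime:
  fixes a b :: "complex poly"
  assumes r: "r = 2 * e + n + 1" and z: "\<And>k. k < r \<Longrightarrow> z k = vec4 1 (x k) 1 (y k)"
    and inj: "inj_on x {..<r}" and gen: "\<And>j. j < r \<Longrightarrow> interp_cond e n (skip j) z"
    and a: "Polynomial.degree a \<le> e" and b: "Polynomial.degree b \<le> e + n" and nz: "\<not> (a = 0 \<and> b = 0)"
    and van: "\<And>k. k < r \<Longrightarrow> poly a (x k) * y k + poly b (x k) = 0"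
    and uv: "(u, v) \<noteq> (0, 0)" "hpoly e a u v = 0"
  shows "hpoly (e + n) b u v \<noteq> 0"
proof
  assume B: "hpoly (e + n) b u v = 0"
  have reduce: False if c: "\<And>i. i \<ge> e \<Longrightarrow> Polynomial.coeff c i = 0"
    and d: "\<And>i. i \<ge> e + n \<Longrightarrow> Polynomial.coeff d i = 0" and cd: "\<not> (c = 0 \<and> d = 0)" and j: "j < r"
    and van: "\<And>k. k < r \<Longrightarrow> k \<noteq> j \<Longrightarrow> poly c (x k) * y k + poly d (x k) = 0" for c d j
  proof -
    have less: "skip j k < r" if "k < 2 * e + n" for k using skip_less[OF that, of j] r by simp
    have "c = 0 \<and> d = 0"
    proof (rule interp_condD[OF gen[OF j]])
      show "z (skip j k) = vec4 1 (x (skip j k)) 1 (y (skip j k))" if "k < 2 * e + n" for k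
        by (rule z[OF less[OF that]])
      show "poly c (x (skip j k)) * y (skip j k) + poly d (x (skip j k)) = 0" if "k < 2 * e + n" for k
        by (rule van[OF less[OF that] skip_neq])
    qed (use c d in auto)
    then show False using cd by simp
  qed
  show False
  proof (cases "u = 0")
    \<comment> \<open>A common zero at infinity is a drop of both degrees. No centre lies over it,
      so any one of them may be left out.\<close>
    case True
    then have top: "Polynomial.coeff a e = 0" "Polynomial.coeff b (e + n) = 0"
      using uv B by (simp_all add: hpoly_root_0)
    show False
    proof (rule reduce[of a b 0])
      show "Polynomial.coeff a i = 0" if "i \<ge> e" for i
        using that top a by (cases "i = e") (auto intro: coeff_eq_0)
      show "Polynomial.coeff b i = 0" if "i \<ge> e + n" for i
        using that top b by (cases "i = e + n") (auto intro: coeff_eq_0)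
    qed (use r nz van in auto)
  next
    case False
    define \<alpha> where "\<alpha> = v / u"
    have "poly a \<alpha> = 0" "poly b \<alpha> = 0"
      using uv B False a b by (simp_all add: hpoly_homogenize \<alpha>_def)
    then obtain c d where cd: "a = [:- \<alpha>, 1:] * c" "b = [:- \<alpha>, 1:] * d"
      by (metis poly_eq_0_iff_dvd dvdE)
    have degree_less: "Polynomial.coeff p i = 0"
      if "i \<ge> m" "Polynomial.degree ([:- \<alpha>, 1:] * p) \<le> m" for p i m
    proof (cases "p = 0")
      case False
      then have "Polynomial.degree ([:- \<alpha>, 1:] * p) = 1 + Polynomial.degree p" by (subst degree_mult_eq) auto
      then show ?thesis using that by (intro coeff_eq_0) simp
    qed simp
    \<comment> \<open>The abscissae are distinct, so at most one centre lies over the root; if none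
      does, \<open>j\<close> is arbitrary.\<close>
    obtain j where j: "j < r" "\<And>k. k < r \<Longrightarrow> k \<noteq> j \<Longrightarrow> x k \<noteq> \<alpha>"
    proof (cases "\<exists>j<r. x j = \<alpha>")
      case True
      then obtain j where "j < r" "x j = \<alpha>" by blast
      then show ?thesis using inj by (intro that[of j]) (auto simp: inj_on_def)
    next
      case False
      then show ?thesis using r by (intro that[of 0]) auto
    qed
    show False
    proof (rule reduce[of c d j])
      show "Polynomial.coeff c i = 0" if "i \<ge> e" for i using degree_less[OF that] a cd(1) by simp
      show "Polynomial.coeff d i = 0" if "i \<ge> e + n" for i using degree_less[OF that] b cd(2) by simp
      fix k assume k: "k < r" "k \<noteq> j"
      have "(x k - \<alpha>) * (poly c (x k) * y k + poly d (x k)) = 0"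
        using van[OF k(1)] unfolding cd by (simp add: algebra_simps)
      then show "poly c (x k) * y k + poly d (x k) = 0" using j(2)[OF k] by simp
    qed (use nz cd j in auto)
  qed
qed

lemma coeff_sum_monom:
  "Polynomial.coeff (\<Sum>i<d. Polynomial.monom (c i) i) j = (if j < d then c j else 0 :: complex)"
proof -
  have "Polynomial.coeff (\<Sum>i<d. Polynomial.monom (c i) i) j = (\<Sum>i<d. if i = j then c j else 0)"
    unfolding coeff_sum by (rule sum.cong) auto
  then show ?thesis by (simp add: sum.delta)
qed

lemma section_blowup_curve:
  assumes r: "r = 2 * e + n + 1" and z: "\<And>k. k < r \<Longrightarrow> z k = vec4 1 (x k) 1 (y k)"
    and inj: "inj_on x {..<r}" and gen: "\<And>j. j < r \<Longrightarrow> interp_cond e n (skip j) z"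
    and p: "\<And>k. k < r \<Longrightarrow> p k = Defs.orbit n (z k)"
  shows "\<exists>f \<phi>. blowup_curve n r z p e 1 f \<phi>"
proof -
  \<comment> \<open>\<open>interp_fun (e + 1) n\<close> lists the monomials of class
    \<open>e F + H\<close>, with forms of degree \<open>e\<close> and \<open>e + n\<close>. They are
    one more than the centres, so a nonzero solution exists.\<close>
  have N: "Suc r = 2 * (e + 1) + n" using r by simp
  obtain v i0 where v: "\<And>k. k < r \<Longrightarrow> (\<Sum>i<Suc r. v i * interp_fun (e + 1) n i (z k)) = 0"
    "i0 < Suc r" "v i0 \<noteq> 0"
    using underdetermined_system[of r "\<lambda>k i. interp_fun (e + 1) n i (z k)"] by blast
  define a where "a = (\<Sum>i<e + 1. Polynomial.monom (v i) i)"
  define b where "b = (\<Sum>i<e + 1 + n. Polynomial.monom (v (e + 1 + i)) i)"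
  have a: "Polynomial.degree a \<le> e" unfolding a_def
    by (rule degree_sum_le) (auto intro: le_trans[OF degree_monom_le])
  have b: "Polynomial.degree b \<le> e + n" unfolding b_def
    by (rule degree_sum_le) (auto intro: le_trans[OF degree_monom_le])
  have van: "poly a (x k) * y k + poly b (x k) = 0" if k: "k < r" for k
    using v(1)[OF k] unfolding z[OF k] N sum_interp_fun a_def b_def by (simp add: poly_sum poly_monom)
  have nz: "\<not> (a = 0 \<and> b = 0)"
  proof
    assume "a = 0 \<and> b = 0"
    then have "Polynomial.coeff a i0 = 0" "Polynomial.coeff b (i0 - (e + 1)) = 0" by simp_all
    moreover have "i0 - (e + 1) < e + 1 + n" "i0 < e + 1 \<or> e + 1 + (i0 - (e + 1)) = i0"
      using v(2) N by auto
    ultimately show False using v(3) unfolding a_def b_def coeff_sum_monom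
      by (cases "i0 < e + 1") simp_all
  qed
  note cop = interpolating_pair_coprime[OF r z inj gen a b nz van]
  \<comment> \<open>By \<open>van\<close>, a zero of \<open>a\<close> at a centre would be one of
    \<open>b\<close> as well. So \<open>f\<close> has nonzero derivative in the direction of
    \<open>z$4\<close> at each centre.\<close>
  have ax: "poly a (x k) \<noteq> 0" if k: "k < r" for k
    using cop[of 1 "x k"] van[OF k] a b by (auto simp: hpoly_1)
  have "a \<noteq> 0" using ax[of 0] r by auto
  define f where "f = section_fun e n a b"
  define \<phi> where "\<phi> = (\<lambda>t. vec4 1 t (poly a t) (- poly b t))"
  have f_phi: "f (\<phi> t) = 0" for t
    unfolding f_def \<phi>_def section_fun_def using a b by (simp add: hpoly_1)
  have f_dvd: "\<exists>h\<in>poly_funs coords. \<forall>x. g x = f x * h x"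
    if "g \<in> hirz_sections n a' b'" "\<And>t. g (\<phi> t) = 0" for g a' b'
    unfolding f_def by (rule section_fun_dvd[OF that(1) a \<open>a \<noteq> 0\<close> b cop]) (use that(2) in \<open>simp_all add: \<phi>_def\<close>)
  have "blowup_curve n r z p e 1 f \<phi>"
  proof
    show "z k \<in> cox_points" if "k < r" for k using z[OF that] by (simp add: cox_points_def)
    show "p k = Defs.orbit n (z k)" if "k < r" for k using p[OF that] .
    show "f \<in> hirz_sections n (int e) (int 1)" unfolding f_def using section_fun_hirz_sections by simp
    have "f (vec4 1 (x 0) 0 1) \<noteq> 0" using ax[of 0] r a by (simp add: f_def section_fun_def hpoly_1)
    then show "\<exists>x. f x \<noteq> 0" by blast
    show "\<exists>q. \<forall>t. \<phi> t $ i = poly q t" for i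
      using exhaust_4[of i] unfolding \<phi>_def
      by (elim disjE) (auto intro: exI[of _ "[:1:]"] exI[of _ "[:0, 1:]"] exI[of _ a] exI[of _ "- b"])
    show "\<phi> t \<in> cox_points" for t
      using cop[of 1 t] a b by (auto simp: cox_points_def \<phi>_def hpoly_1)
    show "inj (\<lambda>t. Defs.orbit n (\<phi> t))"
    proof (rule injI)
      fix t t' assume "Defs.orbit n (\<phi> t) = Defs.orbit n (\<phi> t')"
      then obtain l m where "\<phi> t' = torus_act n l m (\<phi> t)" by (rule orbit_eqE)
      then show "t = t'" by (simp add: vec4_eq_iff \<phi>_def)
    qed
    show "f (\<phi> t) = 0" for t by (rule f_phi)
    show "\<exists>h\<in>poly_funs coords. \<forall>x. g x = f x * h x"
      if "g \<in> hirz_sections n a' b'" "\<And>t. g (\<phi> t) = 0" for g a' b' using that by (rule f_dvd)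
    show fz: "f (z k) = 0" if k: "k < r" for k
      using van[OF k] a b by (simp add: f_def z[OF k] section_fun_affine)
    show "\<exists>w. \<not> vanishes_along f (z k) w 2" if k: "k < r" for k
    proof
      have "f (z k + c *s vec4 0 0 0 1) = poly [:0, poly a (x k):] c" for c
        using van[OF k] a b by (simp add: z[OF k] f_def section_fun_def hpoly_1 algebra_simps)
      from vanishes_along_iff_coeff[OF this] show "\<not> vanishes_along f (z k) (vec4 0 0 0 1) 2"
        using ax[OF k] by (auto intro!: exI[of _ 1])
    qed
    show "\<exists>c. g = (\<lambda>x. c * f x)"
      if g: "g \<in> hirz_sections n (int e) (int 1)" and gz: "\<And>k. k < r \<Longrightarrow> g (z k) = 0" for g
    proof -
      obtain a2 b2 where ab2: "Polynomial.degree a2 \<le> e" "Polynomial.degree b2 \<le> e + n" "g = section_fun e n a2 b2"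
        using hirz_sections_section_fun[of g n e] g by auto
      \<comment> \<open>The two curves share \<open>r\<close> points with distinct abscissae, one
        more than the degree \<open>2 * e + n\<close> of this expression allows.\<close>
      have "a2 * b - a * b2 = 0"
      proof (rule poly_zero_by_roots[of "x ` {..<r}"])
        fix t assume "t \<in> x ` {..<r}"
        then obtain k where k: "k < r" "t = x k" by auto
        have "poly a2 t * y k + poly b2 t = 0"
          using gz[OF k(1)] ab2 by (simp add: z[OF k(1)] section_fun_affine k(2))
        then have b2t: "poly b2 t = - (poly a2 t * y k)" by (simp add: eq_neg_iff_add_eq_0 add.commute)
        have bt: "poly b t = - (poly a t * y k)"
          using van[OF k(1)] k(2) by (simp add: eq_neg_iff_add_eq_0 add.commute)
        show "poly (a2 * b - a * b2) t = 0" by (simp add: b2t bt)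
      next
        fix i assume i: "card (x ` {..<r}) \<le> i"
        have "Polynomial.degree (a2 * b) \<le> e + (e + n)" "Polynomial.degree (a * b2) \<le> e + (e + n)"
          using a b ab2 by (auto intro!: le_trans[OF degree_mult_le] add_mono)
        moreover have "e + (e + n) < i" using i unfolding card_image[OF inj] using r by simp
        ultimately show "Polynomial.coeff (a2 * b - a * b2) i = 0" by (simp add: coeff_eq_0)
      qed simp
      then have eq: "poly a2 t * poly b t = poly a t * poly b2 t" for t
        by (metis eq_iff_diff_eq_0 poly_mult)
      have "g (\<phi> t) = 0" for t
        using eq[of t] ab2 by (simp add: \<phi>_def section_fun_def hpoly_1 mult.commute)
      then obtain h where h: "h \<in> poly_funs coords" "\<And>x. g x = f x * h x" using f_dvd[OF g] by blast
      \<comment> \<open>The quotient has trivial class and is therefore constant.\<close>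
      have "h \<in> hirz_sections n (int e - int e) (int 1 - int 1)"
      proof (rule hirz_sections_quotient[OF _ _ h(1)])
        show "f \<in> hirz_sections n (int e) (int 1)" unfolding f_def using section_fun_hirz_sections by simp
        show "(\<lambda>z. f z * h z) \<in> hirz_sections n (int e) (int 1)" using g h(2) by (simp flip: h(2))
        show "f (vec4 1 (x 0) 0 1) \<noteq> 0" using ax[of 0] r a by (simp add: f_def section_fun_def hpoly_1)
      qed
      then obtain c where "h = (\<lambda>_. c)" using hirz_sections_00_const by auto
      then show ?thesis using h(2) by (intro exI[of _ c]) (auto simp: mult.commute)
    qed
  qed
  then show ?thesis by blast
qed

lemma swap_blowup_curve:
  assumes "blowup_curve 0 r z p a b f \<phi>"
    and p': "\<And>k. k < r \<Longrightarrow> p' k = Defs.orbit 0 (swap (z k))"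
  shows "blowup_curve 0 r (\<lambda>k. swap (z k)) p' b a (\<lambda>z. f (swap z)) (\<lambda>t. swap (\<phi> t))"
proof -
  interpret blowup_curve 0 r z p a b f \<phi> by fact
  show ?thesis
  proof
    show "swap (z k) \<in> cox_points" if "k < r" for k using z_cox[OF that] by (simp add: swap_cox)
    show "p' k = Defs.orbit 0 (swap (z k))" if "k < r" for k using p'[OF that] .
    show "(\<lambda>z. f (swap z)) \<in> hirz_sections 0 (int b) (int a)" using f_hirz by (rule hirz_sections_swap)
    show "\<exists>x. f (swap x) \<noteq> 0" using f_nonzero swap_swap by metis
    show "\<exists>q. \<forall>t. swap (\<phi> t) $ i = poly q t" for i
      using exhaust_4[of i] phi_poly by auto
    show "swap (\<phi> t) \<in> cox_points" for t using phi_cox by (simp add: swap_cox)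
    show "inj (\<lambda>t. Defs.orbit 0 (swap (\<phi> t)))"
      using phi_inj unfolding inj_def orbit_swap_eq .
    show "f (swap (swap (\<phi> t))) = 0" for t using f_phi by simp
    show "\<exists>h\<in>poly_funs coords. \<forall>x. g x = f (swap x) * h x"
      if g: "g \<in> hirz_sections 0 a' b'" and gz: "\<And>t. g (swap (\<phi> t)) = 0" for g a' b'
    proof -
      obtain h where "h \<in> poly_funs coords" "\<And>x. g (swap x) = f x * h x"
        using f_dvd[OF hirz_sections_swap[OF g] gz] by blast
      then show ?thesis
        by (intro bexI[of _ "\<lambda>x. h (swap x)"]) (auto simp: poly_funs_swap simp flip: \<open>\<And>x. g (swap x) = f x * h x\<close>)
    qed
    show "f (swap (swap (z k))) = 0" if "k < r" for k using f_centre[OF that] by simp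
    show "\<exists>w. \<not> vanishes_along (\<lambda>z. f (swap z)) (swap (z k)) w 2" if k: "k < r" for k
    proof -
      obtain w where "\<not> vanishes_along f (z k) w 2" using f_simple[OF k] by blast
      then have "\<not> vanishes_along (\<lambda>z. f (swap z)) (swap (z k)) (swap w) 2"
        unfolding vanishes_along_def swap_linear swap_swap .
      then show ?thesis by blast
    qed
    show "\<exists>c. g = (\<lambda>x. c * f (swap x))"
      if g: "g \<in> hirz_sections 0 (int b) (int a)" and gz: "\<And>k. k < r \<Longrightarrow> g (swap (z k)) = 0" for g
    proof -
      obtain c where "(\<lambda>z. g (swap z)) = (\<lambda>x. c * f x)"
        using f_unique[OF hirz_sections_swap[OF g] gz] by blast
      then have "g (swap (swap x)) = c * f (swap x)" for x by metis
      then show ?thesis by auto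
    qed
  qed
qed

section \<open>The fibre through a centre\<close>

lemma hirz_sections_fiber_class:
  assumes "g \<in> hirz_sections n 1 0"
  shows "\<exists>c d. g = (\<lambda>z. c * z$1 + d * z$2)"
proof (rule hirz_sections_span[OF assms])
  show "\<exists>c d. (\<lambda>_. 0) = (\<lambda>z :: cvec4. c * z$1 + d * z$2)" by (intro exI[of _ 0]) simp
next
  fix g h assume "\<exists>c d. g = (\<lambda>z :: cvec4. c * z$1 + d * z$2)" "\<exists>c d. h = (\<lambda>z :: cvec4. c * z$1 + d * z$2)"
  then obtain c d c' d' where "g = (\<lambda>z :: cvec4. c * z$1 + d * z$2)" "h = (\<lambda>z :: cvec4. c' * z$1 + d' * z$2)" by blast
  then show "\<exists>c d. (\<lambda>z. g z + h z) = (\<lambda>z :: cvec4. c * z$1 + d * z$2)"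
    by (intro exI[of _ "c + c'"] exI[of _ "d + d'"]) (auto simp: algebra_simps)
next
  fix t assume t: "mon_F n t = 1" "mon_H t = 0"
  obtain c i j k l where fields: "t = (c, i, j, k, l)" by (cases t)
  then have "k = 0" "l = 0" using t by auto
  moreover from this have "i + j = 1" using t fields by (simp flip: of_nat_add)
  ultimately consider "i = 1" "j = 0" "k = 0" "l = 0" | "i = 0" "j = 1" "k = 0" "l = 0" by (cases i) auto
  then show "\<exists>c d. (\<lambda>z. mon_eval z t) = (\<lambda>z. c * z$1 + d * z$2)"
  proof cases
    case 1 then show ?thesis by (intro exI[of _ c] exI[of _ 0]) (simp add: fields)
  next
    case 2 then show ?thesis by (intro exI[of _ 0] exI[of _ c]) (simp add: fields)
  qed
qed

text \<open>The parametrization omits the point of the fibre on the negative curve. Vanishing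
  spreads from \<open>z$1 * z$3 \<noteq> 0\<close> by density, and division by the equation is the
  substitution of \<open>x * z$1\<close> for \<open>z$2\<close>.\<close>

lemma fiber_blowup_curve:
  assumes z: "z 0 = vec4 1 x 1 y" and p: "p 0 = Defs.orbit n (z 0)"
  shows "blowup_curve n 1 z p 1 0 (\<lambda>z. z$2 - x * z$1) (\<lambda>t. vec4 1 x 1 t)"
proof
  let ?f = "\<lambda>z :: cvec4. z$2 - x * z$1"
  show "z k \<in> cox_points" if "k < 1" for k using that by (simp add: z cox_points_def)
  show "p k = Defs.orbit n (z k)" if "k < 1" for k using that p by simp
  show "?f \<in> hirz_sections n (int 1) (int 0)"
    by (rule hirz_sectionsI) (auto simp: algebra_simps intro!: poly_funs_diff poly_funs_cmult)
  show "\<exists>z. ?f z \<noteq> 0" by (rule exI[of _ "vec4 0 1 0 0"]) simp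
  show "\<exists>q. \<forall>t. vec4 1 x 1 t $ i = poly q t" for i
    using exhaust_4[of i]
    by (elim disjE) (auto intro: exI[of _ "[:1:]"] exI[of _ "[:x:]"] exI[of _ "[:0, 1:]"])
  show "vec4 1 x 1 t \<in> cox_points" for t by (simp add: cox_points_def)
  show "inj (\<lambda>t. Defs.orbit n (vec4 1 x 1 t))"
  proof (rule injI)
    fix t t' assume "Defs.orbit n (vec4 1 x 1 t) = Defs.orbit n (vec4 1 x 1 t')"
    then obtain l m where "vec4 1 x 1 t' = torus_act n l m (vec4 1 x 1 t)" by (rule orbit_eqE)
    then show "t = t'" by (auto simp: vec4_eq_iff)
  qed
  show "?f (vec4 1 x 1 t) = 0" for t by simp
  show "\<exists>h\<in>poly_funs coords. \<forall>z. g z = ?f z * h z"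
    if g: "g \<in> hirz_sections n a' b'" and van: "\<And>t. g (vec4 1 x 1 t) = 0" for g a' b'
  proof -
    have gp: "g \<in> poly_funs coords" using g by (rule hirz_sections_poly_funs)
    have v: "(\<lambda>z. vec4 (z$1) (x * z$1) (z$3) (z$4) $ i) \<in> poly_funs coords" for i
      using exhaust_4[of i] by (auto intro!: poly_funs_cmult)
    have "g (vec4 (z$1) (x * z$1) (z$3) (z$4)) = 0" for z :: cvec4
    proof (rule poly_funs_domain[of "\<lambda>z. z$1 * z$3" "\<lambda>z. g (vec4 (z$1) (x * z$1) (z$3) (z$4))" "vec4 1 1 1 1"])
      show "(\<lambda>z. g (vec4 (z$1) (x * z$1) (z$3) (z$4))) \<in> poly_funs coords"
        using gp v by (rule poly_funs_compose4)
      fix z :: cvec4 assume nz: "z$1 * z$3 \<noteq> 0"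
      have "vec4 (z$1) (x * z$1) (z$3) (z$4)
          = torus_act n (z$1) (z$3 * z$1 ^ n) (vec4 1 x 1 (z$4 / (z$3 * z$1 ^ n)))"
        using nz by (simp add: vec4_eq_iff)
      then show "g (vec4 (z$1) (x * z$1) (z$3) (z$4)) = 0"
        using hirz_sections_torus_act[OF g] van nz by simp
    qed (auto intro: poly_funs.mult)
    moreover have "\<exists>h\<in>poly_funs coords. \<forall>z. g z - g (vec4 (z$1) (x * z$1) (z$3) (z$4)) = ?f z * h z"
    proof (rule poly_funs_subst_dvd[OF gp _ v])
      show "\<exists>k\<in>poly_funs coords. \<forall>z :: cvec4. z $ i - vec4 (z$1) (x * z$1) (z$3) (z$4) $ i = ?f z * k z" for i
      proof (cases "i = 2")
        case True
        then show ?thesis by (intro bexI[of _ "\<lambda>_. 1"]) (auto intro: poly_funs.const)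
      next
        case False
        then show ?thesis using exhaust_4[of i] by (intro bexI[of _ "\<lambda>_. 0"]) (auto intro: poly_funs.const)
      qed
    qed auto
    ultimately show ?thesis by simp
  qed
  show "?f (z k) = 0" if "k < 1" for k using that z by simp
  show "\<exists>w. \<not> vanishes_along ?f (z k) w 2" if "k < 1" for k
  proof
    have "?f (z k + c *s vec4 0 1 0 0) = poly [:0, 1:] c" for c using that z by simp
    from vanishes_along_iff_coeff[of ?f, OF this] show "\<not> vanishes_along ?f (z k) (vec4 0 1 0 0) 2"
      by (auto intro!: exI[of _ 1])
  qed
  show "\<exists>c. g = (\<lambda>z. c * ?f z)"
    if g: "g \<in> hirz_sections n (int 1) (int 0)" and gz: "\<And>k. k < 1 \<Longrightarrow> g (z k) = 0" for g
  proof -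
    obtain c d where cd: "g = (\<lambda>z. c * z$1 + d * z$2)" using hirz_sections_fiber_class[of g n] g by auto
    then have "c = - d * x" using gz[of 0] z by (simp add: eq_neg_iff_add_eq_0)
    then show ?thesis using cd by (intro exI[of _ d]) (auto simp: algebra_simps)
  qed
qed

subsection \<open>Conics on the blown-up plane\<close>

text \<open>These are the coefficients of \<open>d0 u^2 + d1 u v + d2 v^2\<close> as a product of
  \<open>\<alpha>0 u + \<alpha>1 v\<close> and \<open>\<beta>0 u + \<beta>1 v\<close>. For
  \<open>d2 = 0\<close> the factor \<open>u\<close> splits off.\<close>

lemma binary_quadratic_factor:
  fixes d0 d1 d2 :: complex
  shows "\<exists>\<alpha>0 \<alpha>1 \<beta>0 \<beta>1. d0 = \<alpha>0 * \<beta>0 \<and> d1 = \<alpha>0 * \<beta>1 + \<alpha>1 * \<beta>0 \<and> d2 = \<alpha>1 * \<beta>1"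
proof (cases "d2 = 0")
  case True
  then show ?thesis by (intro exI[of _ d0] exI[of _ d1] exI[of _ 1] exI[of _ 0]) simp
next
  case False
  then have "Polynomial.degree [:d0, d1, d2:] = 2" by simp
  then have "\<not> constant (poly [:d0, d1, d2:])" using constant_degree[of "[:d0, d1, d2:]"] by simp
  then obtain \<rho> where "poly [:d0, d1, d2:] \<rho> = 0" using fundamental_theorem_of_algebra by blast
  then have "d0 = - \<rho> * (d1 + d2 * \<rho>)" by (simp add: algebra_simps eq_neg_iff_add_eq_0)
  then show ?thesis
    by (intro exI[of _ "- \<rho>"] exI[of _ 1] exI[of _ "d1 + d2 * \<rho>"] exI[of _ d2]) (simp add: algebra_simps)
qed

lemma binary_quadratic_square:
  fixes d0 d1 d2 :: complex
  assumes "d1 ^ 2 = 4 * d0 * d2"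
  shows "\<exists>\<delta>0 \<delta>1. d0 = \<delta>0 ^ 2 \<and> d1 = 2 * \<delta>0 * \<delta>1 \<and> d2 = \<delta>1 ^ 2"
proof (cases "d2 = 0")
  case True
  then show ?thesis using assms by (intro exI[of _ "csqrt d0"] exI[of _ 0]) simp
next
  case False
  then have "csqrt d2 \<noteq> 0" by simp
  moreover have "(d1 / (2 * csqrt d2)) ^ 2 = d0"
    using assms False by (simp add: power_divide power_mult_distrib)
  ultimately show ?thesis by (intro exI[of _ "d1 / (2 * csqrt d2)"] exI[of _ "csqrt d2"]) simp
qed

text \<open>The conic \<open>z\<^sub>4\<^sup>2 + L z\<^sub>3 z\<^sub>4 + N z\<^sub>3\<^sup>2\<close> with linear and quadratic forms \<open>L\<close>, \<open>N\<close> in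
  \<open>z\<^sub>1, z\<^sub>2\<close>, whose discriminant \<open>L\<^sup>2 - 4 N\<close> is the product of two independent linear forms. These
  forms serve as \<open>t\<^sup>2\<close> and \<open>1\<close> in the parametrization of the conic.\<close>

locale conic =
  fixes l0 l1 n0 n1 n2 \<alpha>0 \<alpha>1 \<beta>0 \<beta>1 :: complex
  assumes disc0: "l0 ^ 2 - 4 * n0 = \<alpha>0 * \<beta>0"
    and disc1: "2 * l0 * l1 - 4 * n1 = \<alpha>0 * \<beta>1 + \<alpha>1 * \<beta>0"
    and disc2: "l1 ^ 2 - 4 * n2 = \<alpha>1 * \<beta>1"
    and indep: "\<alpha>0 * \<beta>1 - \<alpha>1 * \<beta>0 \<noteq> 0"
begin

definition form :: "cvec4 \<Rightarrow> complex" where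
  "form z = z$4 ^ 2 + (l0 * z$1 + l1 * z$2) * z$3 * z$4 + (n0 * z$1 ^ 2 + n1 * z$1 * z$2 + n2 * z$2 ^ 2) * z$3 ^ 2"

definition X :: "complex \<Rightarrow> complex" where
  "X t = (\<beta>1 * t ^ 2 - \<alpha>1) / (\<alpha>0 * \<beta>1 - \<alpha>1 * \<beta>0)"

definition Y :: "complex \<Rightarrow> complex" where
  "Y t = (\<alpha>0 - \<beta>0 * t ^ 2) / (\<alpha>0 * \<beta>1 - \<alpha>1 * \<beta>0)"

text \<open>\<open>X\<close> and \<open>Y\<close> come from Cramer's rule; the last coordinate
  solves \<open>2 * z$4 + L * z$3 = t\<close>, with \<open>L\<close> the linear form of the
  conic.\<close>

definition param :: "complex \<Rightarrow> cvec4" where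
  "param t = vec4 (X t) (Y t) 1 ((t - (l0 * X t + l1 * Y t)) / 2)"

text \<open>Completing the square in \<open>z$4\<close>, with the discriminant in factored
  form.\<close>

lemma four_form:
  "4 * form z = (2 * z$4 + (l0 * z$1 + l1 * z$2) * z$3) ^ 2
     - z$3 ^ 2 * ((\<alpha>0 * z$1 + \<alpha>1 * z$2) * (\<beta>0 * z$1 + \<beta>1 * z$2))"
proof -
  have n: "4 * n0 = l0 ^ 2 - \<alpha>0 * \<beta>0" "4 * n1 = 2 * l0 * l1 - (\<alpha>0 * \<beta>1 + \<alpha>1 * \<beta>0)"
    "4 * n2 = l1 ^ 2 - \<alpha>1 * \<beta>1" using disc0 disc1 disc2 by (simp_all add: algebra_simps)
  have "4 * form z = 4 * z$4 ^ 2 + 4 * (l0 * z$1 + l1 * z$2) * z$3 * z$4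
      + (4 * n0 * z$1 ^ 2 + 4 * n1 * z$1 * z$2 + 4 * n2 * z$2 ^ 2) * z$3 ^ 2"
    unfolding form_def by (simp add: algebra_simps)
  then show ?thesis unfolding n by (simp add: power2_eq_square algebra_simps)
qed

lemma form_poly: "form \<in> poly_funs coords"
  unfolding form_def by (intro poly_funs_intros)

lemma form_hirz_sections: "form \<in> hirz_sections 1 0 2"
  by (rule hirz_sectionsI[OF form_poly])
     (simp add: form_def power2_eq_square power_int_numeral field_simps)

lemma alpha_X_Y: "\<alpha>0 * X t + \<alpha>1 * Y t = t ^ 2"
  using indep unfolding X_def Y_def times_divide_eq_right add_divide_distrib[symmetric]
  by (simp add: field_simps)

lemma beta_X_Y: "\<beta>0 * X t + \<beta>1 * Y t = 1"
  using indep unfolding X_def Y_def times_divide_eq_right add_divide_distrib[symmetric]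
  by (simp add: field_simps)

lemma alpha_beta_eqD:
  assumes "\<alpha>0 * u + \<alpha>1 * v = \<alpha>0 * u' + \<alpha>1 * v'" "\<beta>0 * u + \<beta>1 * v = \<beta>0 * u' + \<beta>1 * v'"
  shows "u = u'" "v = v'"
proof -
  have "(\<alpha>0 * \<beta>1 - \<alpha>1 * \<beta>0) * (u - u') = \<beta>1 * ((\<alpha>0 * u + \<alpha>1 * v) - (\<alpha>0 * u' + \<alpha>1 * v'))
      - \<alpha>1 * ((\<beta>0 * u + \<beta>1 * v) - (\<beta>0 * u' + \<beta>1 * v'))"
    by (simp add: algebra_simps)
  then show "u = u'" unfolding assms using indep by simp
  have "(\<alpha>0 * \<beta>1 - \<alpha>1 * \<beta>0) * (v - v') = \<alpha>0 * ((\<beta>0 * u + \<beta>1 * v) - (\<beta>0 * u' + \<beta>1 * v'))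
      - \<beta>0 * ((\<alpha>0 * u + \<alpha>1 * v) - (\<alpha>0 * u' + \<alpha>1 * v'))"
    by (simp add: algebra_simps)
  then show "v = v'" unfolding assms using indep by simp
qed

lemma form_param: "form (param t) = 0"
proof -
  have half: "2 * ((t - L) / 2) + L * 1 = t" for L :: complex by (simp add: field_simps)
  have "4 * form (param t) = t ^ 2 - 1 ^ 2 * (t ^ 2 * 1)"
    unfolding four_form param_def vector_4 alpha_X_Y beta_X_Y half ..
  then show ?thesis by simp
qed

lemma param_cox: "param t \<in> cox_points"
  using beta_X_Y[of t] unfolding cox_points_def param_def by auto

lemma param_inj: "inj (\<lambda>t. Defs.orbit 1 (param t))"
proof (rule injI)
  fix t t' assume "Defs.orbit 1 (param t) = Defs.orbit 1 (param t')"
  then obtain l m where lm: "l \<noteq> 0" "m \<noteq> 0" "param t' = torus_act 1 l m (param t)" by (rule orbit_eqE)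
  then have XY: "X t' = l * X t" "Y t' = l * Y t" and "m = l"
    and w: "(t' - (l0 * X t' + l1 * Y t')) / 2 = m * ((t - (l0 * X t + l1 * Y t)) / 2)"
    by (auto simp: vec4_eq_iff param_def)
  \<comment> \<open>The form with coefficients \<open>\<beta>0\<close>, \<open>\<beta>1\<close>
    equals 1 along the parametrization, which pins down the representatives.\<close>
  have "1 = l * (\<beta>0 * X t + \<beta>1 * Y t)" using beta_X_Y[of t'] unfolding XY by (simp add: algebra_simps)
  then have "l = 1" unfolding beta_X_Y by simp
  then show "t = t'" using w XY \<open>m = l\<close> by simp
qed

lemma param_poly: "\<exists>q. \<forall>t. param t $ i = poly q t"
proof -
  let ?D = "\<alpha>0 * \<beta>1 - \<alpha>1 * \<beta>0"
  define p where "p = [:- \<alpha>1 / ?D, 0, \<beta>1 / ?D:]"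
  define q where "q = [:\<alpha>0 / ?D, 0, - \<beta>0 / ?D:]"
  have X: "X t = poly p t" and Y: "Y t = poly q t" for t
    unfolding X_def Y_def p_def q_def by (simp_all add: power2_eq_square field_simps diff_divide_distrib)
  have W: "(t - (l0 * X t + l1 * Y t)) / 2
      = poly (Polynomial.smult (1/2) ([:0, 1:] - (Polynomial.smult l0 p + Polynomial.smult l1 q))) t" for t
    unfolding X Y by simp
  consider "i = 1" | "i = 2" | "i = 3" | "i = 4" using exhaust_4 by blast
  then show ?thesis
  proof cases
    case 1 then show ?thesis using X by (auto simp: param_def)
  next
    case 2 then show ?thesis using Y by (auto simp: param_def)
  next
    case 3 then show ?thesis by (auto simp: param_def intro: exI[of _ "[:1:]"])
  next
    case 4 then show ?thesis by (auto simp only: param_def vector_4 W)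
  qed
qed

text \<open>Division with remainder by \<open>form\<close>, monic of degree 2 in \<open>z$4\<close>.
  Independence of \<open>z$4\<close> is expressed as invariance under changing that coordinate. In
  the product case \<open>z$4 ^ 2\<close> is replaced by
  \<open>form z - P z * z$4 - R z\<close>.\<close>

lemma division_by_form:
  assumes "g \<in> poly_funs coords"
  shows "\<exists>k\<in>poly_funs coords. \<exists>g1\<in>poly_funs coords. \<exists>g0\<in>poly_funs coords.
    (\<forall>z. g z = form z * k z + g1 z * z$4 + g0 z) \<and>
    (\<forall>z s. g1 (vec4 (z$1) (z$2) (z$3) s) = g1 z) \<and> (\<forall>z s. g0 (vec4 (z$1) (z$2) (z$3) s) = g0 z)"
  using assms
proof induction
  case (const c)
  show ?case
    by (rule bexI[of _ "\<lambda>_. 0"], rule bexI[of _ "\<lambda>_. 0"], rule bexI[of _ "\<lambda>_. c"]) (auto intro: poly_funs.const)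
next
  case (coord x)
  then obtain i where i: "x = (\<lambda>z. z $ i)" by auto
  show ?case
  proof (cases "i = 4")
    case True
    then show ?thesis unfolding i
      by (intro bexI[of _ "\<lambda>_. 0"] bexI[of _ "\<lambda>_. 1"]) (auto intro: poly_funs.const)
  next
    case False
    then show ?thesis unfolding i using exhaust_4[of i]
      by (intro bexI[of _ "\<lambda>_. 0"] bexI[of _ "\<lambda>z. z $ i"]) (auto intro: poly_funs.const)
  qed
next
  case (add g h)
  from add.IH(1) obtain k g1 g0 where g: "k \<in> poly_funs coords" "g1 \<in> poly_funs coords" "g0 \<in> poly_funs coords"
    "\<And>z. g z = form z * k z + g1 z * z$4 + g0 z"
    "\<And>z s. g1 (vec4 (z$1) (z$2) (z$3) s) = g1 z" "\<And>z s. g0 (vec4 (z$1) (z$2) (z$3) s) = g0 z" by blast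
  from add.IH(2) obtain k' h1 h0 where h: "k' \<in> poly_funs coords" "h1 \<in> poly_funs coords" "h0 \<in> poly_funs coords"
    "\<And>z. h z = form z * k' z + h1 z * z$4 + h0 z"
    "\<And>z s. h1 (vec4 (z$1) (z$2) (z$3) s) = h1 z" "\<And>z s. h0 (vec4 (z$1) (z$2) (z$3) s) = h0 z" by blast
  show ?case
  proof (rule bexI[of _ "\<lambda>z. k z + k' z"], rule bexI[of _ "\<lambda>z. g1 z + h1 z"], rule bexI[of _ "\<lambda>z. g0 z + h0 z"],
      intro conjI allI)
    show "g z + h z = form z * (k z + k' z) + (g1 z + h1 z) * z$4 + (g0 z + h0 z)" for z
      unfolding g(4) h(4) by (simp add: algebra_simps)
  qed (simp_all add: g(1-3,5,6) h(1-3,5,6) poly_funs.add)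
next
  case (mult g h)
  from mult.IH(1) obtain k g1 g0 where g: "k \<in> poly_funs coords" "g1 \<in> poly_funs coords" "g0 \<in> poly_funs coords"
    "\<And>z. g z = form z * k z + g1 z * z$4 + g0 z"
    "\<And>z s. g1 (vec4 (z$1) (z$2) (z$3) s) = g1 z" "\<And>z s. g0 (vec4 (z$1) (z$2) (z$3) s) = g0 z" by blast
  from mult.IH(2) obtain k' h1 h0 where h: "k' \<in> poly_funs coords" "h1 \<in> poly_funs coords" "h0 \<in> poly_funs coords"
    "\<And>z. h z = form z * k' z + h1 z * z$4 + h0 z"
    "\<And>z s. h1 (vec4 (z$1) (z$2) (z$3) s) = h1 z" "\<And>z s. h0 (vec4 (z$1) (z$2) (z$3) s) = h0 z" by blast
  define P where "P z = (l0 * z$1 + l1 * z$2) * z$3" for z :: cvec4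
  define R where "R z = (n0 * z$1 ^ 2 + n1 * z$1 * z$2 + n2 * z$2 ^ 2) * z$3 ^ 2" for z :: cvec4
  have PR: "P \<in> poly_funs coords" "R \<in> poly_funs coords"
    unfolding P_def R_def by (intro poly_funs_intros)+
  have form_eq: "form z = z$4 ^ 2 + P z * z$4 + R z" for z unfolding form_def P_def R_def by simp
  show ?case
  proof (rule bexI[of _ "\<lambda>z. k z * h z + (g1 z * z$4 + g0 z) * k' z + g1 z * h1 z"],
      rule bexI[of _ "\<lambda>z. g1 z * h0 z + g0 z * h1 z - P z * (g1 z * h1 z)"],
      rule bexI[of _ "\<lambda>z. g0 z * h0 z - R z * (g1 z * h1 z)"], intro conjI allI)
    show "g z * h z = form z * (k z * h z + (g1 z * z$4 + g0 z) * k' z + g1 z * h1 z)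
        + (g1 z * h0 z + g0 z * h1 z - P z * (g1 z * h1 z)) * z$4 + (g0 z * h0 z - R z * (g1 z * h1 z))" for z
      unfolding g(4) h(4) form_eq by (simp add: algebra_simps power2_eq_square)
    have "P (vec4 (z$1) (z$2) (z$3) s) = P z" "R (vec4 (z$1) (z$2) (z$3) s) = R z" for z s
      unfolding P_def R_def by simp_all
    then show "g1 (vec4 (z$1) (z$2) (z$3) s) * h0 (vec4 (z$1) (z$2) (z$3) s)
        + g0 (vec4 (z$1) (z$2) (z$3) s) * h1 (vec4 (z$1) (z$2) (z$3) s)
        - P (vec4 (z$1) (z$2) (z$3) s) * (g1 (vec4 (z$1) (z$2) (z$3) s) * h1 (vec4 (z$1) (z$2) (z$3) s))
        = g1 z * h0 z + g0 z * h1 z - P z * (g1 z * h1 z)"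
      "g0 (vec4 (z$1) (z$2) (z$3) s) * h0 (vec4 (z$1) (z$2) (z$3) s)
        - R (vec4 (z$1) (z$2) (z$3) s) * (g1 (vec4 (z$1) (z$2) (z$3) s) * h1 (vec4 (z$1) (z$2) (z$3) s))
        = g0 z * h0 z - R z * (g1 z * h1 z)" for z s
      by (simp_all add: g(5,6) h(5,6))
  qed (intro poly_funs.add poly_funs_diff poly_funs.mult poly_funs_coord PR g(1-3) h(1-3) mult.hyps)+
qed

text \<open>Over general \<open>z$1\<close>, \<open>z$2\<close>, \<open>z$3\<close> the conic has
  two points, with parameters \<open>t\<close> and \<open>- t\<close>. The remainder has degree at
  most 1 in \<open>z$4\<close> and vanishes at both, so it is 0.\<close>

lemma form_dvd:
  assumes g: "g \<in> hirz_sections 1 a' b'" and van: "\<And>t. g (param t) = 0"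
  shows "\<exists>h\<in>poly_funs coords. \<forall>z. g z = form z * h z"
proof -
  obtain k g1 g0 where k: "k \<in> poly_funs coords" "g1 \<in> poly_funs coords" "g0 \<in> poly_funs coords"
    and g_eq: "\<And>z. g z = form z * k z + g1 z * z$4 + g0 z"
    and g1: "\<And>z s. g1 (vec4 (z$1) (z$2) (z$3) s) = g1 z" and g0: "\<And>z s. g0 (vec4 (z$1) (z$2) (z$3) s) = g0 z"
    using division_by_form[OF hirz_sections_poly_funs[OF g]] by blast
  \<comment> \<open>\<open>F\<close> has the same zeros as the discriminant of \<open>form\<close>
    with respect to \<open>z$4\<close>.\<close>
  define F where "F z = z$3 * ((\<alpha>0 * z$1 + \<alpha>1 * z$2) * (\<beta>0 * z$1 + \<beta>1 * z$2))" for z :: cvec4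
  have F: "F \<in> poly_funs coords" unfolding F_def by (intro poly_funs_intros)
  have F1: "F (vec4 (X 1) (Y 1) 1 0) \<noteq> 0" unfolding F_def by (simp add: alpha_X_Y beta_X_Y)
  have "g1 z = 0 \<and> g0 z = 0" if "F z \<noteq> 0" for z
  proof -
    have nz: "z$3 \<noteq> 0" "\<alpha>0 * z$1 + \<alpha>1 * z$2 \<noteq> 0" "\<beta>0 * z$1 + \<beta>1 * z$2 \<noteq> 0"
      using that unfolding F_def by auto
    define l where "l = \<beta>0 * z$1 + \<beta>1 * z$2"
    define t where "t = csqrt ((\<alpha>0 * z$1 + \<alpha>1 * z$2) / l)"
    have l: "l \<noteq> 0" using nz l_def by simp
    have t: "t \<noteq> 0" "l * t ^ 2 = \<alpha>0 * z$1 + \<alpha>1 * z$2" using nz l unfolding t_def by simp_all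
    have on_curve: "g1 z * (z$3 * l * ((s - (l0 * X s + l1 * Y s)) / 2)) + g0 z = 0" if s: "s ^ 2 = t ^ 2" for s
    proof -
      have "\<alpha>0 * (l * X s) + \<alpha>1 * (l * Y s) = l * (\<alpha>0 * X s + \<alpha>1 * Y s)"
        by (simp add: algebra_simps)
      then have 1: "\<alpha>0 * (l * X s) + \<alpha>1 * (l * Y s) = \<alpha>0 * z$1 + \<alpha>1 * z$2"
        unfolding alpha_X_Y s t(2) .
      have "\<beta>0 * (l * X s) + \<beta>1 * (l * Y s) = l * (\<beta>0 * X s + \<beta>1 * Y s)"
        by (simp add: algebra_simps)
      also have "\<dots> = \<beta>0 * z$1 + \<beta>1 * z$2" unfolding beta_X_Y by (simp add: l_def)
      finally have 2: "\<beta>0 * (l * X s) + \<beta>1 * (l * Y s) = \<beta>0 * z$1 + \<beta>1 * z$2" .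
      note XY = alpha_beta_eqD[OF 1 2]
      \<comment> \<open>This torus element moves the point with parameter \<open>s\<close> to the
        prescribed first three coordinates.\<close>
      define x where "x = torus_act 1 l (z$3 * l) (param s)"
      have x: "x = vec4 (z$1) (z$2) (z$3) (z$3 * l * ((s - (l0 * X s + l1 * Y s)) / 2))"
        unfolding x_def using l XY by (simp add: vec4_eq_iff param_def)
      have "g x = 0" "form x = 0"
        unfolding x_def using hirz_sections_torus_act[OF g] hirz_sections_torus_act[OF form_hirz_sections]
          van form_param l nz by simp_all
      then have "g1 x * x$4 + g0 x = 0" using g_eq[of x] by simp
      then show ?thesis unfolding x g1 g0 by simp
    qed
    have XY: "X (- t) = X t" "Y (- t) = Y t" unfolding X_def Y_def by simp_all
    \<comment> \<open>\<open>X\<close> and \<open>Y\<close> are even in \<open>t\<close>, so the two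
      values of \<open>z$4\<close> differ by \<open>z$3 * l * t\<close>.\<close>
    have "g1 z * (z$3 * l * t) = (g1 z * (z$3 * l * ((t - (l0 * X t + l1 * Y t)) / 2)) + g0 z)
        - (g1 z * (z$3 * l * ((- t - (l0 * X (- t) + l1 * Y (- t))) / 2)) + g0 z)"
      unfolding XY by (simp add: field_simps)
    also have "\<dots> = 0" using on_curve[of t] on_curve[of "- t"] by simp
    finally have "g1 z = 0" using l t(1) nz by simp
    then show ?thesis using on_curve[of t] by simp
  qed
  then have "g1 z = 0" "g0 z = 0" for z
    using poly_funs_domain[OF F k(2) F1] poly_funs_domain[OF F k(3) F1] by blast+
  then show ?thesis using g_eq k(1) by auto
qed

text \<open>At a double point the derivative in \<open>z$4\<close> shows that the discriminant
  vanishes at \<open>x\<close>, and the derivative in \<open>z$2\<close> that it vanishes there to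
  second order. Its two linear factors would then be proportional.\<close>

lemma form_simple:
  assumes "form (vec4 1 x 1 y) = 0"
  shows "\<exists>w. \<not> vanishes_along form (vec4 1 x 1 y) w 2"
proof (rule ccontr)
  assume *: "\<not> ?thesis"
  define A B where "A = \<alpha>0 + \<alpha>1 * x" and "B = \<beta>0 + \<beta>1 * x"
  define S where "S = A * \<beta>1 + \<alpha>1 * B"
  have "form (vec4 1 x 1 y + c *s vec4 0 0 0 1) = poly [:0, 2 * y + (l0 + l1 * x), 1:] c" for c
    using assms by (simp add: form_def power2_eq_square algebra_simps)
  from vanishes_along_iff_coeff[OF this, of 2] have y: "2 * y + (l0 + l1 * x) = 0"
    using * by (auto dest: spec[of _ 1])
  then have AB: "A * B = 0" using assms four_form[of "vec4 1 x 1 y"] unfolding A_def B_def by simp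
  have "form (vec4 1 x 1 y + c *s vec4 0 1 0 0)
      = poly [:0, - S / 4, (l1 ^ 2 - \<alpha>1 * \<beta>1) / 4:] c" for c
  proof -
    have "4 * form (vec4 1 x 1 y + c *s vec4 0 1 0 0)
        = ((2 * y + (l0 + l1 * x)) + l1 * c) ^ 2 - (A + \<alpha>1 * c) * (B + \<beta>1 * c)"
      unfolding four_form A_def B_def by (simp add: algebra_simps)
    also have "\<dots> = l1 ^ 2 * c ^ 2 - A * B - (A * \<beta>1 + \<alpha>1 * B) * c - \<alpha>1 * \<beta>1 * c ^ 2"
      unfolding y by (simp add: power2_eq_square algebra_simps)
    also have "\<dots> = 4 * poly [:0, - S / 4, (l1 ^ 2 - \<alpha>1 * \<beta>1) / 4:] c"
      unfolding AB S_def by (simp add: power2_eq_square field_simps)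
    finally show ?thesis by simp
  qed
  from vanishes_along_iff_coeff[OF this, of 2] have S: "S = 0"
    using * by (auto dest: spec[of _ 1])
  have "\<alpha>0 * \<beta>1 - \<alpha>1 * \<beta>0 = A * \<beta>1 - \<alpha>1 * B" unfolding A_def B_def by (simp add: algebra_simps)
  moreover have "A * \<beta>1 - \<alpha>1 * B = 0" using AB S unfolding S_def by auto
  ultimately show False using indep by simp
qed

end

text \<open>Every monomial of class \<open>2 H\<close> other than \<open>z$4 ^ 2\<close> is
  divisible by \<open>z$3\<close>, and the quotient has class \<open>F + H\<close>.\<close>

lemma hirz_sections_conic_class:
  assumes "g \<in> hirz_sections 1 0 2"
  shows "\<exists>c a b. Polynomial.degree a \<le> 1 \<and> Polynomial.degree b \<le> 2 \<and>
    g = (\<lambda>z. c * z$4 ^ 2 + z$3 * section_fun 1 1 a b z)"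
proof (rule hirz_sections_span[OF assms])
  show "\<exists>c a b. Polynomial.degree a \<le> 1 \<and> Polynomial.degree b \<le> 2 \<and>
      (\<lambda>_. 0) = (\<lambda>z :: cvec4. c * z$4 ^ 2 + z$3 * section_fun 1 1 a b z)"
    by (intro exI[of _ 0]) (auto simp: section_fun_def)
next
  fix g h :: "cvec4 \<Rightarrow> complex"
  assume "\<exists>c a b. Polynomial.degree a \<le> 1 \<and> Polynomial.degree b \<le> 2 \<and>
      g = (\<lambda>z. c * z$4 ^ 2 + z$3 * section_fun 1 1 a b z)"
    "\<exists>c a b. Polynomial.degree a \<le> 1 \<and> Polynomial.degree b \<le> 2 \<and>
      h = (\<lambda>z. c * z$4 ^ 2 + z$3 * section_fun 1 1 a b z)"
  then obtain c a b c' a' b' where *: "Polynomial.degree a \<le> 1" "Polynomial.degree b \<le> 2"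
    "Polynomial.degree a' \<le> 1" "Polynomial.degree b' \<le> 2"
    "g = (\<lambda>z. c * z$4 ^ 2 + z$3 * section_fun 1 1 a b z)"
    "h = (\<lambda>z. c' * z$4 ^ 2 + z$3 * section_fun 1 1 a' b' z)" by blast
  have "(\<lambda>z. g z + h z) = (\<lambda>z. (c + c') * z$4 ^ 2 + z$3 * section_fun 1 1 (a + a') (b + b') z)"
    unfolding *(5,6) section_fun_def hpoly_add by (simp add: algebra_simps)
  then show "\<exists>c a b. Polynomial.degree a \<le> 1 \<and> Polynomial.degree b \<le> 2 \<and>
      (\<lambda>z. g z + h z) = (\<lambda>z. c * z$4 ^ 2 + z$3 * section_fun 1 1 a b z)"
    using *(1-4) degree_add_le by blast
next
  fix t assume t: "mon_F 1 t = 0" "mon_H t = 2"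
  obtain c i j k l where fields: "t = (c, i, j, k, l)" by (cases t)
  have "int (k + l) = int 2" "int (i + j) = int k" using t fields by simp_all
  then have "k + l = 2" "i + j = k" by (simp_all only: of_nat_eq_iff)
  then consider "k = 0" "l = 2" "i = 0" "j = 0" | k' where "k = Suc k'" "l + k' = 1" "i + j = Suc k'"
    by (cases k) auto
  then show "\<exists>c a b. Polynomial.degree a \<le> 1 \<and> Polynomial.degree b \<le> 2 \<and>
      (\<lambda>z. mon_eval z t) = (\<lambda>z. c * z$4 ^ 2 + z$3 * section_fun 1 1 a b z)"
  proof cases
    case 1
    then show ?thesis by (intro exI[of _ c] exI[of _ 0]) (simp add: fields section_fun_def)
  next
    case (2 k')
    have "(\<lambda>z. mon_eval z (c, i, j, k', l)) \<in> hirz_sections 1 (mon_F 1 (c, i, j, k', l)) (mon_H (c, i, j, k', l))"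
      by (rule mon_eval_hirz_sections)
    moreover have "mon_F 1 (c, i, j, k', l) = int 1" "mon_H (c, i, j, k', l) = 1"
      using 2 by (simp_all flip: of_nat_add)
    ultimately obtain a b where "Polynomial.degree a \<le> 1" "Polynomial.degree b \<le> 1 + 1"
      "(\<lambda>z. mon_eval z (c, i, j, k', l)) = section_fun 1 1 a b"
      using hirz_sections_section_fun[of _ 1 1] by metis
    moreover have "mon_eval z t = z$3 * mon_eval z (c, i, j, k', l)" for z
      unfolding fields using 2 by simp
    ultimately have "(\<lambda>z. mon_eval z t) = (\<lambda>z. 0 * z$4 ^ 2 + z$3 * section_fun 1 1 a b z)"
      by (simp add: fun_eq_iff del: mon_eval.simps)
    then show ?thesis using \<open>Polynomial.degree a \<le> 1\<close> \<open>Polynomial.degree b \<le> 1 + 1\<close>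
      by (intro exI[of _ 0] exI[of _ a] exI[of _ b]) simp
  qed
qed

section \<open>The conic through five general points\<close>

definition triple :: "nat \<Rightarrow> nat \<Rightarrow> nat \<Rightarrow> nat \<Rightarrow> nat" where
  "triple i j k m = (if m = 0 then i else if m = 1 then j else k)"

lemma two_lines_collinear_triple:
  assumes "\<And>k. k < (5 :: nat) \<Longrightarrow> P k \<or> Q k"
  obtains R i j k where "R = P \<or> R = Q" "i < 5" "j < 5" "k < 5" "i \<noteq> j" "j \<noteq> k" "i \<noteq> k" "R i" "R j" "R k"
proof -
  let ?S = "\<lambda>R. {k. k < (5 :: nat) \<and> R k}"
  have fin: "finite (?S R)" for R by (rule finite_subset[of _ "{..<5}"]) auto
  have "{..<5} = ?S P \<union> ?S Q" using assms by auto
  then have "5 \<le> card (?S P) + card (?S Q)" using card_Un_le[of "?S P" "?S Q"] by (metis card_lessThan)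
  then have "3 \<le> card (?S P) \<or> 3 \<le> card (?S Q)" by linarith
  then obtain R where R: "R = P \<or> R = Q" "3 \<le> card (?S R)" by blast
  then obtain T where T: "T \<subseteq> ?S R" "card T = 3" using obtain_subset_with_card_n by metis
  then obtain i j k where "T = {i, j, k}" "i \<noteq> j" "j \<noteq> k" "i \<noteq> k" using card_3_iff by metis
  then show thesis using that[of R i j k] R(1) T(1) by auto
qed

text \<open>In the plane obtained by contracting the negative curve, \<open>gen5\<close> says that
  no conic through the five centres passes through the contracted point, and \<open>gen3\<close>
  that no three centres are collinear. The first makes the coefficient of \<open>z$4 ^ 2\<close>
  nonzero, the second the discriminant nondegenerate.\<close>

lemma conic_blowup_curve:
  assumes z: "\<And>k. k < 5 \<Longrightarrow> z k = vec4 1 (x k) 1 (y k)"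
    and p: "\<And>k. k < 5 \<Longrightarrow> p k = Defs.orbit 1 (z k)"
    and gen5: "interp_cond 2 1 (\<lambda>k. k) z"
    and gen3: "\<And>i j k. i < 5 \<Longrightarrow> j < 5 \<Longrightarrow> k < 5 \<Longrightarrow> i \<noteq> j \<Longrightarrow> j \<noteq> k \<Longrightarrow> i \<noteq> k \<Longrightarrow>
      interp_cond 1 1 (triple i j k) z"
  shows "\<exists>f \<phi>. blowup_curve 1 5 z p 0 2 f \<phi>"
proof -
  \<comment> \<open>Six monomials against five points: \<open>interp_fun 2 1\<close> yields
    \<open>y\<close>, \<open>x y\<close>, \<open>1\<close>, \<open>x\<close>, \<open>x^2\<close>,
    and index 5 is reserved for \<open>y^2\<close>.\<close>
  obtain v where v: "\<And>k. k < 5 \<Longrightarrow> (\<Sum>i<Suc 5. v i * (if i < 5 then interp_fun 2 1 i (z k) else y k ^ 2)) = 0"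
    "\<exists>i<Suc 5. v i \<noteq> 0"
    using underdetermined_system[of 5 "\<lambda>k i. if i < 5 then interp_fun 2 1 i (z k) else y k ^ 2"] by blast
  have sum5: "(\<Sum>i<5. v i * interp_fun 2 1 i (z k)) + v 5 * y k ^ 2 = 0" if k: "k < 5" for k
  proof -
    have "(\<Sum>i<5. v i * (if i < 5 then interp_fun 2 1 i (z k) else y k ^ 2))
        = (\<Sum>i<5. v i * interp_fun 2 1 i (z k))" by (rule sum.cong) auto
    then show ?thesis using v(1)[OF k] unfolding sum.lessThan_Suc by simp
  qed
  have v5: "v 5 \<noteq> 0"
  proof
    assume v5: "v 5 = 0"
    have five: "2 * 2 + 1 = (5 :: nat)" by simp
    have "v i = 0" if "i < 5" for i
      using gen5 sum5 that unfolding interp_cond_def five v5 by simp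
    then show False using v(2) v5 by (metis less_SucE)
  qed
  define l0 l1 n0 n1 n2 where "l0 = v 0 / v 5" and "l1 = v 1 / v 5"
    and "n0 = v 2 / v 5" and "n1 = v 3 / v 5" and "n2 = v 4 / v 5"
  have pt: "y k ^ 2 + (l0 + l1 * x k) * y k + (n0 + n1 * x k + n2 * x k ^ 2) = 0" if k: "k < 5" for k
  proof -
    have five: "5 = 2 * 2 + (1 :: nat)" by simp
    have "(\<Sum>i<5. v i * interp_fun 2 1 i (z k)) = (v 0 + v 1 * x k) * y k + (v 2 + v 3 * x k + v 4 * x k ^ 2)"
      unfolding z[OF k] five sum_interp_fun
      by (simp add: eval_nat_numeral lessThan_Suc algebra_simps)
    then have "v 5 * y k ^ 2 + (v 0 + v 1 * x k) * y k + (v 2 + v 3 * x k + v 4 * x k ^ 2) = 0"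
      using sum5[OF k] by (simp add: add_ac)
    moreover have "y k ^ 2 + (l0 + l1 * x k) * y k + (n0 + n1 * x k + n2 * x k ^ 2)
        = (v 5 * y k ^ 2 + (v 0 + v 1 * x k) * y k + (v 2 + v 3 * x k + v 4 * x k ^ 2)) / v 5"
      using v5 by (simp add: l0_def l1_def n0_def n1_def n2_def field_simps)
    ultimately show ?thesis by simp
  qed
  obtain \<alpha>0 \<alpha>1 \<beta>0 \<beta>1 where disc: "l0 ^ 2 - 4 * n0 = \<alpha>0 * \<beta>0"
    "2 * l0 * l1 - 4 * n1 = \<alpha>0 * \<beta>1 + \<alpha>1 * \<beta>0" "l1 ^ 2 - 4 * n2 = \<alpha>1 * \<beta>1"
    using binary_quadratic_factor by metis
  \<comment> \<open>Proportional factors would make the discriminant a square and split the conic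
    into the two lines \<open>Q 1\<close> and \<open>Q (- 1)\<close>, one of which would contain
    three of the five centres.\<close>
  have indep: "\<alpha>0 * \<beta>1 - \<alpha>1 * \<beta>0 \<noteq> 0"
  proof
    assume "\<alpha>0 * \<beta>1 - \<alpha>1 * \<beta>0 = 0"
    then have "(\<alpha>0 * \<beta>1 - \<alpha>1 * \<beta>0) ^ 2 = 0" by simp
    then have "(\<alpha>0 * \<beta>1 + \<alpha>1 * \<beta>0) ^ 2 = 4 * (\<alpha>0 * \<beta>0) * (\<alpha>1 * \<beta>1)"
      by (simp add: power2_eq_square algebra_simps)
    then obtain \<delta>0 \<delta>1 where \<delta>: "l0 ^ 2 - 4 * n0 = \<delta>0 ^ 2" "2 * l0 * l1 - 4 * n1 = 2 * \<delta>0 * \<delta>1"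
      "l1 ^ 2 - 4 * n2 = \<delta>1 ^ 2" using binary_quadratic_square disc by metis
    define Q where "Q s k \<longleftrightarrow> y k + ((l0 + s * \<delta>0) / 2 + (l1 + s * \<delta>1) / 2 * x k) = 0" for s k
    have "Q 1 k \<or> Q (- 1) k" if k: "k < 5" for k
    proof -
      define A where "A = 2 * y k + (l0 + l1 * x k)"
      have "(A + (\<delta>0 + \<delta>1 * x k)) * (A - (\<delta>0 + \<delta>1 * x k))
          = A ^ 2 - (\<delta>0 ^ 2 + 2 * \<delta>0 * \<delta>1 * x k + \<delta>1 ^ 2 * x k ^ 2)"
        by (simp add: power2_eq_square algebra_simps)
      also have "\<dots> = 4 * (y k ^ 2 + (l0 + l1 * x k) * y k + (n0 + n1 * x k + n2 * x k ^ 2))"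
        unfolding A_def \<delta>[symmetric] by (simp add: power2_eq_square algebra_simps)
      also have "\<dots> = 0" using pt[OF k] by simp
      finally have "A + (\<delta>0 + \<delta>1 * x k) = 0 \<or> A - (\<delta>0 + \<delta>1 * x k) = 0" by simp
      moreover have Q_iff: "Q s k \<longleftrightarrow> A + s * (\<delta>0 + \<delta>1 * x k) = 0" for s
      proof -
        have "2 * (y k + ((l0 + s * \<delta>0) / 2 + (l1 + s * \<delta>1) / 2 * x k)) = A + s * (\<delta>0 + \<delta>1 * x k)"
          unfolding A_def by (simp add: distrib_left distrib_right add_divide_distrib)
        then show ?thesis unfolding Q_def by (metis mult_eq_0_iff zero_neq_numeral)
      qed
      ultimately show ?thesis unfolding Q_iff by (auto simp: algebra_simps)
    qed
    then obtain R i j k where R: "R = Q 1 \<or> R = Q (- 1)" and ijk: "i < 5" "j < 5" "k < 5"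
      "i \<noteq> j" "j \<noteq> k" "i \<noteq> k" "R i" "R j" "R k" by (rule two_lines_collinear_triple)
    then obtain s where s: "Q s i" "Q s j" "Q s k" by blast
    \<comment> \<open>The equation of the line is a pair excluded by \<open>gen3\<close>, its first
      entry being 1.\<close>
    have "[:1:] = (0 :: complex poly) \<and> [:(l0 + s * \<delta>0) / 2, (l1 + s * \<delta>1) / 2:] = 0"
    proof (rule interp_condD[OF gen3[OF ijk(1-6)]])
      fix m assume "m < 2 * 1 + (1 :: nat)"
      then have "triple i j k m \<in> {i, j, k}" by (auto simp: triple_def)
      then have lt: "triple i j k m < 5" and "Q s (triple i j k m)" using ijk s by auto
      then show "poly [:1:] (x (triple i j k m)) * y (triple i j k m)
          + poly [:(l0 + s * \<delta>0) / 2, (l1 + s * \<delta>1) / 2:] (x (triple i j k m)) = 0"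
        unfolding Q_def by (simp add: mult.commute)
      show "z (triple i j k m) = vec4 1 (x (triple i j k m)) 1 (y (triple i j k m))" using z[OF lt] .
    qed (auto intro: coeff_eq_0)
    then show False by simp
  qed
  interpret conic l0 l1 n0 n1 n2 \<alpha>0 \<alpha>1 \<beta>0 \<beta>1
    by unfold_locales (use disc indep in auto)
  have form_affine: "form (vec4 1 x 1 y) = y ^ 2 + (l0 + l1 * x) * y + (n0 + n1 * x + n2 * x ^ 2)" for x y
    by (simp add: form_def)
  have "blowup_curve 1 5 z p 0 2 form param"
  proof
    show "z k \<in> cox_points" if "k < 5" for k using z[OF that] by (simp add: cox_points_def)
    show "p k = Defs.orbit 1 (z k)" if "k < 5" for k using p[OF that] .
    show "form \<in> hirz_sections 1 (int 0) (int 2)" using form_hirz_sections by simp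
    show "\<exists>x. form x \<noteq> 0" by (rule exI[of _ "vec4 0 0 0 1"]) (simp add: form_def)
    show "form (z k) = 0" if "k < 5" for k using pt[OF that] z[OF that] by (simp add: form_affine)
    then show "\<exists>w. \<not> vanishes_along form (z k) w 2" if "k < 5" for k
      using form_simple that z[OF that] by metis
    show "\<exists>c. g = (\<lambda>x. c * form x)"
      if g: "g \<in> hirz_sections 1 (int 0) (int 2)" and gz: "\<And>k. k < 5 \<Longrightarrow> g (z k) = 0" for g
    proof -
      have "g \<in> hirz_sections 1 0 2" using g by simp
      then obtain c a b where ab: "Polynomial.degree a \<le> 1" "Polynomial.degree b \<le> 1 + 1"
        "g = (\<lambda>z. c * z$4 ^ 2 + z$3 * section_fun 1 1 a b z)"
        unfolding one_add_one using hirz_sections_conic_class by blast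
      \<comment> \<open>Subtracting \<open>c\<close> times the conic removes the term in
        \<open>z$4 ^ 2\<close>, so that \<open>gen5\<close> applies to the rest.\<close>
      define a' where "a' = a - Polynomial.smult c [:l0, l1:]"
      define b' where "b' = b - Polynomial.smult c [:n0, n1, n2:]"
      have "a' = 0 \<and> b' = 0"
      proof (rule interp_condD[OF gen5])
        show "Polynomial.coeff a' i = 0" if "i \<ge> 2" for i
          using that ab(1) unfolding a'_def
          by (auto simp: coeff_eq_0 coeff_pCons split: nat.split)
        show "Polynomial.coeff b' i = 0" if "i \<ge> 2 + 1" for i
          using that ab(2) unfolding b'_def
          by (auto simp: coeff_eq_0 coeff_pCons split: nat.split)
        fix k :: nat assume "k < 2 * 2 + 1"
        then have k: "k < 5" by simp
        show "z k = vec4 1 (x k) 1 (y k)" using z[OF k] .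
        have "c * y k ^ 2 + (poly a (x k) * y k + poly b (x k)) = 0"
          using gz[OF k] ab(1,2) unfolding ab(3) z[OF k] by (simp add: section_fun_affine)
        moreover have "c * (y k ^ 2 + (l0 + l1 * x k) * y k + (n0 + n1 * x k + n2 * x k ^ 2)) = 0"
          using pt[OF k] by simp
        moreover have "poly a' (x k) * y k + poly b' (x k)
            = (c * y k ^ 2 + (poly a (x k) * y k + poly b (x k)))
              - c * (y k ^ 2 + (l0 + l1 * x k) * y k + (n0 + n1 * x k + n2 * x k ^ 2))"
          unfolding a'_def b'_def by (simp add: algebra_simps power2_eq_square)
        ultimately show "poly a' (x k) * y k + poly b' (x k) = 0" by simp
      qed
      then have eqs: "a = Polynomial.smult c [:l0, l1:]" "b = Polynomial.smult c [:n0, n1, n2:]"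
        unfolding a'_def b'_def by simp_all
      have h1: "hpoly 1 [:l0, l1:] u v = l0 * u + l1 * v" for u v
        unfolding hpoly_def by simp
      have h2: "hpoly (1 + 1) [:n0, n1, n2:] u v = n0 * u ^ 2 + n1 * u * v + n2 * v ^ 2" for u v
        unfolding hpoly_def by (simp add: eval_nat_numeral)
      have "g = (\<lambda>z. c * form z)"
        unfolding ab(3) section_fun_def eqs hpoly_smult h1 h2 form_def
        by (simp add: power2_eq_square algebra_simps)
      then show ?thesis by blast
    qed
  qed (use param_poly param_cox param_inj form_param form_dvd in blast)+
  then show ?thesis by blast
qed

subsection \<open>General position\<close>

text \<open>Nonvanishing of \<open>z$1\<close> and \<open>z$3\<close> allows the centres to be
  normalized and keeps them off the negative curve; the third condition puts them on distinct
  fibres. The bound \<open>e < r\<close> follows from \<open>r = 2 * e + n + 1\<close> and makes the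
  last conjunction finite.\<close>

definition general_for_sections :: "nat \<Rightarrow> nat \<Rightarrow> (nat \<Rightarrow> cvec4) \<Rightarrow> bool" where
  "general_for_sections n r z \<longleftrightarrow> (\<forall>k<r. z k $ 1 \<noteq> 0) \<and> (\<forall>k<r. z k $ 3 \<noteq> 0) \<and>
     (\<forall>j<r. \<forall>k<r. j \<noteq> k \<longrightarrow> z j $ 1 * z k $ 2 - z j $ 2 * z k $ 1 \<noteq> 0) \<and>
     (\<forall>e<r. r = 2 * e + n + 1 \<longrightarrow> (\<forall>j<r. interp_cond e n (skip j) z))"

definition general_for_conics :: "(nat \<Rightarrow> cvec4) \<Rightarrow> bool" where
  "general_for_conics z \<longleftrightarrow> interp_cond 2 1 (\<lambda>k. k) z \<and>
     (\<forall>i<5. \<forall>j<5. \<forall>k<5. i \<noteq> j \<and> j \<noteq> k \<and> i \<noteq> k \<longrightarrow> interp_cond 1 1 (triple i j k) z)"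

definition general_position :: "nat \<Rightarrow> nat \<Rightarrow> (nat \<Rightarrow> cvec4) \<Rightarrow> bool" where
  "general_position n r z \<longleftrightarrow> general_for_sections n r z \<and>
     (n = 0 \<longrightarrow> general_for_sections n r (\<lambda>k. swap (z k))) \<and>
     (n = 1 \<and> r = 5 \<longrightarrow> general_for_conics z)"

lemma coord_hirz_sections:
  "(\<lambda>z. z$1) \<in> hirz_sections n 1 0" "(\<lambda>z. z$3) \<in> hirz_sections n (- int n) 1"
  by (rule hirz_sectionsI; simp add: power_int_minus field_simps)+

lemma open_condition_distinct:
  assumes "j < r" "k < r" "j \<noteq> k"
  shows "open_condition n r (\<lambda>z. z j $ 1 * z k $ 2 - z j $ 2 * z k $ 1 \<noteq> 0)"
proof (rule open_conditionI)
  show "(\<lambda>z. z j $ 1 * z k $ 2 - z j $ 2 * z k $ 1) \<in> poly_funs (tuple_coords r)"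
    using assms poly_funs_tuple_component[OF _ poly_funs_coord]
    by (intro poly_funs_diff poly_funs.mult) auto
  show "(\<lambda>m. if m = j then vec4 1 0 0 0 else vec4 0 1 0 0) j $ 1 *
        (\<lambda>m. if m = j then vec4 1 0 0 0 else vec4 0 1 0 0) k $ 2 -
        (\<lambda>m. if m = j then vec4 1 0 0 0 else vec4 0 1 0 0) j $ 2 *
        (\<lambda>m. if m = j then vec4 1 0 0 0 else vec4 0 1 0 0) k $ 1 \<noteq> 0"
    using assms by simp
  fix z l m z'
  assume lm: "\<And>k. k < r \<Longrightarrow> l k \<noteq> 0 \<and> m k \<noteq> 0" and nz: "z j $ 1 * z k $ 2 - z j $ 2 * z k $ 1 \<noteq> 0"
    and z': "\<And>k. k < r \<Longrightarrow> z' k = torus_act n (l k) (m k) (z k)"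
  have "z' j $ 1 * z' k $ 2 - z' j $ 2 * z' k $ 1 = l j * l k * (z j $ 1 * z k $ 2 - z j $ 2 * z k $ 1)"
    unfolding z'[OF assms(1)] z'[OF assms(2)] by (simp add: algebra_simps)
  then show "z' j $ 1 * z' k $ 2 - z' j $ 2 * z' k $ 1 \<noteq> 0" using nz lm assms by simp
qed simp

lemma open_condition_general_for_sections: "open_condition n r (general_for_sections n r)"
proof -
  have "open_condition n r (\<lambda>z. \<forall>k<r. z k $ 1 \<noteq> 0)"
    by (intro open_condition_all_less open_condition_nonzero[OF _ coord_hirz_sections(1), of _ _ "vec4 1 1 1 1"]) auto
  moreover have "open_condition n r (\<lambda>z. \<forall>k<r. z k $ 3 \<noteq> 0)"
    by (intro open_condition_all_less open_condition_nonzero[OF _ coord_hirz_sections(2), of _ _ "vec4 1 1 1 1"]) auto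
  moreover have "open_condition n r
      (\<lambda>z. \<forall>j<r. \<forall>k<r. j \<noteq> k \<longrightarrow> z j $ 1 * z k $ 2 - z j $ 2 * z k $ 1 \<noteq> 0)"
    by (intro open_condition_all_less open_condition_imp open_condition_distinct)
  moreover have "open_condition n r
      (\<lambda>z. \<forall>e<r. r = 2 * e + n + 1 \<longrightarrow> (\<forall>j<r. interp_cond e n (skip j) z))"
    by (intro open_condition_all_less open_condition_imp open_condition_interp_cond inj_skip)
       (metis Suc_eq_plus1 skip_less)
  ultimately show ?thesis
    unfolding general_for_sections_def[abs_def] by (intro open_condition_conj)
qed

lemma open_condition_general_position: "open_condition n r (general_position n r)"
proof -
  have "open_condition n r (\<lambda>z. n = 0 \<longrightarrow> general_for_sections n r (\<lambda>k. swap (z k)))"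
    using open_condition_swap open_condition_general_for_sections by (intro open_condition_imp) blast
  moreover have "open_condition n r (\<lambda>z. n = 1 \<and> r = 5 \<longrightarrow> general_for_conics z)"
  proof (rule open_condition_imp)
    assume nr: "n = 1 \<and> r = 5"
    have "open_condition n r (interp_cond 2 n (\<lambda>k. k))"
      by (rule open_condition_interp_cond) (use nr in auto)
    moreover have "open_condition n r (interp_cond 1 n (triple i j k))"
      if "i < 5" "j < 5" "k < 5" "i \<noteq> j \<and> j \<noteq> k \<and> i \<noteq> k" for i j k
      by (rule open_condition_interp_cond) (use nr that in \<open>auto simp: triple_def inj_on_def\<close>)
    then have "open_condition n r (\<lambda>z. \<forall>i<5. \<forall>j<5. \<forall>k<5. i \<noteq> j \<and> j \<noteq> k \<and> i \<noteq> k \<longrightarrow>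
        interp_cond 1 n (triple i j k) z)"
      by (intro open_condition_all_less open_condition_imp) auto
    ultimately show "open_condition n r general_for_conics"
      unfolding general_for_conics_def[abs_def] using nr by (intro open_condition_conj) auto
  qed
  ultimately show ?thesis
    unfolding general_position_def[abs_def]
    using open_condition_general_for_sections by (intro open_condition_conj)
qed

section \<open>Existence of the listed curves\<close>

lemma listed_blowup_curve:
  assumes gen: "general_for_sections n r z" and con: "n = 1 \<and> r = 5 \<longrightarrow> general_for_conics z"
    and z: "\<And>k. k < r \<Longrightarrow> z k = vec4 1 (x k) 1 (y k)"
    and p: "\<And>k. k < r \<Longrightarrow> p k = Defs.orbit n (z k)"
    and listed: "listed n r a b"
  shows "\<exists>f \<phi>. blowup_curve n r z p a b f \<phi>"
proof -
  consider "n = 1" "a = 0" "b = 2" "r = 5" | "a = 1" "b = 0" "r = 1" | "b = 1" "r = 2 * a + n + 1"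
    using listed unfolding listed_def by blast
  then show ?thesis
  proof cases
    case 1
    then show ?thesis
      using conic_blowup_curve[of z x y p] z p con unfolding general_for_conics_def by simp
  next
    case 2
    then show ?thesis using fiber_blowup_curve[of z "x 0" "y 0" p n] z p by auto
  next
    case 3
    have "inj_on x {..<r}"
    proof (rule inj_onI, rule ccontr)
      fix j k assume "j \<in> {..<r}" "k \<in> {..<r}" "x j = x k" "j \<noteq> k"
      moreover from this have "z j $ 1 * z k $ 2 - z j $ 2 * z k $ 1 \<noteq> 0"
        using gen unfolding general_for_sections_def by blast
      ultimately show False using z by simp
    qed
    moreover have "interp_cond a n (skip j) z" if "j < r" for j
      using gen 3 that unfolding general_for_sections_def by auto
    ultimately show ?thesis using section_blowup_curve[of r a n z x y p] 3 z p by auto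
  qed
qed

lemma blowup_curve_result:
  assumes "blowup_curve n r z p a b f \<phi>" "listed_up_to_swap n r a b"
  shows "\<exists>E. minus_one_curve n r p E \<and> system_is_curve n r p a b 1 E"
proof -
  interpret blowup_curve n r z p a b f \<phi> by fact
  have "2 * a * b + n * b * b + 1 = r" "2 * a + 2 * b + n * b = r + 1"
    using assms(2) unfolding listed_up_to_swap_def listed_def by auto
  then show ?thesis using minus_one_curve system_is_curve by blast
qed

lemma general_position_normalized:
  assumes z: "general_position n r z" and norm: "\<And>k. k < r \<Longrightarrow> z k = vec4 1 (x k) 1 (y k)"
    and p: "\<And>k. k < r \<Longrightarrow> p k = Defs.orbit n (z k)"
    and listed: "listed_up_to_swap n r a b"
  shows "\<exists>E. minus_one_curve n r p E \<and> system_is_curve n r p a b 1 E"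
proof (cases "listed n r a b")
  case True
  have "\<exists>f \<phi>. blowup_curve n r z p a b f \<phi>"
    by (rule listed_blowup_curve[OF _ _ _ _ True]) (use z norm p in \<open>auto simp: general_position_def\<close>)
  then show ?thesis using blowup_curve_result[OF _ listed] by blast
next
  case False
  then have n0: "n = 0" and l: "listed 0 r b a" using listed unfolding listed_up_to_swap_def by auto
  \<comment> \<open>The exchanged class is listed for the centres \<open>swap (z k)\<close>, whose
    normal form has \<open>x\<close> and \<open>y\<close> interchanged; a second exchange moves the
    curve back.\<close>
  define p' where "p' k = Defs.orbit 0 (swap (z k))" for k
  have "\<exists>f \<phi>. blowup_curve 0 r (\<lambda>k. swap (z k)) p' b a f \<phi>"
  proof (rule listed_blowup_curve[OF _ _ _ _ l])
    show "general_for_sections 0 r (\<lambda>k. swap (z k))" using z n0 unfolding general_position_def by simp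
    show "swap (z k) = vec4 1 (y k) 1 (x k)" if "k < r" for k using norm[OF that] by (simp add: swap_def)
  qed (auto simp: p'_def)
  then obtain f \<phi> where "blowup_curve 0 r (\<lambda>k. swap (z k)) p' b a f \<phi>" by blast
  then have "blowup_curve 0 r (\<lambda>k. swap (swap (z k))) p a b (\<lambda>z. f (swap z)) (\<lambda>t. swap (\<phi> t))"
    using p n0 by (intro swap_blowup_curve) auto
  then show ?thesis using blowup_curve_result[OF _ listed] n0 by blast
qed

theorem mainTheorem2:
  fixes n r :: nat
  assumes "r \<ge> 1"
  shows "\<exists>U. zariski_open_prod n r U \<and> U \<noteq> {} \<and>
    (\<forall>p\<in>U. inj_on p {..<r} \<and> (\<forall>i<r. p i \<notin> negative_curve n) \<and>
      (\<forall>a b :: nat.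
        ((\<exists>E. minus_one_curve n r p E \<and> belongs_to_system n r p a b 1 E)
           \<longleftrightarrow> listed_up_to_swap n r a b) \<and>
        (listed_up_to_swap n r a b \<longrightarrow>
           (\<exists>E. minus_one_curve n r p E \<and> system_is_curve n r p a b 1 E))))"
proof -
  define U where "U = {\<lambda>k\<in>{..<r}. Defs.orbit n (z k) | z. (\<forall>k<r. z k \<in> cox_points) \<and> general_position n r z}"
  have "zariski_open_prod n r U"
    unfolding U_def by (rule zariski_open_prod_open_condition[OF open_condition_general_position])
  moreover have "U \<noteq> {}"
  proof -
    obtain z where z: "general_position n r z"
      using open_condition_general_position unfolding open_condition_def by blast
    \<comment> \<open>The witness is a tuple of arbitrary vectors; nonzero first and third
      coordinates make it a tuple of points.\<close>
    then have "\<forall>k<r. z k \<in> cox_points"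
      unfolding general_position_def general_for_sections_def cox_points_def by simp
    then show ?thesis using z unfolding U_def by blast
  qed
  moreover have "inj_on p {..<r} \<and> (\<forall>i<r. p i \<notin> negative_curve n) \<and>
      (\<forall>a b :: nat.
        ((\<exists>E. minus_one_curve n r p E \<and> belongs_to_system n r p a b 1 E)
           \<longleftrightarrow> listed_up_to_swap n r a b) \<and>
        (listed_up_to_swap n r a b \<longrightarrow>
           (\<exists>E. minus_one_curve n r p E \<and> system_is_curve n r p a b 1 E)))" if pU: "p \<in> U" for p
  proof -
    obtain z0 where z0: "p = (\<lambda>k\<in>{..<r}. Defs.orbit n (z0 k))" "general_position n r z0"
      using pU unfolding U_def by blast
    \<comment> \<open>Scaling by \<open>l = 1 / z$1\<close> makes the first coordinate 1 and the
      third \<open>m * z$3 * z$1 ^ n\<close>, which dictates \<open>m\<close>.\<close>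
    define x where "x k = z0 k $ 2 / z0 k $ 1" for k
    define y where "y k = z0 k $ 4 / (z0 k $ 3 * z0 k $ 1 ^ n)" for k
    define z where "z k = vec4 1 (x k) 1 (y k)" for k
    have norm: "inverse (z0 k $ 1) \<noteq> 0 \<and> inverse (z0 k $ 3 * z0 k $ 1 ^ n) \<noteq> 0 \<and>
        z k = torus_act n (inverse (z0 k $ 1)) (inverse (z0 k $ 3 * z0 k $ 1 ^ n)) (z0 k)" if "k < r" for k
    proof -
      have "z0 k $ 1 \<noteq> 0" "z0 k $ 3 \<noteq> 0"
        using z0(2) that unfolding general_position_def general_for_sections_def by auto
      then show ?thesis by (simp add: vec4_eq_iff z_def x_def y_def field_simps)
    qed
    have p: "p k = Defs.orbit n (z k)" if "k < r" for k
      using norm[OF that] that orbit_torus_act unfolding z0(1) by simp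
    \<comment> \<open>Torus invariance carries general position over to the normalized
      representatives.\<close>
    have gen: "general_position n r z"
      using open_condition_general_position[of n r] z0(2) norm unfolding open_condition_def by blast
    have "inj_on p {..<r}"
    proof (rule inj_onI, rule ccontr)
      fix j k assume jk: "j \<in> {..<r}" "k \<in> {..<r}" "p j = p k" "j \<noteq> k"
      then have "Defs.orbit n (z j) = Defs.orbit n (z k)" using p by simp
      then obtain l m where "z k = torus_act n l m (z j)" by (rule orbit_eqE)
      then have "x j = x k" by (simp add: z_def vec4_eq_iff)
      moreover have "z j $ 1 * z k $ 2 - z j $ 2 * z k $ 1 \<noteq> 0"
        using gen jk unfolding general_position_def general_for_sections_def by blast
      ultimately show False by (simp add: z_def)
    qed
    moreover have "p i \<notin> negative_curve n" if "i < r" for i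
    proof -
      have "z i \<in> p i" "z i $ 3 \<noteq> 0" using p[OF that] self_in_orbit by (auto simp: z_def)
      then show ?thesis unfolding negative_curve_def by blast
    qed
    moreover have nonempty: "\<forall>i<r. p i \<noteq> {}" using p self_in_orbit by blast
    moreover have curve: "\<exists>E. minus_one_curve n r p E \<and> system_is_curve n r p a b 1 E"
      if "listed_up_to_swap n r a b" for a b
      using general_position_normalized[OF gen _ p that] z_def by blast
    moreover have "belongs_to_system n r p a b 1 E" if "system_is_curve n r p a b 1 E" for a b E
      using that unfolding system_is_curve_def belongs_to_system_def by blast
    moreover have "listed_up_to_swap n r a b"
      if "minus_one_curve n r p E" "belongs_to_system n r p a b 1 E" for a b E
      using class_equations_listed minus_one_curve_class_equations[OF that nonempty] by blast
    ultimately show ?thesis by blast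
  qed
  ultimately show ?thesis by blast
qed

end
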